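(* Let $(S,\|\cdot\|)$ be a complete $RN$ module over $C$ with base $(\Omega,\mathcal F,P)$. For a module homomorphism $A:D(A)\subset S\to S$ the following assertions are equivalent. (a) $(A,D(A))$ generates a contraction $C_{0}$--semigroup. (b) $(A,D(A))$ is closed, densely defined, and for each $\xi\in L^{0}_{++}(\mathcal F)$ one has $\xi\in\rho(A)$ and $\|\xi R(\xi,A)\|\leq 1$. (c) $(A,D(A))$ is closed, densely defined, and for each $\xi\in L^{0}(\mathcal F,C)$ with $\mathrm{Re}\,\xi\in L^{0}_{++}(\mathcal F)$ one has $\xi\in\rho(A)$ and $\|R(\xi,A)\|\leq\frac{1}{\mathrm{Re}\,\xi}$.
   Context: $(\Omega,\mathcal F,P)$ is a probability space; $L^{0}(\mathcal F,K)$ ($K=R$ or $C$) is the algebra of equivalence classes of $K$-valued $\mathcal F$-measurable random variables, ordered a.s.; $L^{0}_{+}(\mathcal F)=\{\xi\in L^0(\mathcal F,R):\xi\ge 0\}$, $L^{0}_{++}(\mathcal F)=\{\xi\in L^0(\mathcal F,R):\xi>0\text{ a.s.}\}$. An $RN$ module over $K$ with base $(\Omega,\mathcal F,P)$ is a left $L^0(\mathcal F,K)$-module $S$ with a map $\|\cdot\|:S\to L^0_+(\mathcal F)$ such that $\|\xi x\|=|\xi|\|x\|$, $\|x+y\|\le\|x\|+\|y\|$, $\|x\|=0\Rightarrow x=0$; it carries the $(\varepsilon,\lambda)$-topology, in which $x_n\to x$ iff $\|x_n-x\|\to0$ in probability; completeness refers to this topology. $B(S)$ is the set of continuous module homomorphisms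 $S\to S$, with $\|T\|=\bigwedge\{\xi\in L^0_+(\mathcal F):\|Tx\|\le\xi\|x\|\ \forall x\}$. A $C_0$--semigroup is $\{T(t):t\ge0\}\subset B(S)$ with $T(0)=I$, $T(s)T(t)=T(s+t)$, $\lim_{t\downarrow0}T(t)x=x$ for all $x$; it is a contraction $C_0$--semigroup if $\|T(t)\|\le1$ for all $t\ge0$. Its infinitesimal generator is $Ax=\lim_{t\downarrow0}\frac{T(t)x-x}{t}$ on $D(A)=\{x:\text{the limit exists}\}$; "$(A,D(A))$ generates the semigroup" means $A$ is its infinitesimal generator. $A$ is closed if its graph is closed in $S\times S$; densely defined if $D(A)$ is dense. $\rho(A)=\{\xi\in L^0(\mathcal F,C):\xi I-A:D(A)\to S\text{ is bijective and }(\xi I-A)^{-1}\in B(S)\}$, $R(\xi,A)=(\xi I-A)^{-1}$. *)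

theory Defs
  imports "HOL-Probability.Probability"
begin

text \<open>
  Conventions.  The base probability space is M.  An element of L0(F,K) is represented
  by an F-measurable function 'w => K; two representatives denote the same class iff
  they agree almost everywhere.  The RN module S is the whole type 's (an abelian group);
  the L0(F,C)-module action is sm, and the random norm is nrm (its values are
  representatives of elements of L0_+(F); all (in)equalities between them are read a.e.).
\<close>

definition RN_module ::
  "'w measure \<Rightarrow> (('w \<Rightarrow> complex) \<Rightarrow> 's::ab_group_add \<Rightarrow> 's) \<Rightarrow> ('s \<Rightarrow> 'w \<Rightarrow> real) \<Rightarrow> bool" where
  "RN_module M sm nrm \<longleftrightarrow>
     (\<forall>\<xi> \<eta> x. \<xi> \<in> borel_measurable M \<longrightarrow> \<eta> \<in> borel_measurable M \<longrightarrow>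
        (AE \<omega> in M. \<xi> \<omega> = \<eta> \<omega>) \<longrightarrow> sm \<xi> x = sm \<eta> x) \<and>
     (\<forall>\<xi> x y. \<xi> \<in> borel_measurable M \<longrightarrow> sm \<xi> (x + y) = sm \<xi> x + sm \<xi> y) \<and>
     (\<forall>\<xi> \<eta> x. \<xi> \<in> borel_measurable M \<longrightarrow> \<eta> \<in> borel_measurable M \<longrightarrow>
        sm (\<lambda>\<omega>. \<xi> \<omega> + \<eta> \<omega>) x = sm \<xi> x + sm \<eta> x) \<and>
     (\<forall>\<xi> \<eta> x. \<xi> \<in> borel_measurable M \<longrightarrow> \<eta> \<in> borel_measurable M \<longrightarrow>
        sm (\<lambda>\<omega>. \<xi> \<omega> * \<eta> \<omega>) x = sm \<xi> (sm \<eta> x)) \<and>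
     (\<forall>x. sm (\<lambda>\<omega>. 1) x = x) \<and>
     (\<forall>x. nrm x \<in> borel_measurable M \<and> (AE \<omega> in M. 0 \<le> nrm x \<omega>)) \<and>
     (\<forall>\<xi> x. \<xi> \<in> borel_measurable M \<longrightarrow>
        (AE \<omega> in M. nrm (sm \<xi> x) \<omega> = cmod (\<xi> \<omega>) * nrm x \<omega>)) \<and>
     (\<forall>x y. AE \<omega> in M. nrm (x + y) \<omega> \<le> nrm x \<omega> + nrm y \<omega>) \<and>
     (\<forall>x. (AE \<omega> in M. nrm x \<omega> = 0) \<longrightarrow> x = 0)"

text \<open>Convergence in the (epsilon,lambda)-topology along a filter:
  nrm (f t - x) tends to 0 in probability.\<close>
definition rn_tendsto ::
  "'w measure \<Rightarrow> ('s::ab_group_add \<Rightarrow> 'w \<Rightarrow> real) \<Rightarrow> ('a \<Rightarrow> 's) \<Rightarrow> 's \<Rightarrow> 'a filter \<Rightarrow> bool" where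
  "rn_tendsto M nrm f x F \<longleftrightarrow>
     (\<forall>e>0. ((\<lambda>t. measure M {\<omega> \<in> space M. e \<le> nrm (f t - x) \<omega>}) \<longlongrightarrow> 0) F)"

definition rn_Cauchy ::
  "'w measure \<Rightarrow> ('s::ab_group_add \<Rightarrow> 'w \<Rightarrow> real) \<Rightarrow> (nat \<Rightarrow> 's) \<Rightarrow> bool" where
  "rn_Cauchy M nrm f \<longleftrightarrow>
     (\<forall>e>0. ((\<lambda>(n, m). measure M {\<omega> \<in> space M. e \<le> nrm (f n - f m) \<omega>}) \<longlongrightarrow> 0)
              (sequentially \<times>\<^sub>F sequentially))"

definition rn_complete ::
  "'w measure \<Rightarrow> ('s::ab_group_add \<Rightarrow> 'w \<Rightarrow> real) \<Rightarrow> bool" where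
  "rn_complete M nrm \<longleftrightarrow> (\<forall>f. rn_Cauchy M nrm f \<longrightarrow> (\<exists>x. rn_tendsto M nrm f x sequentially))"

definition bounded_op ::
  "'w measure \<Rightarrow> (('w \<Rightarrow> complex) \<Rightarrow> 's::ab_group_add \<Rightarrow> 's) \<Rightarrow> ('s \<Rightarrow> 'w \<Rightarrow> real) \<Rightarrow> ('s \<Rightarrow> 's) \<Rightarrow> bool" where
  "bounded_op M sm nrm T \<longleftrightarrow>
     (\<forall>x y. T (x + y) = T x + T y) \<and>
     (\<forall>\<xi> x. \<xi> \<in> borel_measurable M \<longrightarrow> T (sm \<xi> x) = sm \<xi> (T x)) \<and>
     (\<forall>f x. rn_tendsto M nrm f x sequentially \<longrightarrow> rn_tendsto M nrm (\<lambda>n. T (f n)) (T x) sequentially)"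

definition L0_glb :: "'w measure \<Rightarrow> ('w \<Rightarrow> real) set \<Rightarrow> ('w \<Rightarrow> real) \<Rightarrow> bool" where
  "L0_glb M H \<xi> \<longleftrightarrow> \<xi> \<in> borel_measurable M \<and>
     (\<forall>h\<in>H. AE \<omega> in M. \<xi> \<omega> \<le> h \<omega>) \<and>
     (\<forall>\<eta>\<in>borel_measurable M. (\<forall>h\<in>H. AE \<omega> in M. \<eta> \<omega> \<le> h \<omega>) \<longrightarrow> (AE \<omega> in M. \<eta> \<omega> \<le> \<xi> \<omega>))"

definition opnorm :: "'w measure \<Rightarrow> ('s \<Rightarrow> 'w \<Rightarrow> real) \<Rightarrow> ('s \<Rightarrow> 's) \<Rightarrow> 'w \<Rightarrow> real" where
  "opnorm M nrm T = (SOME \<xi>. L0_glb M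
      {\<xi>'. \<xi>' \<in> borel_measurable M \<and> (AE \<omega> in M. 0 \<le> \<xi>' \<omega>) \<and>
           (\<forall>x. AE \<omega> in M. nrm (T x) \<omega> \<le> \<xi>' \<omega> * nrm x \<omega>)} \<xi>)"

definition C0_semigroup ::
  "'w measure \<Rightarrow> (('w \<Rightarrow> complex) \<Rightarrow> 's::ab_group_add \<Rightarrow> 's) \<Rightarrow> ('s \<Rightarrow> 'w \<Rightarrow> real) \<Rightarrow> (real \<Rightarrow> 's \<Rightarrow> 's) \<Rightarrow> bool" where
  "C0_semigroup M sm nrm T \<longleftrightarrow>
     (\<forall>t\<ge>0. bounded_op M sm nrm (T t)) \<and>
     T 0 = id \<and>
     (\<forall>s\<ge>0. \<forall>t\<ge>0. T s \<circ> T t = T (s + t)) \<and>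
     (\<forall>x. rn_tendsto M nrm (\<lambda>t. T t x) x (at_right 0))"

definition contraction_C0_semigroup ::
  "'w measure \<Rightarrow> (('w \<Rightarrow> complex) \<Rightarrow> 's::ab_group_add \<Rightarrow> 's) \<Rightarrow> ('s \<Rightarrow> 'w \<Rightarrow> real) \<Rightarrow> (real \<Rightarrow> 's \<Rightarrow> 's) \<Rightarrow> bool" where
  "contraction_C0_semigroup M sm nrm T \<longleftrightarrow>
     C0_semigroup M sm nrm T \<and> (\<forall>t\<ge>0. AE \<omega> in M. opnorm M nrm (T t) \<omega> \<le> 1)"

definition generates ::
  "'w measure \<Rightarrow> (('w \<Rightarrow> complex) \<Rightarrow> 's::ab_group_add \<Rightarrow> 's) \<Rightarrow> ('s \<Rightarrow> 'w \<Rightarrow> real)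
   \<Rightarrow> ('s \<Rightarrow> 's) \<Rightarrow> 's set \<Rightarrow> (real \<Rightarrow> 's \<Rightarrow> 's) \<Rightarrow> bool" where
  "generates M sm nrm A D T \<longleftrightarrow>
     D = {x. \<exists>y. rn_tendsto M nrm (\<lambda>t. sm (\<lambda>\<omega>. complex_of_real (1 / t)) (T t x - x)) y (at_right 0)} \<and>
     (\<forall>x\<in>D. rn_tendsto M nrm (\<lambda>t. sm (\<lambda>\<omega>. complex_of_real (1 / t)) (T t x - x)) (A x) (at_right 0))"

definition module_hom_on ::
  "'w measure \<Rightarrow> (('w \<Rightarrow> complex) \<Rightarrow> 's::ab_group_add \<Rightarrow> 's) \<Rightarrow> 's set \<Rightarrow> ('s \<Rightarrow> 's) \<Rightarrow> bool" where
  "module_hom_on M sm D A \<longleftrightarrow>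
     0 \<in> D \<and> (\<forall>x\<in>D. \<forall>y\<in>D. x + y \<in> D) \<and>
     (\<forall>\<xi> x. \<xi> \<in> borel_measurable M \<longrightarrow> x \<in> D \<longrightarrow> sm \<xi> x \<in> D) \<and>
     (\<forall>x\<in>D. \<forall>y\<in>D. A (x + y) = A x + A y) \<and>
     (\<forall>\<xi> x. \<xi> \<in> borel_measurable M \<longrightarrow> x \<in> D \<longrightarrow> A (sm \<xi> x) = sm \<xi> (A x))"

definition closed_op ::
  "'w measure \<Rightarrow> ('s::ab_group_add \<Rightarrow> 'w \<Rightarrow> real) \<Rightarrow> ('s \<Rightarrow> 's) \<Rightarrow> 's set \<Rightarrow> bool" where
  "closed_op M nrm A D \<longleftrightarrow>
     (\<forall>f x y. (\<forall>n. f n \<in> D) \<longrightarrow> rn_tendsto M nrm f x sequentially \<longrightarrow>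
        rn_tendsto M nrm (\<lambda>n. A (f n)) y sequentially \<longrightarrow> x \<in> D \<and> A x = y)"

definition dense_set ::
  "'w measure \<Rightarrow> ('s::ab_group_add \<Rightarrow> 'w \<Rightarrow> real) \<Rightarrow> 's set \<Rightarrow> bool" where
  "dense_set M nrm D \<longleftrightarrow> (\<forall>x. \<exists>f. (\<forall>n. f n \<in> D) \<and> rn_tendsto M nrm f x sequentially)"

definition resolvent ::
  "(('w \<Rightarrow> complex) \<Rightarrow> 's::ab_group_add \<Rightarrow> 's) \<Rightarrow> ('s \<Rightarrow> 's) \<Rightarrow> 's set \<Rightarrow> ('w \<Rightarrow> complex) \<Rightarrow> 's \<Rightarrow> 's" where
  "resolvent sm A D \<xi> = the_inv_into D (\<lambda>x. sm \<xi> x - A x)"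

definition in_resolvent_set ::
  "'w measure \<Rightarrow> (('w \<Rightarrow> complex) \<Rightarrow> 's::ab_group_add \<Rightarrow> 's) \<Rightarrow> ('s \<Rightarrow> 'w \<Rightarrow> real)
   \<Rightarrow> ('s \<Rightarrow> 's) \<Rightarrow> 's set \<Rightarrow> ('w \<Rightarrow> complex) \<Rightarrow> bool" where
  "in_resolvent_set M sm nrm A D \<xi> \<longleftrightarrow>
     \<xi> \<in> borel_measurable M \<and>
     bij_betw (\<lambda>x. sm \<xi> x - A x) D UNIV \<and>
     bounded_op M sm nrm (resolvent sm A D \<xi>)"

end

theory Submission
  imports Defs
begin

text \<open>
  Convergence in probability is metrized by \<open>rho x = E (min 1 (nrm x))\<close>, and a continuous module
  homomorphism has a least almost sure bound, so the three assertions become statements about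
  almost sure norm inequalities.

  For a contraction semigroup \<open>T\<close> the orbit integral \<open>\<integral>\<^sub>0\<^sup>t T s x ds\<close> is a limit of dyadic Riemann
  sums.  These need not converge for a merely continuous function, because the topology is not
  locally convex; but after multiplying \<open>x\<close> by a positive random variable one may assume
  \<open>nrm x \<le> 1 / 2\<close>, and then the expected norm of \<open>T s x - x\<close> tends to \<open>0\<close>.  The integrals yield
  density of the domain and closedness of the generator; integrating the rescaled semigroup
  \<open>exp (- t \<xi>) (T t)\<close> over the unit interval gives surjectivity of \<open>\<xi> I - A\<close>, and dissipativity of
  the difference quotients gives injectivity and the resolvent bound.

  Conversely, let \<open>J n = 2^n R(2^n, A)\<close> and \<open>U n t = J n ^^ \<lfloor>2^n t\<rfloor>\<close> (implicit Euler scheme with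
  step \<open>2^-n\<close>).  On the dense domain of \<open>A\<^sup>2\<close> halving the step changes \<open>U n t x\<close> by
  \<open>O(2^-n)\<close>, so \<open>U n t\<close> converges to a contraction semigroup.  Its generator extends \<open>A\<close>, and equals
  \<open>A\<close> because \<open>I - A\<close> is surjective while \<open>I\<close> minus the generator is injective.
\<close>

section \<open>Convergence in probability\<close>

text \<open>Each norm inequality has its own null set, depending on the vectors and the time, so
  estimates cannot be imposed at uncountably many times at once. This is why the integral and the
  semigroup are built from finitely many dyadic times at each level, and why limits are taken
  through \<open>rho\<close>. The real part of \<xi> may come arbitrarily close to 0. The rescaled
  semigroup then has no deterministic decay rate, and the geometric series that replaces the Laplace
  integral converges only with a random ratio. An Euler scheme suits this setting because it
  consists of powers of contractions: its error is a finite sum of almost sure inequalities, and no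
  exponential series of an operator has to be summed. With step \<open>2^-n\<close> the grids are
  nested, and one coarse step faces exactly two fine ones. Such a pair differs by order
  \<open>4^-n\<close>, there are about \<open>2^n t\<close> pairs, and contractions do not amplify
  earlier errors; this gives the rate \<open>2^-n\<close>.\<close>

context prob_space
begin

definition pmag :: "('a \<Rightarrow> real) \<Rightarrow> real" where
  "pmag f = expectation (\<lambda>\<omega>. min 1 \<bar>f \<omega>\<bar>)"

lemma integrable_min_abs [simp]:
  fixes f :: "'a \<Rightarrow> real"
  assumes [measurable]: "f \<in> borel_measurable M"
  shows "integrable M (\<lambda>\<omega>. min 1 \<bar>f \<omega>\<bar>)"
  by (rule integrable_const_bound[where B=1]) auto

lemma pmag_nonneg: "0 \<le> pmag f"
  unfolding pmag_def by (rule integral_nonneg_AE) auto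

lemma pmag_mono:
  assumes [measurable]: "f \<in> borel_measurable M" "g \<in> borel_measurable M"
    and "AE \<omega> in M. \<bar>f \<omega>\<bar> \<le> \<bar>g \<omega>\<bar>"
  shows "pmag f \<le> pmag g"
  unfolding pmag_def using assms(3) by (intro integral_mono_AE) auto

lemma pmag_add_le:
  assumes [measurable]: "f \<in> borel_measurable M" "g \<in> borel_measurable M"
  shows "pmag (\<lambda>\<omega>. f \<omega> + g \<omega>) \<le> pmag f + pmag g"
proof -
  have "pmag (\<lambda>\<omega>. f \<omega> + g \<omega>) \<le> expectation (\<lambda>\<omega>. min 1 \<bar>f \<omega>\<bar> + min 1 \<bar>g \<omega>\<bar>)"
    unfolding pmag_def by (intro integral_mono) auto
  also have "\<dots> = pmag f + pmag g"
    unfolding pmag_def by (intro Bochner_Integration.integral_add) auto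
  finally show ?thesis .
qed

lemma pmag_tendsto_AE:
  assumes [measurable]: "\<And>n. f n \<in> borel_measurable M" "g \<in> borel_measurable M"
    and "AE \<omega> in M. (\<lambda>n. f n \<omega>) \<longlonglongrightarrow> g \<omega>"
  shows "(\<lambda>n. pmag (f n)) \<longlonglongrightarrow> pmag g"
  unfolding pmag_def
proof (rule integral_dominated_convergence[where w="\<lambda>_. 1"])
  show "AE \<omega> in M. (\<lambda>n. min 1 \<bar>f n \<omega>\<bar>) \<longlonglongrightarrow> min 1 \<bar>g \<omega>\<bar>"
    using assms(3) by eventually_elim (intro tendsto_intros)
qed auto

lemma pmag_zero [simp]: "pmag (\<lambda>_. 0) = 0"
  by (simp add: pmag_def)

lemma pmag_eq_0D:
  assumes [measurable]: "f \<in> borel_measurable M" and "pmag f = 0"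
  shows "AE \<omega> in M. f \<omega> = 0"
proof -
  have "AE \<omega> in M. min 1 \<bar>f \<omega>\<bar> = 0"
    using assms(2) unfolding pmag_def by (subst (asm) integral_nonneg_eq_0_iff_AE) auto
  then show ?thesis by eventually_elim (auto simp: min_def split: if_splits)
qed

text \<open>Below the level \<open>e\<close> the truncation is at most \<open>e\<close>, above it at
  most 1. Together with the Markov-type converse \<open>prob_le_pmag\<close> this identifies
  convergence in probability with \<open>pmag\<close> tending to 0.\<close>

lemma pmag_le_prob:
  assumes [measurable]: "f \<in> borel_measurable M" and f0: "AE \<omega> in M. 0 \<le> f \<omega>" and "0 < e"
  shows "pmag f \<le> e + prob {\<omega> \<in> space M. e \<le> f \<omega>}"
proof -
  have "pmag f \<le> expectation (\<lambda>\<omega>. e + indicat_real {\<omega> \<in> space M. e \<le> f \<omega>} \<omega>)"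
    unfolding pmag_def
  proof (intro integral_mono_AE)
    show "AE \<omega> in M. min 1 \<bar>f \<omega>\<bar> \<le> e + indicat_real {\<omega> \<in> space M. e \<le> f \<omega>} \<omega>"
      using f0 AE_space by eventually_elim (use \<open>0 < e\<close> in \<open>auto simp: indicator_def\<close>)
  qed (auto simp: emeasure_eq_measure)
  also have "\<dots> = e + prob {\<omega> \<in> space M. e \<le> f \<omega>}"
    by (subst Bochner_Integration.integral_add) (auto simp: emeasure_eq_measure prob_space)
  finally show ?thesis .
qed

lemma prob_le_pmag:
  assumes [measurable]: "f \<in> borel_measurable M" and "0 < e"
  shows "min 1 e * prob {\<omega> \<in> space M. e \<le> f \<omega>} \<le> pmag f"
proof -
  have [simp]: "integrable M (indicat_real {\<omega> \<in> space M. e \<le> f \<omega>})"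
    by (simp add: emeasure_eq_measure)
  have "min 1 e * prob {\<omega> \<in> space M. e \<le> f \<omega>}
      = expectation (\<lambda>\<omega>. min 1 e * indicat_real {\<omega> \<in> space M. e \<le> f \<omega>} \<omega>)"
    by (simp add: emeasure_eq_measure)
  also have "\<dots> \<le> pmag f"
    unfolding pmag_def
    by (intro integral_mono) (use \<open>0 < e\<close> in \<open>auto split: split_indicator\<close>)
  finally show ?thesis .
qed

text \<open>The factor \<open>c\<close> may be unbounded, so no constant can be pulled out. Off an
  event of small probability \<open>c\<close> is bounded, and on that event the truncation caps the
  product at 1. This is what makes the action of a random scalar continuous, along any
  filter.\<close>

lemma pmag_mult_tendsto:
  assumes [measurable]: "c \<in> borel_measurable M"
    and f: "\<And>t. f t \<in> borel_measurable M"
    and lim: "((\<lambda>t. pmag (f t)) \<longlongrightarrow> 0) F"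
  shows "((\<lambda>t. pmag (\<lambda>\<omega>. c \<omega> * f t \<omega>)) \<longlongrightarrow> 0) F"
proof (rule order_tendstoI)
  fix a :: real assume "a < 0"
  then show "\<forall>\<^sub>F t in F. a < pmag (\<lambda>\<omega>. c \<omega> * f t \<omega>)"
    by (intro always_eventually allI less_le_trans[OF _ pmag_nonneg])
next
  fix a :: real assume a: "0 < a"
  have "(\<lambda>n. pmag (\<lambda>\<omega>. indicat_real {\<omega>' \<in> space M. real n < \<bar>c \<omega>'\<bar>} \<omega>)) \<longlonglongrightarrow> pmag (\<lambda>_. 0)"
  proof (rule pmag_tendsto_AE)
    show "AE \<omega> in M. (\<lambda>n. indicat_real {\<omega>' \<in> space M. real n < \<bar>c \<omega>'\<bar>} \<omega>) \<longlonglongrightarrow> 0"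
    proof (rule AE_I2)
      fix \<omega>
      obtain N :: nat where N: "\<bar>c \<omega>\<bar> \<le> real N" using real_arch_simple by blast
      have "\<forall>\<^sub>F n in sequentially. indicat_real {\<omega>' \<in> space M. real n < \<bar>c \<omega>'\<bar>} \<omega> = 0"
        by (rule eventually_sequentiallyI[of N]) (use N in \<open>auto simp: indicator_def\<close>)
      then show "(\<lambda>n. indicat_real {\<omega>' \<in> space M. real n < \<bar>c \<omega>'\<bar>} \<omega>) \<longlonglongrightarrow> 0"
        by (rule tendsto_eventually)
    qed
  qed measurable
  then have "\<forall>\<^sub>F n in sequentially. pmag (\<lambda>\<omega>. indicat_real {\<omega>' \<in> space M. real n < \<bar>c \<omega>'\<bar>} \<omega>) < a / 2"
    using a by (intro order_tendstoD(2)) auto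
  then obtain n where n: "pmag (\<lambda>\<omega>. indicat_real {\<omega>' \<in> space M. real n < \<bar>c \<omega>'\<bar>} \<omega>) < a / 2"
    by (auto simp: eventually_sequentially)
  \<comment> \<open>The extra 1 ensures \<open>1 \<le> K\<close> even if \<open>n = 0\<close>; this
    is needed for \<open>min 1 (K * a) \<le> K * min 1 a\<close>.\<close>
  define K where "K = real n + 1"
  have K: "1 \<le> K" by (simp add: K_def)
  have bound: "pmag (\<lambda>\<omega>. c \<omega> * g \<omega>) \<le> a / 2 + K * pmag g" if [measurable]: "g \<in> borel_measurable M" for g
  proof -
    have "pmag (\<lambda>\<omega>. c \<omega> * g \<omega>) \<le>
        expectation (\<lambda>\<omega>. min 1 \<bar>indicat_real {\<omega>' \<in> space M. real n < \<bar>c \<omega>'\<bar>} \<omega>\<bar> + K * min 1 \<bar>g \<omega>\<bar>)"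
      unfolding pmag_def
    proof (intro integral_mono)
      fix \<omega> assume w: "\<omega> \<in> space M"
      show "min 1 \<bar>c \<omega> * g \<omega>\<bar> \<le> min 1 \<bar>indicat_real {\<omega>' \<in> space M. real n < \<bar>c \<omega>'\<bar>} \<omega>\<bar> + K * min 1 \<bar>g \<omega>\<bar>"
      proof (cases "real n < \<bar>c \<omega>\<bar>")
        case True
        then show ?thesis using w K by (simp add: indicator_def min_le_iff_disj)
      next
        case False
        then have "\<bar>c \<omega>\<bar> * \<bar>g \<omega>\<bar> \<le> K * \<bar>g \<omega>\<bar>" by (intro mult_right_mono) (auto simp: K_def)
        moreover have "1 \<le> K * 1" using K by simp
        ultimately have "min 1 \<bar>c \<omega> * g \<omega>\<bar> \<le> K * min 1 \<bar>g \<omega>\<bar>"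
          by (cases "\<bar>g \<omega>\<bar> \<le> 1") (auto simp: abs_mult min_le_iff_disj min_absorb2 min_absorb1)
        then show ?thesis using K by (simp add: add_increasing)
      qed
    next
      show "integrable M (\<lambda>\<omega>. min 1 \<bar>indicat_real {\<omega>' \<in> space M. real n < \<bar>c \<omega>'\<bar>} \<omega>\<bar> + K * min 1 \<bar>g \<omega>\<bar>)"
        by (intro Bochner_Integration.integrable_add integrable_mult_right integrable_min_abs) measurable
    qed auto
    also have "\<dots> = pmag (\<lambda>\<omega>. indicat_real {\<omega>' \<in> space M. real n < \<bar>c \<omega>'\<bar>} \<omega>) + K * pmag g"
      unfolding pmag_def by (subst Bochner_Integration.integral_add) (auto simp: emeasure_eq_measure)
    finally show ?thesis using n by linarith
  qed
  have "\<forall>\<^sub>F t in F. pmag (f t) < a / (2 * K)"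
    using lim a K by (intro order_tendstoD(2)) auto
  then show "\<forall>\<^sub>F t in F. pmag (\<lambda>\<omega>. c \<omega> * f t \<omega>) < a"
  proof eventually_elim
    case (elim t)
    then have "K * pmag (f t) < a / 2" using K by (simp add: field_simps)
    then show ?case using bound[OF f[of t]] by linarith
  qed
qed

text \<open>A pointwise infimum over an uncountable family need not be measurable. Instead a
  decreasing sequence is chosen whose expectations approach their infimum \<open>m\<close>. If its
  limit \<open>g\<close> exceeded some \<open>h\<close> with positive probability,
  \<open>min g h\<close> would have expectation below \<open>m\<close>, although directedness puts a
  member of \<open>F\<close> below every \<open>min (f n) h\<close>.\<close>

lemma essential_infimum_of_directed_family:
  fixes F :: "('a \<Rightarrow> real) set"
  assumes ne: "F \<noteq> {}"
    and meas: "\<And>f. f \<in> F \<Longrightarrow> f \<in> borel_measurable M"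
    and bnd: "\<And>f. f \<in> F \<Longrightarrow> AE \<omega> in M. 0 \<le> f \<omega> \<and> f \<omega> \<le> 1"
    and dir: "\<And>f g. f \<in> F \<Longrightarrow> g \<in> F \<Longrightarrow> \<exists>h\<in>F. AE \<omega> in M. h \<omega> \<le> min (f \<omega>) (g \<omega>)"
  obtains f g where "\<And>n::nat. f n \<in> F" "g \<in> borel_measurable M"
    "AE \<omega> in M. (\<lambda>n. f n \<omega>) \<longlonglongrightarrow> g \<omega>" "\<And>h. h \<in> F \<Longrightarrow> AE \<omega> in M. g \<omega> \<le> h \<omega>"
proof -
  have int: "integrable M f" if "f \<in> F" for f
    by (rule integrable_const_bound[where B=1]) (use bnd[OF that] meas[OF that] in auto)
  define m where "m = Inf (expectation ` F)"
  have "0 \<le> expectation f" if "f \<in> F" for f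
    using bnd[OF that] by (intro integral_nonneg_AE) auto
  then have bdd: "bdd_below (expectation ` F)" by (intro bdd_belowI2)
  have m_le: "m \<le> expectation f" if "f \<in> F" for f
    unfolding m_def using bdd that by (intro cInf_lower) auto
  have "\<exists>a\<in>F. expectation a < m + 1 / real (Suc n)" for n
    using cInf_lessD[of "expectation ` F" "m + 1 / real (Suc n)"] ne unfolding m_def by auto
  then obtain a where a: "\<And>n. a n \<in> F" "\<And>n. expectation (a n) < m + 1 / real (Suc n)" by metis
  \<comment> \<open>Each term is chosen below its predecessor, for monotonicity, and below
    \<open>a n\<close>, for the expectations.\<close>
  obtain f where f: "\<And>n. f n \<in> F" "\<And>n. AE \<omega> in M. f (Suc n) \<omega> \<le> min (f n \<omega>) (a n \<omega>)"
    using dependent_nat_choice[of "\<lambda>_ f. f \<in> F" "\<lambda>n f h. AE \<omega> in M. h \<omega> \<le> min (f \<omega>) (a n \<omega>)"]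
      ne dir a(1) by (metis ex_in_conv)
  note [measurable] = meas[OF f(1)] meas[OF a(1)]
  define g where "g \<omega> = lim (\<lambda>n. f n \<omega>)" for \<omega>
  have [measurable]: "g \<in> borel_measurable M" unfolding g_def by measurable
  have "AE \<omega> in M. \<forall>n. 0 \<le> f n \<omega> \<and> f n \<omega> \<le> 1" using bnd[OF f(1)] by (simp add: AE_all_countable)
  moreover have "AE \<omega> in M. \<forall>n. f (Suc n) \<omega> \<le> min (f n \<omega>) (a n \<omega>)" using f(2) by (simp add: AE_all_countable)
  ultimately have g_lim: "AE \<omega> in M. (\<lambda>n. f n \<omega>) \<longlonglongrightarrow> g \<omega>"
  proof eventually_elim
    case (elim \<omega>)
    then have "decseq (\<lambda>n. f n \<omega>)" by (intro decseq_SucI) auto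
    then have "convergent (\<lambda>n. f n \<omega>)"
      using decseq_convergent[of "\<lambda>n. f n \<omega>" 0] elim by (metis convergentI)
    then show ?case unfolding g_def by (simp add: convergent_LIMSEQ_iff)
  qed
  have lim_int: "(\<lambda>n. expectation (\<lambda>\<omega>. min (f n \<omega>) (h \<omega>))) \<longlonglongrightarrow> expectation (\<lambda>\<omega>. min (g \<omega>) (h \<omega>))"
    if [measurable]: "h \<in> borel_measurable M" and h: "AE \<omega> in M. 0 \<le> h \<omega> \<and> h \<omega> \<le> 1" for h
  proof (rule integral_dominated_convergence[where w="\<lambda>_. 1"])
    show "AE \<omega> in M. (\<lambda>n. min (f n \<omega>) (h \<omega>)) \<longlonglongrightarrow> min (g \<omega>) (h \<omega>)"
      using g_lim by eventually_elim (intro tendsto_intros)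
    show "AE \<omega> in M. norm (min (f n \<omega>) (h \<omega>)) \<le> 1" for n
      using bnd[OF f(1)[of n]] h by eventually_elim (auto simp: min_def)
  qed auto
  have g01: "AE \<omega> in M. 0 \<le> g \<omega> \<and> g \<omega> \<le> 1"
    using g_lim \<open>AE \<omega> in M. \<forall>n. 0 \<le> f n \<omega> \<and> f n \<omega> \<le> 1\<close>
    by eventually_elim (meson LIMSEQ_le_const LIMSEQ_le_const2)
  have intg: "integrable M g"
    by (rule integrable_const_bound[where B=1]) (use g01 in auto)
  have Eg: "expectation g \<le> m"
  proof (rule field_le_epsilon)
    fix e :: real assume "0 < e"
    then obtain n where n: "1 / real (Suc n) < e" using nat_approx_posE by blast
    have "AE \<omega> in M. g \<omega> \<le> a n \<omega>"
      using g_lim \<open>AE \<omega> in M. \<forall>n. f (Suc n) \<omega> \<le> min (f n \<omega>) (a n \<omega>)\<close>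
    proof eventually_elim
      case (elim \<omega>)
      then have "decseq (\<lambda>n. f n \<omega>)" by (intro decseq_SucI) auto
      then have "g \<omega> \<le> f (Suc n) \<omega>" using elim(1) by (rule decseq_ge)
      then show ?case using elim(2) by (metis min.bounded_iff order_trans)
    qed
    then have "expectation g \<le> expectation (a n)"
      by (intro integral_mono_AE intg int a(1))
    then show "expectation g \<le> m + e" using a(2)[of n] n by linarith
  qed
  have "AE \<omega> in M. g \<omega> \<le> h \<omega>" if h: "h \<in> F" for h
  proof -
    note [measurable] = meas[OF h]
    have intmin: "integrable M (\<lambda>\<omega>. min (g \<omega>) (h \<omega>))"
      by (intro integrable_min intg int h)
    have "m \<le> expectation (\<lambda>\<omega>. min (f n \<omega>) (h \<omega>))" for n
    proof -
      obtain k where k: "k \<in> F" "AE \<omega> in M. k \<omega> \<le> min (f n \<omega>) (h \<omega>)" using dir[OF f(1) h] by blast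
      have "m \<le> expectation k" by (rule m_le[OF k(1)])
      also have "\<dots> \<le> expectation (\<lambda>\<omega>. min (f n \<omega>) (h \<omega>))"
        by (intro integral_mono_AE integrable_min int k f h)
      finally show ?thesis .
    qed
    then have "m \<le> expectation (\<lambda>\<omega>. min (g \<omega>) (h \<omega>))"
      using lim_int[OF meas[OF h] bnd[OF h]] by (intro LIMSEQ_le_const) auto
    then have "expectation (\<lambda>\<omega>. g \<omega> - min (g \<omega>) (h \<omega>)) \<le> 0"
      using Eg intg intmin by simp
    moreover have "0 \<le> expectation (\<lambda>\<omega>. g \<omega> - min (g \<omega>) (h \<omega>))"
      by (intro integral_nonneg_AE) auto
    ultimately have "expectation (\<lambda>\<omega>. g \<omega> - min (g \<omega>) (h \<omega>)) = 0" by simp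
    then have "AE \<omega> in M. g \<omega> - min (g \<omega>) (h \<omega>) = 0"
      using intg intmin by (subst (asm) integral_nonneg_eq_0_iff_AE) auto
    then show ?thesis by eventually_elim (auto simp: min_def split: if_splits)
  qed
  then show ?thesis by (intro that[OF f(1) _ g_lim]) auto
qed

end

section \<open>Random normed modules\<close>

locale RN_space = prob_space M for M :: "'w measure" +
  fixes sm :: "('w \<Rightarrow> complex) \<Rightarrow> 's::ab_group_add \<Rightarrow> 's"
    and nrm :: "'s \<Rightarrow> 'w \<Rightarrow> real"
  assumes RN: "RN_module M sm nrm"
begin

abbreviation conv :: "('b \<Rightarrow> 's) \<Rightarrow> 's \<Rightarrow> 'b filter \<Rightarrow> bool" where
  "conv \<equiv> rn_tendsto M nrm"

abbreviation rs :: "real \<Rightarrow> 's \<Rightarrow> 's" where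
  "rs r \<equiv> sm (\<lambda>_. complex_of_real r)"

definition rho :: "'s \<Rightarrow> real" where
  "rho x = pmag (nrm x)"

section \<open>Elementary rules for scalars and random norms\<close>

lemma nrm_measurable [measurable, simp]: "nrm x \<in> borel_measurable M"
  by (rule RN[unfolded RN_module_def, THEN conjunct2, THEN conjunct2, THEN conjunct2, THEN conjunct2, THEN conjunct2, THEN conjunct1, rule_format, THEN conjunct1])

lemma nrm_nonneg: "AE \<omega> in M. 0 \<le> nrm x \<omega>"
  by (rule RN[unfolded RN_module_def, THEN conjunct2, THEN conjunct2, THEN conjunct2, THEN conjunct2, THEN conjunct2, THEN conjunct1, rule_format, THEN conjunct2])

lemma sm_cong: "\<xi> \<in> borel_measurable M \<Longrightarrow> \<eta> \<in> borel_measurable M \<Longrightarrow> (AE \<omega> in M. \<xi> \<omega> = \<eta> \<omega>) \<Longrightarrow> sm \<xi> x = sm \<eta> x"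
  by (rule RN[unfolded RN_module_def, THEN conjunct1, rule_format])

lemma sm_add_right: "\<xi> \<in> borel_measurable M \<Longrightarrow> sm \<xi> (x + y) = sm \<xi> x + sm \<xi> y"
  by (rule RN[unfolded RN_module_def, THEN conjunct2, THEN conjunct1, rule_format])

lemma sm_add_left: "\<xi> \<in> borel_measurable M \<Longrightarrow> \<eta> \<in> borel_measurable M \<Longrightarrow>
    sm (\<lambda>\<omega>. \<xi> \<omega> + \<eta> \<omega>) x = sm \<xi> x + sm \<eta> x"
  by (rule RN[unfolded RN_module_def, THEN conjunct2, THEN conjunct2, THEN conjunct1, rule_format])

lemma sm_sm: "\<xi> \<in> borel_measurable M \<Longrightarrow> \<eta> \<in> borel_measurable M \<Longrightarrow>
    sm \<xi> (sm \<eta> x) = sm (\<lambda>\<omega>. \<xi> \<omega> * \<eta> \<omega>) x"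
  by (rule RN[unfolded RN_module_def, THEN conjunct2, THEN conjunct2, THEN conjunct2, THEN conjunct1, rule_format, symmetric])

lemma sm_one [simp]: "sm (\<lambda>\<omega>. 1) x = x"
  by (rule RN[unfolded RN_module_def, THEN conjunct2, THEN conjunct2, THEN conjunct2, THEN conjunct2, THEN conjunct1, rule_format])

lemma nrm_sm: "\<xi> \<in> borel_measurable M \<Longrightarrow> AE \<omega> in M. nrm (sm \<xi> x) \<omega> = cmod (\<xi> \<omega>) * nrm x \<omega>"
  by (rule RN[unfolded RN_module_def, THEN conjunct2, THEN conjunct2, THEN conjunct2, THEN conjunct2, THEN conjunct2, THEN conjunct2, THEN conjunct1, rule_format])

lemma nrm_triangle: "AE \<omega> in M. nrm (x + y) \<omega> \<le> nrm x \<omega> + nrm y \<omega>"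
  by (rule RN[unfolded RN_module_def, THEN conjunct2, THEN conjunct2, THEN conjunct2, THEN conjunct2, THEN conjunct2, THEN conjunct2, THEN conjunct2, THEN conjunct1, rule_format])

lemma nrm_eq_0D: "(AE \<omega> in M. nrm x \<omega> = 0) \<Longrightarrow> x = 0"
  by (rule RN[unfolded RN_module_def, THEN conjunct2, THEN conjunct2, THEN conjunct2, THEN conjunct2, THEN conjunct2, THEN conjunct2, THEN conjunct2, THEN conjunct2, rule_format])

lemma sm_zero_left [simp]: "sm (\<lambda>_. 0) x = 0"
  by (rule nrm_eq_0D) (use nrm_sm[of "\<lambda>_. 0" x] in auto)

lemma sm_zero_right [simp]: "\<xi> \<in> borel_measurable M \<Longrightarrow> sm \<xi> 0 = 0"
  using sm_add_right[of \<xi> 0 0] by simp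

lemma sm_diff_right: "\<xi> \<in> borel_measurable M \<Longrightarrow> sm \<xi> (x - y) = sm \<xi> x - sm \<xi> y"
  using sm_add_right[of \<xi> "x - y" y] by (simp add: algebra_simps)

lemma sm_diff_left: "\<xi> \<in> borel_measurable M \<Longrightarrow> \<eta> \<in> borel_measurable M \<Longrightarrow>
    sm (\<lambda>\<omega>. \<xi> \<omega> - \<eta> \<omega>) x = sm \<xi> x - sm \<eta> x"
  using sm_add_left[of "\<lambda>\<omega>. \<xi> \<omega> - \<eta> \<omega>" \<eta> x] by (simp add: algebra_simps)

lemma sm_minus_one: "sm (\<lambda>_. - 1) x = - x"
  using sm_diff_left[of "\<lambda>_. 0" "\<lambda>_. 1" x] by simp

lemma sm_commute: "\<xi> \<in> borel_measurable M \<Longrightarrow> \<eta> \<in> borel_measurable M \<Longrightarrow>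
    sm \<xi> (sm \<eta> x) = sm \<eta> (sm \<xi> x)"
  by (simp add: sm_sm mult.commute)

lemma sm_sum_right: "\<xi> \<in> borel_measurable M \<Longrightarrow> sm \<xi> (sum f K) = (\<Sum>k\<in>K. sm \<xi> (f k))"
  by (induction K rule: infinite_finite_induct) (auto simp: sm_add_right)

lemma rs_rs: "rs a (rs b x) = rs (a * b) x"
  by (simp add: sm_sm)

lemma rs_1 [simp]: "rs 1 x = x" and rs_0 [simp]: "rs 0 x = 0"
  by simp_all

lemma rs_add_left: "rs (a + b) x = rs a x + rs b x"
  by (simp add: sm_add_left)

lemma rs_diff_left: "rs (a - b) x = rs a x - rs b x"
  by (simp add: sm_diff_left)

lemma nrm_sm_real: "r \<in> borel_measurable M \<Longrightarrow>
    AE \<omega> in M. nrm (sm (\<lambda>\<omega>. complex_of_real (r \<omega>)) x) \<omega> = \<bar>r \<omega>\<bar> * nrm x \<omega>"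
  using nrm_sm[of "\<lambda>\<omega>. complex_of_real (r \<omega>)" x] by simp

lemma nrm_rs: "AE \<omega> in M. nrm (rs r x) \<omega> = \<bar>r\<bar> * nrm x \<omega>"
  by (rule nrm_sm_real) simp

lemma sum_const_rs: "(\<Sum>k<(n::nat). x) = rs (real n) x"
  by (induction n) (simp_all add: sm_add_left add.commute)

lemma nrm_zero: "AE \<omega> in M. nrm 0 \<omega> = 0"
  using nrm_sm[of "\<lambda>_. 0" 0] by simp

lemma nrm_uminus: "AE \<omega> in M. nrm (- x) \<omega> = nrm x \<omega>"
  using nrm_sm[of "\<lambda>_. -1" x] by (simp add: sm_minus_one)

lemma nrm_diff_triangle: "AE \<omega> in M. nrm (x - y) \<omega> \<le> nrm x \<omega> + nrm y \<omega>"
  using nrm_triangle[of x "- y"] nrm_uminus[of y] by eventually_elim simp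

lemma nrm_minus_commute: "AE \<omega> in M. nrm (x - y) \<omega> = nrm (y - x) \<omega>"
  using nrm_uminus[of "x - y"] by eventually_elim simp

lemma nrm_diff_trans: "AE \<omega> in M. nrm (x - z) \<omega> \<le> nrm (x - y) \<omega> + nrm (y - z) \<omega>"
  using nrm_triangle[of "x - y" "y - z"] by simp

lemma nrm_sum: "finite K \<Longrightarrow> AE \<omega> in M. nrm (sum f K) \<omega> \<le> (\<Sum>k\<in>K. nrm (f k) \<omega>)"
proof (induction K rule: finite_induct)
  case empty
  show ?case using nrm_zero by eventually_elim simp
next
  case (insert k K)
  show ?case using nrm_triangle[of "f k" "sum f K"] insert.IH
    by eventually_elim (use insert.hyps in auto)
qed

section \<open>The truncated expected norm and convergence\<close>

lemma rho_nonneg: "0 \<le> rho x"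
  by (simp add: rho_def pmag_nonneg)

lemma rho_le_1: "rho x \<le> 1"
  unfolding rho_def pmag_def
  by (rule order_trans[OF integral_mono[of M _ "\<lambda>_. 1"]]) (auto simp: prob_space)

lemma rho_mono:
  assumes "AE \<omega> in M. nrm x \<omega> \<le> nrm y \<omega>"
  shows "rho x \<le> rho y"
  unfolding rho_def
  by (rule pmag_mono) (use assms nrm_nonneg[of x] in auto)

lemma rho_cong:
  assumes "AE \<omega> in M. nrm x \<omega> = nrm y \<omega>"
  shows "rho x = rho y"
  by (intro antisym rho_mono) (use assms in auto)

lemma rho_minus_commute: "rho (x - y) = rho (y - x)"
  by (rule rho_cong[OF nrm_minus_commute])

lemma rho_zero [simp]: "rho 0 = 0"
proof -
  have "rho 0 \<le> pmag (\<lambda>_. 0)"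
    unfolding rho_def by (rule pmag_mono) (use nrm_zero in auto)
  then show ?thesis using rho_nonneg[of 0] by simp
qed

lemma rho_le_pmag:
  assumes [measurable]: "g \<in> borel_measurable M" and "AE \<omega> in M. nrm x \<omega> \<le> g \<omega>"
  shows "rho x \<le> pmag g"
  unfolding rho_def by (rule pmag_mono) (use assms nrm_nonneg[of x] in auto)

lemma rho_le_add:
  assumes "AE \<omega> in M. nrm x \<omega> \<le> nrm y \<omega> + nrm z \<omega>"
  shows "rho x \<le> rho y + rho z"
proof -
  have "rho x \<le> pmag (\<lambda>\<omega>. nrm y \<omega> + nrm z \<omega>)"
    by (rule rho_le_pmag) (use assms in auto)
  also have "\<dots> \<le> rho y + rho z" unfolding rho_def by (rule pmag_add_le) auto
  finally show ?thesis .
qed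

lemma rho_triangle: "rho (x - z) \<le> rho (x - y) + rho (y - z)"
  by (rule rho_le_add[OF nrm_diff_trans])

lemma rho_eq_0D: "rho x = 0 \<Longrightarrow> x = 0"
  unfolding rho_def by (intro nrm_eq_0D pmag_eq_0D) auto

text \<open>The truncated functional \<open>rho\<close> is not homogeneous; convexity holds as long as the
  truncation is inactive.\<close>
lemma rho_weighted_sum:
  assumes "finite K" and w: "\<And>k. k \<in> K \<Longrightarrow> 0 \<le> w k"
    and y: "\<And>k. k \<in> K \<Longrightarrow> AE \<omega> in M. nrm (y k) \<omega> \<le> 1"
    and x: "AE \<omega> in M. nrm x \<omega> \<le> (\<Sum>k\<in>K. w k * nrm (y k) \<omega>)"
  shows "rho x \<le> (\<Sum>k\<in>K. w k * rho (y k))"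
proof -
  have int: "integrable M (nrm (y k))" if "k \<in> K" for k
    by (rule integrable_const_bound[where B=1]) (use y[OF that] nrm_nonneg[of "y k"] in auto)
  have eq: "rho (y k) = expectation (nrm (y k))" if "k \<in> K" for k
    unfolding rho_def pmag_def by (rule integral_cong_AE) (use y[OF that] nrm_nonneg[of "y k"] in auto)
  have "rho x \<le> expectation (\<lambda>\<omega>. \<Sum>k\<in>K. w k * nrm (y k) \<omega>)"
    unfolding rho_def pmag_def
    by (rule integral_mono_AE) (use x nrm_nonneg[of x] int in auto)
  also have "\<dots> = (\<Sum>k\<in>K. w k * rho (y k))"
    using int by (simp add: eq)
  finally show ?thesis .
qed

text \<open>Convergence is handled through the single real function \<open>rho\<close> from here on.
  The tolerance \<open>a\<close> is split evenly between the level and the probability in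
  \<open>pmag_le_prob\<close>.\<close>

lemma conv_iff: "conv f x F \<longleftrightarrow> ((\<lambda>t. rho (f t - x)) \<longlongrightarrow> 0) F"
proof
  assume L: "conv f x F"
  show "((\<lambda>t. rho (f t - x)) \<longlongrightarrow> 0) F"
  proof (rule order_tendstoI)
    fix a :: real assume "a < 0"
    then show "\<forall>\<^sub>F t in F. a < rho (f t - x)"
      by (intro always_eventually allI less_le_trans[OF _ rho_nonneg])
  next
    fix a :: real assume a: "0 < a"
    then have "((\<lambda>t. prob {\<omega> \<in> space M. a / 2 \<le> nrm (f t - x) \<omega>}) \<longlongrightarrow> 0) F"
      using L unfolding rn_tendsto_def by (metis half_gt_zero)
    then have "\<forall>\<^sub>F t in F. prob {\<omega> \<in> space M. a / 2 \<le> nrm (f t - x) \<omega>} < a / 2"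
      using a by (intro order_tendstoD(2)) auto
    then show "\<forall>\<^sub>F t in F. rho (f t - x) < a"
    proof eventually_elim
      case (elim t)
      show ?case using pmag_le_prob[OF nrm_measurable nrm_nonneg, of "a / 2" "f t - x"] a elim
        unfolding rho_def by auto
    qed
  qed
next
  assume R: "((\<lambda>t. rho (f t - x)) \<longlongrightarrow> 0) F"
  show "conv f x F"
    unfolding rn_tendsto_def
  proof (intro allI impI)
    fix e :: real assume e: "0 < e"
    show "((\<lambda>t. prob {\<omega> \<in> space M. e \<le> nrm (f t - x) \<omega>}) \<longlongrightarrow> 0) F"
    proof (rule tendsto_sandwich[OF _ _ tendsto_const])
      show "((\<lambda>t. rho (f t - x) / min 1 e) \<longlongrightarrow> 0) F"
        using tendsto_divide[OF R tendsto_const[of "min 1 e"]] e by auto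
      show "\<forall>\<^sub>F t in F. prob {\<omega> \<in> space M. e \<le> nrm (f t - x) \<omega>} \<le> rho (f t - x) / min 1 e"
        using prob_le_pmag[OF nrm_measurable e] e
        by (intro always_eventually allI) (auto simp: rho_def pos_le_divide_eq mult.commute)
    qed auto
  qed
qed

lemma conv_rho_le:
  assumes "\<forall>\<^sub>F t in F. rho (f t - x) \<le> r t" and "(r \<longlongrightarrow> 0) F"
  shows "conv f x F"
  unfolding conv_iff
  by (rule tendsto_sandwich[OF _ assms(1) tendsto_const assms(2)]) (auto simp: rho_nonneg)

lemma conv_epsI:
  assumes "\<And>e. 0 < e \<Longrightarrow> \<forall>\<^sub>F t in F. rho (f t - x) < e"
  shows "conv f x F"
  unfolding conv_iff
  by (rule order_tendstoI) (auto intro: assms less_le_trans[OF _ rho_nonneg] always_eventually)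

lemma conv_epsD: "conv f x F \<Longrightarrow> 0 < e \<Longrightarrow> \<forall>\<^sub>F t in F. rho (f t - x) < e"
  unfolding conv_iff by (rule order_tendstoD(2))

lemma conv_const [simp]: "conv (\<lambda>_. x) x F"
  by (simp add: conv_iff)

lemma conv_cong: "(\<forall>\<^sub>F t in F. f t = g t) \<Longrightarrow> conv g x F \<Longrightarrow> conv f x F"
  unfolding conv_iff by (erule Lim_transform_eventually) (auto elim: eventually_mono)

lemma conv_unique:
  assumes "F \<noteq> bot" "conv f x F" "conv f y F"
  shows "x = y"
proof -
  have "((\<lambda>t. rho (f t - x) + rho (f t - y)) \<longlongrightarrow> 0 + 0) F"
    using assms unfolding conv_iff by (intro tendsto_add)
  moreover have "rho (x - y) \<le> rho (f t - x) + rho (f t - y)" for t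
    using rho_triangle[of x y "f t"] by (simp add: rho_minus_commute)
  ultimately have "rho (x - y) \<le> 0"
    using assms(1) by (intro tendsto_lowerbound[of _ _ F]) auto
  then show ?thesis using rho_eq_0D[of "x - y"] rho_nonneg[of "x - y"] by simp
qed

lemma conv_add:
  assumes "conv f x F" "conv g y F"
  shows "conv (\<lambda>t. f t + g t) (x + y) F"
proof (rule conv_rho_le)
  show "((\<lambda>t. rho (f t - x) + rho (g t - y)) \<longlongrightarrow> 0) F"
    using tendsto_add[OF assms[unfolded conv_iff]] by simp
  show "\<forall>\<^sub>F t in F. rho (f t + g t - (x + y)) \<le> rho (f t - x) + rho (g t - y)"
    by (rule always_eventually, rule allI, rule rho_le_add, subst add_diff_add, rule nrm_triangle)
qed

lemma conv_sm:
  assumes [measurable]: "\<xi> \<in> borel_measurable M" and "conv f x F"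
  shows "conv (\<lambda>t. sm \<xi> (f t)) (sm \<xi> x) F"
proof (rule conv_rho_le)
  show "((\<lambda>t. pmag (\<lambda>\<omega>. cmod (\<xi> \<omega>) * nrm (f t - x) \<omega>)) \<longlongrightarrow> 0) F"
    by (rule pmag_mult_tendsto) (use assms(2) in \<open>auto simp: conv_iff rho_def\<close>)
  show "\<forall>\<^sub>F t in F. rho (sm \<xi> (f t) - sm \<xi> x) \<le> pmag (\<lambda>\<omega>. cmod (\<xi> \<omega>) * nrm (f t - x) \<omega>)"
  proof (rule always_eventually, rule allI, rule rho_le_pmag)
    fix t
    show "AE \<omega> in M. nrm (sm \<xi> (f t) - sm \<xi> x) \<omega> \<le> cmod (\<xi> \<omega>) * nrm (f t - x) \<omega>"
      using nrm_sm[OF assms(1), of "f t - x"] unfolding sm_diff_right[OF assms(1)] by eventually_elim simp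
  qed auto
qed

lemma conv_uminus: "conv f x F \<Longrightarrow> conv (\<lambda>t. - f t) (- x) F"
  using conv_sm[of "\<lambda>_. - 1" f x F] by (simp add: sm_minus_one)

lemma conv_diff: "conv f x F \<Longrightarrow> conv g y F \<Longrightarrow> conv (\<lambda>t. f t - g t) (x - y) F"
  using conv_add[OF _ conv_uminus, of f x F g y] by simp

lemma conv_0I: "conv (\<lambda>t. f t - x) 0 F \<Longrightarrow> conv f x F"
  by (simp add: conv_iff)

lemma conv_compose: "conv f x F \<Longrightarrow> filterlim g F G \<Longrightarrow> conv (\<lambda>t. f (g t)) x G"
  unfolding conv_iff by (rule filterlim_compose)

lemma conv_rho_mono:
  assumes "\<And>t. AE \<omega> in M. nrm (f t - x) \<omega> \<le> nrm (g t - y) \<omega>" "conv g y F"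
  shows "conv f x F"
  by (rule conv_rho_le[OF always_eventually assms(2)[unfolded conv_iff]]) (auto intro: rho_mono assms)

lemma conv_nrm_le:
  assumes g: "\<And>t. g t \<in> borel_measurable M" and le: "\<forall>\<^sub>F t in F. AE \<omega> in M. nrm (f t - x) \<omega> \<le> g t \<omega>"
    and lim: "((\<lambda>t. pmag (g t)) \<longlongrightarrow> 0) F"
  shows "conv f x F"
  by (rule conv_rho_le[OF _ lim]) (use le in eventually_elim, rule rho_le_pmag[OF g])

text \<open>As soon as the bound holds at \<open>t\<close>, the positive part of
  \<open>nrm x - h\<close> is at most \<open>nrm (f t - x)\<close>, so its \<open>pmag\<close> is 0.
  This avoids almost surely convergent subsequences, which a general filter would not
  provide.\<close>

lemma nrm_limit_le:
  assumes "F \<noteq> bot" "conv f x F" and [measurable]: "h \<in> borel_measurable M"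
    and le: "\<forall>\<^sub>F t in F. AE \<omega> in M. nrm (f t) \<omega> \<le> h \<omega>"
  shows "AE \<omega> in M. nrm x \<omega> \<le> h \<omega>"
proof -
  let ?p = "\<lambda>\<omega>. max 0 (nrm x \<omega> - h \<omega>)"
  have bound: "pmag ?p \<le> rho (f t - x)" if "AE \<omega> in M. nrm (f t) \<omega> \<le> h \<omega>" for t
    unfolding rho_def
  proof (rule pmag_mono)
    show "AE \<omega> in M. \<bar>?p \<omega>\<bar> \<le> \<bar>nrm (f t - x) \<omega>\<bar>"
      using that nrm_diff_triangle[of "f t" "f t - x"] nrm_nonneg[of "f t - x"]
      by eventually_elim auto
  qed auto
  have "pmag ?p \<le> 0"
    by (rule tendsto_lowerbound[OF assms(2)[unfolded conv_iff]])
      (use le bound assms(1) in \<open>auto elim: eventually_mono\<close>)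
  then have "pmag ?p = 0" using pmag_nonneg[of ?p] by simp
  then have "AE \<omega> in M. ?p \<omega> = 0" by (intro pmag_eq_0D) auto
  then show ?thesis by eventually_elim auto
qed

lemma nrm_limit_ge:
  assumes "F \<noteq> bot" "conv f x F" and [measurable]: "c \<in> borel_measurable M"
    and le: "\<forall>\<^sub>F t in F. AE \<omega> in M. c \<omega> \<le> nrm (f t) \<omega>"
  shows "AE \<omega> in M. c \<omega> \<le> nrm x \<omega>"
proof -
  let ?p = "\<lambda>\<omega>. max 0 (c \<omega> - nrm x \<omega>)"
  have bound: "pmag ?p \<le> rho (f t - x)" if "AE \<omega> in M. c \<omega> \<le> nrm (f t) \<omega>" for t
    unfolding rho_def
  proof (rule pmag_mono)
    show "AE \<omega> in M. \<bar>?p \<omega>\<bar> \<le> \<bar>nrm (f t - x) \<omega>\<bar>"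
      using that nrm_triangle[of "f t - x" x] nrm_nonneg[of "f t - x"] by eventually_elim auto
  qed auto
  have "pmag ?p \<le> 0"
    by (rule tendsto_lowerbound[OF assms(2)[unfolded conv_iff]])
      (use le bound assms(1) in \<open>auto elim: eventually_mono\<close>)
  then have "pmag ?p = 0" using pmag_nonneg[of ?p] by simp
  then have "AE \<omega> in M. ?p \<omega> = 0" by (intro pmag_eq_0D) auto
  then show ?thesis by eventually_elim auto
qed

section \<open>Module homomorphisms and almost sure contractions\<close>

definition hom :: "('s \<Rightarrow> 's) \<Rightarrow> bool" where
  "hom T \<longleftrightarrow> (\<forall>x y. T (x + y) = T x + T y) \<and>
     (\<forall>\<xi> x. \<xi> \<in> borel_measurable M \<longrightarrow> T (sm \<xi> x) = sm \<xi> (T x))"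

lemma hom_add: "hom T \<Longrightarrow> T (x + y) = T x + T y"
  and hom_sm: "hom T \<Longrightarrow> \<xi> \<in> borel_measurable M \<Longrightarrow> T (sm \<xi> x) = sm \<xi> (T x)"
  by (auto simp: hom_def)

lemma hom_sm_real: "hom T \<Longrightarrow> r \<in> borel_measurable M \<Longrightarrow>
    T (sm (\<lambda>\<omega>. complex_of_real (r \<omega>)) x) = sm (\<lambda>\<omega>. complex_of_real (r \<omega>)) (T x)"
  by (simp add: hom_sm)

lemma hom_zero: "hom T \<Longrightarrow> T 0 = 0"
  using hom_add[of T 0 0] by simp

lemma hom_diff: "hom T \<Longrightarrow> T (x - y) = T x - T y"
  using hom_add[of T "x - y" y] by (simp add: algebra_simps)

lemma hom_sum: "hom T \<Longrightarrow> T (sum f K) = (\<Sum>k\<in>K. T (f k))"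
  by (induction K rule: infinite_finite_induct) (auto simp: hom_add hom_zero)

text \<open>Contractivity without reference to \<open>opnorm\<close>; continuity is then automatic
  by \<open>bounded_opI\<close>.\<close>

definition contr :: "('s \<Rightarrow> 's) \<Rightarrow> bool" where
  "contr T \<longleftrightarrow> hom T \<and> (\<forall>x. AE \<omega> in M. nrm (T x) \<omega> \<le> nrm x \<omega>)"

lemma contr_hom: "contr T \<Longrightarrow> hom T"
  and contr_nrm: "contr T \<Longrightarrow> AE \<omega> in M. nrm (T x) \<omega> \<le> nrm x \<omega>"
  by (auto simp: contr_def)

lemma contr_nrm_diff: "contr T \<Longrightarrow> AE \<omega> in M. nrm (T x - T y) \<omega> \<le> nrm (x - y) \<omega>"
  using contr_nrm[of T "x - y"] by (simp add: hom_diff[OF contr_hom])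

lemma contr_rho_diff: "contr T \<Longrightarrow> rho (T x - T y) \<le> rho (x - y)"
  by (rule rho_mono[OF contr_nrm_diff])

lemma contr_conv: "contr T \<Longrightarrow> conv f x F \<Longrightarrow> conv (\<lambda>t. T (f t)) (T x) F"
  by (rule conv_rho_mono[OF contr_nrm_diff])

lemma contr_id: "contr (\<lambda>x. x)"
  by (simp add: contr_def hom_def)

lemma contr_compose:
  assumes S: "contr S" and T: "contr T"
  shows "contr (\<lambda>x. S (T x))"
  unfolding contr_def
proof (intro conjI allI)
  show "hom (\<lambda>x. S (T x))" using contr_hom[OF S] contr_hom[OF T] by (auto simp: hom_def)
  show "AE \<omega> in M. nrm (S (T x)) \<omega> \<le> nrm x \<omega>" for x
    using contr_nrm[OF S, of "T x"] contr_nrm[OF T, of x] by eventually_elim simp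
qed

lemma contr_funpow: "contr T \<Longrightarrow> contr (T ^^ n)"
  by (induction n) (use contr_id contr_compose in \<open>auto simp: id_def comp_def\<close>)

text \<open>A random Lipschitz factor suffices, since \<open>pmag_mult_tendsto\<close> absorbs an
  unbounded \<open>c\<close>.\<close>

lemma bounded_opI:
  assumes "hom T" and [measurable]: "c \<in> borel_measurable M"
    and le: "\<And>x. AE \<omega> in M. nrm (T x) \<omega> \<le> c \<omega> * nrm x \<omega>"
  shows "bounded_op M sm nrm T"
  unfolding bounded_op_def
proof (intro conjI allI impI)
  fix f x assume f: "conv f x sequentially"
  show "conv (\<lambda>n. T (f n)) (T x) sequentially"
  proof (rule conv_nrm_le)
    show "(\<lambda>t. pmag (\<lambda>\<omega>. c \<omega> * nrm (f t - x) \<omega>)) \<longlonglongrightarrow> 0"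
      by (rule pmag_mult_tendsto) (use f in \<open>auto simp: conv_iff rho_def\<close>)
    show "\<forall>\<^sub>F t in sequentially. AE \<omega> in M. nrm (T (f t) - T x) \<omega> \<le> c \<omega> * nrm (f t - x) \<omega>"
      using le[of "f _ - x"] by (simp add: hom_diff[OF \<open>hom T\<close>])
  qed auto
qed (use \<open>hom T\<close> in \<open>auto simp: hom_def\<close>)

lemma bounded_op_hom: "bounded_op M sm nrm T \<Longrightarrow> hom T"
  by (auto simp: bounded_op_def hom_def)

section \<open>Least almost sure bounds and the operator norm\<close>

definition op_bound :: "('s \<Rightarrow> 's) \<Rightarrow> ('w \<Rightarrow> real) \<Rightarrow> bool" where
  "op_bound T \<eta> \<longleftrightarrow> \<eta> \<in> borel_measurable M \<and> (AE \<omega> in M. 0 \<le> \<eta> \<omega>) \<and>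
     (\<forall>x. AE \<omega> in M. nrm (T x) \<omega> \<le> \<eta> \<omega> * nrm x \<omega>)"

text \<open>The least bound is the essential supremum of the upwards directed family of all
  \<open>nrm (T x)\<close> with \<open>nrm x \<le> 1\<close>, written through the essential infimum \<open>g\<close> of the bounded
  functions \<open>1 / (1 + nrm (T x))\<close>.  If \<open>g\<close> vanished on a set \<open>B\<close> of positive probability,
  rescaling a maximizing sequence on \<open>B\<close> would contradict continuity at \<open>0\<close>.\<close>
lemma bounded_op_least_bound:
  assumes T: "bounded_op M sm nrm T"
  shows "\<exists>\<xi>. op_bound T \<xi> \<and> (\<forall>\<eta>. op_bound T \<eta> \<longrightarrow> (AE \<omega> in M. \<xi> \<omega> \<le> \<eta> \<omega>))"
proof -
  have hT: "hom T" by (rule bounded_op_hom[OF T])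
  define X where "X = {x. AE \<omega> in M. nrm x \<omega> \<le> 1}"
  define q where "q x \<omega> = 1 / (1 + nrm (T x) \<omega>)" for x \<omega>
  have [measurable]: "q x \<in> borel_measurable M" for x unfolding q_def by measurable
  have "0 \<in> X" using nrm_zero by (auto simp: X_def)
  have glue: "\<exists>u\<in>X. AE \<omega> in M. q u \<omega> \<le> min (q x \<omega>) (q y \<omega>)" if x: "x \<in> X" and y: "y \<in> X" for x y
  proof -
    define B where "B = {\<omega> \<in> space M. nrm (T y) \<omega> \<le> nrm (T x) \<omega>}"
    have [measurable]: "B \<in> sets M" unfolding B_def by measurable
    \<comment> \<open>On each of the two events \<open>u\<close> takes the vector whose image is
      larger there. A module homomorphism is local: multiplying by indicators shows that
      \<open>T u\<close> agrees with \<open>T x\<close> on \<open>B\<close> and with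
      \<open>T y\<close> off \<open>B\<close>.\<close>
    define u where "u = sm (indicator B) x + sm (indicator (space M - B)) y"
    have u: "AE \<omega> in M. nrm u \<omega> \<le> 1"
      using nrm_triangle[of "sm (indicator B) x" "sm (indicator (space M - B)) y"]
        nrm_sm[of "indicator B" x, simplified] nrm_sm[of "indicator (space M - B)" y, simplified]
        x[unfolded X_def mem_Collect_eq] y[unfolded X_def mem_Collect_eq] AE_space
      unfolding u_def
    proof eventually_elim
      case (elim \<omega>)
      then show ?case by (cases "\<omega> \<in> B") auto
    qed
    have Tu: "T u = sm (indicator B) (T x) + sm (indicator (space M - B)) (T y)"
      by (simp add: u_def hom_add[OF hT] hom_sm[OF hT])
    have B1: "sm (indicator B) (T u) = sm (indicator B) (T x)"
    proof -
      have "sm (\<lambda>\<omega>. indicator B \<omega> * indicator B \<omega>) (T x) = sm (indicator B) (T x)"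
        "sm (\<lambda>\<omega>. indicator B \<omega> * indicator (space M - B) \<omega>) (T y) = sm (\<lambda>_. 0) (T y)"
        by (rule sm_cong; auto simp: indicator_def)+
      then show ?thesis by (simp add: Tu sm_add_right sm_sm)
    qed
    have B2: "sm (indicator (space M - B)) (T u) = sm (indicator (space M - B)) (T y)"
    proof -
      have "sm (\<lambda>\<omega>. indicator (space M - B) \<omega> * indicator B \<omega>) (T x) = sm (\<lambda>_. 0) (T x)"
        "sm (\<lambda>\<omega>. indicator (space M - B) \<omega> * indicator (space M - B) \<omega>) (T y) = sm (indicator (space M - B)) (T y)"
        by (rule sm_cong; auto simp: indicator_def)+
      then show ?thesis by (simp add: Tu sm_add_right sm_sm)
    qed
    have "AE \<omega> in M. q u \<omega> \<le> min (q x \<omega>) (q y \<omega>)"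
      using nrm_sm[of "indicator B" "T u", simplified] nrm_sm[of "indicator B" "T x", simplified]
        nrm_sm[of "indicator (space M - B)" "T u", simplified]
        nrm_sm[of "indicator (space M - B)" "T y", simplified]
        nrm_nonneg[of "T x"] nrm_nonneg[of "T y"] AE_space
      unfolding B1 B2
    proof eventually_elim
      case (elim \<omega>)
      then show ?case
        by (cases "\<omega> \<in> B") (auto simp: q_def B_def intro!: frac_le)
    qed
    then show ?thesis using u by (auto simp: X_def)
  qed
  obtain f g where f: "\<And>n::nat. f n \<in> q ` X" and [measurable]: "g \<in> borel_measurable M"
    and fg: "AE \<omega> in M. (\<lambda>n. f n \<omega>) \<longlonglongrightarrow> g \<omega>" and g_le: "\<And>h. h \<in> q ` X \<Longrightarrow> AE \<omega> in M. g \<omega> \<le> h \<omega>"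
  proof (rule essential_infimum_of_directed_family[of "q ` X"])
    show "AE \<omega> in M. 0 \<le> h \<omega> \<and> h \<omega> \<le> 1" if "h \<in> q ` X" for h
    proof -
      obtain x where "h = q x" using \<open>h \<in> q ` X\<close> by auto
      then show ?thesis using nrm_nonneg[of "T x"] by (auto simp: q_def)
    qed
    show "\<exists>h\<in>q ` X. AE \<omega> in M. h \<omega> \<le> min (a \<omega>) (b \<omega>)" if "a \<in> q ` X" "b \<in> q ` X" for a b
      using glue that by blast
    show "q ` X \<noteq> {}" using \<open>0 \<in> X\<close> by auto
    show "h \<in> borel_measurable M" if "h \<in> q ` X" for h using that by auto
  qed (rule that)
  obtain x where x: "\<And>n. x n \<in> X" "\<And>n. f n = q (x n)" using f unfolding image_iff by metis
  have T_nonneg: "AE \<omega> in M. \<forall>n. 0 \<le> nrm (T (x n)) \<omega>"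
    using nrm_nonneg by (simp add: AE_all_countable)
  have q_lim: "AE \<omega> in M. (\<lambda>n. q (x n) \<omega>) \<longlonglongrightarrow> g \<omega>" using fg x(2) by simp
  have g_nonneg: "AE \<omega> in M. 0 \<le> g \<omega>"
    using q_lim T_nonneg by eventually_elim (rule LIMSEQ_le_const, auto simp: q_def)
  have g_pos: "AE \<omega> in M. 0 < g \<omega>"
  proof -
    define B where "B = {\<omega> \<in> space M. g \<omega> = 0}"
    have [measurable]: "B \<in> sets M" unfolding B_def by measurable
    have r: "(\<lambda>\<omega>. indicator B \<omega> * q (x n) \<omega>) \<in> borel_measurable M" for n by measurable
    \<comment> \<open>Almost surely on \<open>B\<close> the norms of the \<open>T (x n)\<close> tend
      to infinity, that is, \<open>q (x n)\<close> tends to 0. Multiplying by \<open>q (x n)\<close>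
      therefore sends the vectors to 0, while the images keep norm
      \<open>q (x n) * nrm (T (x n)) = 1 - q (x n)\<close> on \<open>B\<close>, which tends to
      1.\<close>
    define y where "y n = sm (\<lambda>\<omega>. complex_of_real (indicator B \<omega> * q (x n) \<omega>)) (x n)" for n
    have "conv y 0 sequentially"
    proof (rule conv_nrm_le)
      show "\<forall>\<^sub>F n in sequentially. AE \<omega> in M. nrm (y n - 0) \<omega> \<le> indicator B \<omega> * q (x n) \<omega>"
      proof (rule always_eventually, rule allI)
        fix n
        show "AE \<omega> in M. nrm (y n - 0) \<omega> \<le> indicator B \<omega> * q (x n) \<omega>"
          using nrm_sm_real[OF r[of n], of "x n"]
            x(1)[of n, unfolded X_def mem_Collect_eq] nrm_nonneg[of "T (x n)"]
          unfolding y_def[symmetric]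
        proof eventually_elim
          case (elim \<omega>)
          then show ?case by (cases "\<omega> \<in> B") (auto simp: q_def divide_right_mono)
        qed
      qed
      have "(\<lambda>n. pmag (\<lambda>\<omega>. indicator B \<omega> * q (x n) \<omega>)) \<longlonglongrightarrow> pmag (\<lambda>_. 0)"
        by (rule pmag_tendsto_AE)
          (use q_lim in \<open>auto simp: indicator_def B_def elim!: eventually_mono\<close>)
      then show "(\<lambda>n. pmag (\<lambda>\<omega>. indicator B \<omega> * q (x n) \<omega>)) \<longlonglongrightarrow> 0" by simp
    qed auto
    then have "conv (\<lambda>n. T (y n)) (T 0) sequentially" using T by (auto simp: bounded_op_def)
    then have l0: "(\<lambda>n. pmag (nrm (T (y n)))) \<longlonglongrightarrow> 0"
      by (simp add: hom_zero[OF hT] conv_iff rho_def)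
    have "(\<lambda>n. pmag (nrm (T (y n)))) \<longlonglongrightarrow> pmag (indicator B)"
    proof (rule pmag_tendsto_AE)
      have "AE \<omega> in M. \<forall>n. nrm (T (y n)) \<omega> = indicator B \<omega> * (1 - q (x n) \<omega>)"
        unfolding AE_all_countable
      proof
        fix n
        show "AE \<omega> in M. nrm (T (y n)) \<omega> = indicator B \<omega> * (1 - q (x n) \<omega>)"
          using nrm_sm_real[OF r[of n], of "T (x n)"] nrm_nonneg[of "T (x n)"]
          unfolding y_def hom_sm_real[OF hT r]
        proof eventually_elim
          case (elim \<omega>)
          then show ?case by (cases "\<omega> \<in> B") (auto simp: q_def field_simps)
        qed
      qed
      then show "AE \<omega> in M. (\<lambda>n. nrm (T (y n)) \<omega>) \<longlonglongrightarrow> indicator B \<omega>"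
        using q_lim
      proof eventually_elim
        case (elim \<omega>)
        have "(\<lambda>n. indicator B \<omega> * (1 - q (x n) \<omega>)) \<longlonglongrightarrow> indicator B \<omega> * (1 - g \<omega>)"
          by (intro tendsto_intros elim)
        moreover have "indicator B \<omega> * (1 - g \<omega>) = indicat_real B \<omega>" by (auto simp: B_def indicator_def)
        ultimately show ?case using elim(1) by simp
      qed
    qed auto
    then have "pmag (indicator B) = 0" using l0 LIMSEQ_unique by blast
    then have "AE \<omega> in M. indicat_real B \<omega> = 0" by (intro pmag_eq_0D) auto
    then show ?thesis using g_nonneg AE_space
      by eventually_elim (auto simp: B_def indicator_def split: if_splits)
  qed
  \<comment> \<open>This inverts the map sending \<open>s\<close> to \<open>1 / (1 + s)\<close>, so
    an infimum of the \<open>q z\<close> becomes a supremum of the \<open>nrm (T z)\<close>.\<close>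
  define \<xi> where "\<xi> \<omega> = 1 / g \<omega> - 1" for \<omega>
  have [measurable]: "\<xi> \<in> borel_measurable M" unfolding \<xi>_def by measurable
  have \<xi>_ge: "AE \<omega> in M. nrm (T z) \<omega> \<le> \<xi> \<omega>" if "z \<in> X" for z
    using g_le[of "q z"] g_pos nrm_nonneg[of "T z"] that
    by (auto elim!: eventually_elim2 simp: q_def \<xi>_def field_simps)
  show ?thesis
    unfolding op_bound_def
  proof (intro exI[of _ \<xi>] conjI allI impI)
    show "\<xi> \<in> borel_measurable M" by measurable
    show "AE \<omega> in M. 0 \<le> \<xi> \<omega>" using \<xi>_ge[OF \<open>0 \<in> X\<close>] nrm_nonneg[of "T 0"] by eventually_elim simp
  next
    fix z
    \<comment> \<open>Where the norm of \<open>z\<close> vanishes the default 0 is harmless: there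
      \<open>z\<close> itself vanishes, so \<open>z\<close> is still recovered as
      \<open>nrm z\<close> times the normalized vector.\<close>
    define r where "r \<omega> = complex_of_real (if 0 < nrm z \<omega> then 1 / nrm z \<omega> else 0)" for \<omega>
    have [measurable]: "r \<in> borel_measurable M" unfolding r_def by measurable
    have "AE \<omega> in M. nrm (sm r z) \<omega> \<le> 1"
      using nrm_sm[of r z, simplified] by eventually_elim (auto simp: r_def norm_divide)
    then have "AE \<omega> in M. nrm (T (sm r z)) \<omega> \<le> \<xi> \<omega>" by (intro \<xi>_ge) (simp add: X_def)
    moreover have "z = sm (\<lambda>\<omega>. complex_of_real (nrm z \<omega>)) (sm r z)"
    proof -
      have "AE \<omega> in M. nrm (sm (\<lambda>\<omega>. 1 - complex_of_real (nrm z \<omega>) * r \<omega>) z) \<omega> = 0"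
        using nrm_sm[of "\<lambda>\<omega>. 1 - complex_of_real (nrm z \<omega>) * r \<omega>" z, simplified] nrm_nonneg[of z]
        by eventually_elim (auto simp: r_def)
      then have "sm (\<lambda>\<omega>. 1 - complex_of_real (nrm z \<omega>) * r \<omega>) z = 0" by (rule nrm_eq_0D)
      then show ?thesis by (simp add: sm_diff_left sm_sm)
    qed
    then have "T z = sm (\<lambda>\<omega>. complex_of_real (nrm z \<omega>)) (T (sm r z))"
      by (metis hom_sm_real[OF hT] nrm_measurable)
    then have "AE \<omega> in M. nrm (T z) \<omega> = cmod (complex_of_real (nrm z \<omega>)) * nrm (T (sm r z)) \<omega>"
      using nrm_sm[of "\<lambda>\<omega>. complex_of_real (nrm z \<omega>)" "T (sm r z)"] by simp
    ultimately show "AE \<omega> in M. nrm (T z) \<omega> \<le> \<xi> \<omega> * nrm z \<omega>"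
      using nrm_nonneg[of z] by eventually_elim (auto simp: mult.commute[of "nrm z _"] mult_right_mono)
  next
    fix \<eta> :: "'w \<Rightarrow> real"
    assume "\<eta> \<in> borel_measurable M \<and> (AE \<omega> in M. 0 \<le> \<eta> \<omega>) \<and>
      (\<forall>x. AE \<omega> in M. nrm (T x) \<omega> \<le> \<eta> \<omega> * nrm x \<omega>)"
    then have \<eta>: "\<eta> \<in> borel_measurable M" "AE \<omega> in M. 0 \<le> \<eta> \<omega>"
      "\<And>x. AE \<omega> in M. nrm (T x) \<omega> \<le> \<eta> \<omega> * nrm x \<omega>" by blast+
    have "AE \<omega> in M. \<forall>n. nrm (T (x n)) \<omega> \<le> \<eta> \<omega>"
      unfolding AE_all_countable
    proof
      fix n
      show "AE \<omega> in M. nrm (T (x n)) \<omega> \<le> \<eta> \<omega>"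
        using \<eta>(2) \<eta>(3)[of "x n"] x(1)[of n, unfolded X_def mem_Collect_eq]
      proof eventually_elim
        case (elim \<omega>)
        then have "\<eta> \<omega> * nrm (x n) \<omega> \<le> \<eta> \<omega> * 1" by (intro mult_left_mono)
        then show ?case using elim by linarith
      qed
    qed
    then show "AE \<omega> in M. \<xi> \<omega> \<le> \<eta> \<omega>"
      using T_nonneg q_lim g_pos \<eta>(2)
    proof eventually_elim
      case (elim \<omega>)
      have "1 / (1 + \<eta> \<omega>) \<le> q (x n) \<omega>" for n
        using elim(1,2,5) by (auto simp: q_def intro!: frac_le add_pos_nonneg)
      then have "1 / (1 + \<eta> \<omega>) \<le> g \<omega>" using elim(3) by (intro LIMSEQ_le_const) auto
      then show ?case using elim(4,5) by (simp add: \<xi>_def field_simps)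
    qed
  qed
qed

text \<open>\<open>opnorm\<close> is picked by \<open>SOME\<close> among the greatest lower bounds,
  which agree almost surely. The least bound is itself a bound, so the infimum is attained, and an
  estimate of \<open>opnorm\<close> becomes an estimate of every \<open>nrm (T x)\<close>.\<close>

lemma opnorm_le_iff:
  assumes T: "bounded_op M sm nrm T" and \<eta>: "\<eta> \<in> borel_measurable M" "AE \<omega> in M. 0 \<le> \<eta> \<omega>"
  shows "(AE \<omega> in M. opnorm M nrm T \<omega> \<le> \<eta> \<omega>) \<longleftrightarrow> (\<forall>x. AE \<omega> in M. nrm (T x) \<omega> \<le> \<eta> \<omega> * nrm x \<omega>)"
proof -
  obtain \<xi> where \<xi>: "op_bound T \<xi>" "\<And>\<eta>. op_bound T \<eta> \<Longrightarrow> AE \<omega> in M. \<xi> \<omega> \<le> \<eta> \<omega>"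
    using bounded_op_least_bound[OF T] by blast
  have "L0_glb M {\<eta>. op_bound T \<eta>} \<xi>"
    unfolding L0_glb_def using \<xi> op_bound_def by blast
  moreover from this have "L0_glb M {\<eta>. op_bound T \<eta>} (opnorm M nrm T)"
    using someI[of "L0_glb M {\<eta>. op_bound T \<eta>}" \<xi>] by (simp add: opnorm_def op_bound_def)
  ultimately have opn: "AE \<omega> in M. \<xi> \<omega> \<le> opnorm M nrm T \<omega>"
    "\<And>h. op_bound T h \<Longrightarrow> AE \<omega> in M. opnorm M nrm T \<omega> \<le> h \<omega>"
    unfolding L0_glb_def by blast+
  have \<xi>3: "AE \<omega> in M. nrm (T x) \<omega> \<le> \<xi> \<omega> * nrm x \<omega>" for x
    using \<xi>(1) unfolding op_bound_def by blast
  show ?thesis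
  proof
    assume le: "AE \<omega> in M. opnorm M nrm T \<omega> \<le> \<eta> \<omega>"
    show "\<forall>x. AE \<omega> in M. nrm (T x) \<omega> \<le> \<eta> \<omega> * nrm x \<omega>"
    proof
      fix x
      show "AE \<omega> in M. nrm (T x) \<omega> \<le> \<eta> \<omega> * nrm x \<omega>"
        using opn(1) le \<xi>3[of x] nrm_nonneg[of x]
      proof eventually_elim
        case (elim \<omega>)
        then have "\<xi> \<omega> * nrm x \<omega> \<le> \<eta> \<omega> * nrm x \<omega>" by (intro mult_right_mono) auto
        then show ?case using elim by linarith
      qed
    qed
  qed (use \<eta> opn(2)[of \<eta>] in \<open>simp add: op_bound_def\<close>)
qed

end

section \<open>Consequences of completeness\<close>

locale complete_RN_space = RN_space +
  assumes complete: "rn_complete M nrm"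
begin

lemma Cauchy_conv:
  assumes "\<And>e. 0 < e \<Longrightarrow> \<exists>N. \<forall>n\<ge>N. rho (f n - f N) < e"
  shows "\<exists>x. conv f x sequentially"
proof -
  have "rn_Cauchy M nrm f"
    unfolding rn_Cauchy_def
  proof (intro allI impI order_tendstoI)
    fix e a :: real assume e: "0 < e" and "0 < a"
    then have "0 < a * min 1 e / 2" by auto
    then obtain N where N: "\<And>n. n \<ge> N \<Longrightarrow> rho (f n - f N) < a * min 1 e / 2" using assms by blast
    have "prob {\<omega> \<in> space M. e \<le> nrm (f n - f m) \<omega>} < a" if "n \<ge> N" "m \<ge> N" for n m
    proof -
      have "min 1 e * prob {\<omega> \<in> space M. e \<le> nrm (f n - f m) \<omega>} \<le> rho (f n - f m)"
        unfolding rho_def by (rule prob_le_pmag[OF nrm_measurable e])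
      also have "\<dots> < a * min 1 e"
        using N[OF that(1)] N[OF that(2)] rho_triangle[of "f n" "f m" "f N"] rho_minus_commute[of "f N" "f m"]
        by simp
      finally show ?thesis using e by (simp add: mult.commute)
    qed
    then show "\<forall>\<^sub>F p in sequentially \<times>\<^sub>F sequentially.
        (case p of (n, m) \<Rightarrow> prob {\<omega> \<in> space M. e \<le> nrm (f n - f m) \<omega>}) < a"
      unfolding eventually_prod_sequentially by auto
  qed (auto intro!: always_eventually elim: less_le_trans)
  then show ?thesis using complete unfolding rn_complete_def by blast
qed

lemma Cauchy_conv_nrm:
  assumes [measurable]: "\<And>n. g n \<in> borel_measurable M"
    and le: "\<And>n m. n \<le> m \<Longrightarrow> AE \<omega> in M. nrm (f m - f n) \<omega> \<le> g n \<omega>"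
    and lim: "(\<lambda>n. pmag (g n)) \<longlonglongrightarrow> 0"
  shows "\<exists>x. conv f x sequentially"
proof (rule Cauchy_conv)
  fix e :: real assume "0 < e"
  then obtain N where "pmag (g N) < e" using order_tendstoD(2)[OF lim] by (auto simp: eventually_sequentially)
  then show "\<exists>N. \<forall>n\<ge>N. rho (f n - f N) < e" using rho_le_pmag[OF _ le] assms(1) by (meson le_less_trans)
qed

text \<open>Contractions are equicontinuous for \<open>rho\<close>, so the Cauchy property passes
  from \<open>G\<close> to its closure.\<close>

lemma Cauchy_conv_dense:
  assumes V: "\<And>n. contr (V n)"
    and dense: "\<And>x. \<exists>f. (\<forall>n. f n \<in> G) \<and> conv f x sequentially"
    and G: "\<And>z. z \<in> G \<Longrightarrow> \<exists>y. conv (\<lambda>n. V n z) y sequentially"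
  shows "\<exists>y. conv (\<lambda>n. V n x) y sequentially"
proof (rule Cauchy_conv)
  fix e :: real assume e: "0 < e"
  obtain f where f: "\<And>n. f n \<in> G" "conv f x sequentially" using dense by metis
  then obtain k where k: "rho (f k - x) < e / 4"
    using conv_epsD[of f x sequentially "e / 4"] e by (auto simp: eventually_sequentially)
  obtain y where "conv (\<lambda>n. V n (f k)) y sequentially" using G f by blast
  then obtain N where N: "\<And>n. n \<ge> N \<Longrightarrow> rho (V n (f k) - y) < e / 4"
    using conv_epsD[of _ y sequentially "e / 4"] e by (fastforce simp: eventually_sequentially)
  have "rho (V n x - V N x) < e" if "n \<ge> N" for n
  proof -
    have "rho (V n x - V N x) \<le> rho (V n x - V n (f k)) + rho (V n (f k) - y) + rho (y - V N (f k)) + rho (V N (f k) - V N x)"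
      using rho_triangle[of "V n x" "V N x" "V N (f k)"] rho_triangle[of "V n x" "V N (f k)" y]
        rho_triangle[of "V n x" y "V n (f k)"] by linarith
    moreover have "rho (V n x - V n (f k)) < e / 4"
      using contr_rho_diff[OF V, of n "f k" x] k rho_minus_commute by (metis le_less_trans)
    moreover have "rho (V N (f k) - V N x) < e / 4"
      using contr_rho_diff[OF V, of N "f k" x] k by simp
    ultimately show ?thesis using N[OF that] N[of N] rho_minus_commute[of y] by simp
  qed
  then show "\<exists>N. \<forall>n\<ge>N. rho (V n x - V N x) < e" by blast
qed

end

section \<open>Integrals of semigroup orbits\<close>

context RN_space
begin

section \<open>Limits in the scalar factor, and normalization of a vector\<close>

lemma conv_rs_left:
  assumes "(a \<longlongrightarrow> a0) F"
  shows "conv (\<lambda>t. rs (a t) x) (rs a0 x) F"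
proof (rule conv_nrm_le)
  have "((\<lambda>t. pmag (\<lambda>_. a t - a0)) \<longlongrightarrow> 0) F"
  proof -
    have "((\<lambda>t. min 1 \<bar>a t - a0\<bar>) \<longlongrightarrow> min 1 \<bar>a0 - a0\<bar>) F" by (intro tendsto_intros assms)
    then show ?thesis by (simp add: pmag_def prob_space)
  qed
  then have "((\<lambda>t. pmag (\<lambda>\<omega>. nrm x \<omega> * (a t - a0))) \<longlongrightarrow> 0) F"
    by (intro pmag_mult_tendsto) auto
  then show "((\<lambda>t. pmag (\<lambda>\<omega>. \<bar>nrm x \<omega> * (a t - a0)\<bar>)) \<longlongrightarrow> 0) F"
    by (simp add: pmag_def)
  show "\<forall>\<^sub>F t in F. AE \<omega> in M. nrm (rs (a t) x - rs a0 x) \<omega> \<le> \<bar>nrm x \<omega> * (a t - a0)\<bar>"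
  proof (rule always_eventually, rule allI)
    fix t
    show "AE \<omega> in M. nrm (rs (a t) x - rs a0 x) \<omega> \<le> \<bar>nrm x \<omega> * (a t - a0)\<bar>"
      using nrm_rs[of "a t - a0" x] nrm_nonneg[of x] unfolding rs_diff_left[symmetric]
      by eventually_elim (simp add: abs_mult)
  qed
qed auto

lemma conv_at_right_sequentially:
  assumes "\<And>S. (\<And>n. 0 < S n) \<Longrightarrow> S \<longlonglongrightarrow> (0::real) \<Longrightarrow> conv (\<lambda>n. f (S n)) x sequentially"
  shows "conv f x (at_right 0)"
  unfolding conv_iff
  by (rule tendsto_at_right_sequentially[where b=1]) (use assms in \<open>auto simp: conv_iff\<close>)

text \<open>Dominated convergence works along sequences, so the one-sided limit is first reduced to
  sequences tending to 0 from the right.\<close>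

lemma conv_sm_left:
  assumes [measurable]: "\<And>t. \<zeta> t \<in> borel_measurable M" "\<zeta>0 \<in> borel_measurable M"
    and lim: "\<And>\<omega>. ((\<lambda>t. \<zeta> t \<omega>) \<longlongrightarrow> \<zeta>0 \<omega>) (at_right (0::real))"
  shows "conv (\<lambda>t. sm (\<zeta> t) x) (sm \<zeta>0 x) (at_right 0)"
proof (rule conv_at_right_sequentially)
  fix S :: "nat \<Rightarrow> real" assume S: "\<And>n. 0 < S n" "S \<longlonglongrightarrow> 0"
  then have S': "filterlim S (at_right 0) sequentially"
    by (auto simp: filterlim_at less_imp_neq[symmetric] intro!: always_eventually)
  show "conv (\<lambda>n. sm (\<zeta> (S n)) x) (sm \<zeta>0 x) sequentially"
  proof (rule conv_nrm_le)
    have "(\<lambda>n. pmag (\<lambda>\<omega>. cmod (\<zeta> (S n) \<omega> - \<zeta>0 \<omega>) * nrm x \<omega>)) \<longlonglongrightarrow> pmag (\<lambda>_. 0)"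
    proof (rule pmag_tendsto_AE)
      have "(\<lambda>n. cmod (\<zeta> (S n) \<omega> - \<zeta>0 \<omega>) * nrm x \<omega>) \<longlonglongrightarrow> cmod (\<zeta>0 \<omega> - \<zeta>0 \<omega>) * nrm x \<omega>" for \<omega>
        by (intro tendsto_intros filterlim_compose[OF lim S'])
      then show "AE \<omega> in M. (\<lambda>n. cmod (\<zeta> (S n) \<omega> - \<zeta>0 \<omega>) * nrm x \<omega>) \<longlonglongrightarrow> 0" by simp
    qed auto
    then show "(\<lambda>n. pmag (\<lambda>\<omega>. cmod (\<zeta> (S n) \<omega> - \<zeta>0 \<omega>) * nrm x \<omega>)) \<longlonglongrightarrow> 0" by simp
    show "\<forall>\<^sub>F n in sequentially. AE \<omega> in M. nrm (sm (\<zeta> (S n)) x - sm \<zeta>0 x) \<omega> \<le> cmod (\<zeta> (S n) \<omega> - \<zeta>0 \<omega>) * nrm x \<omega>"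
    proof (rule always_eventually, rule allI)
      fix n
      have "(\<lambda>\<omega>. \<zeta> (S n) \<omega> - \<zeta>0 \<omega>) \<in> borel_measurable M" by measurable
      from nrm_sm[OF this, of x]
      show "AE \<omega> in M. nrm (sm (\<zeta> (S n)) x - sm \<zeta>0 x) \<omega> \<le> cmod (\<zeta> (S n) \<omega> - \<zeta>0 \<omega>) * nrm x \<omega>"
        unfolding sm_diff_left[OF assms(1,2)] by eventually_elim simp
    qed
  qed auto
qed

text \<open>With the bound \<open>1 / 2\<close>, every difference of two contracted copies of
  \<open>x'\<close> has norm at most 1, so the truncation in \<open>rho\<close> is inactive. The
  scaling factor is at least 2 at every \<omega> and hence invertible; \<open>max 0\<close> covers
  the null set on which the representative \<open>nrm x\<close> may be negative.\<close>

lemma normalize: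
  obtains \<zeta> x' where "\<zeta> \<in> borel_measurable M" "x = sm \<zeta> x'" "AE \<omega> in M. nrm x' \<omega> \<le> 1 / 2"
proof -
  define r where "r \<omega> = 2 * (1 + max 0 (nrm x \<omega>))" for \<omega>
  have [measurable]: "r \<in> borel_measurable M" unfolding r_def by measurable
  have r2: "2 \<le> r \<omega>" for \<omega> by (auto simp: r_def)
  have m: "(\<lambda>\<omega>. 1 / r \<omega>) \<in> borel_measurable M" by measurable
  have "AE \<omega> in M. nrm (sm (\<lambda>\<omega>. complex_of_real (1 / r \<omega>)) x) \<omega> \<le> 1 / 2"
    using nrm_sm_real[OF m, of x] nrm_nonneg[of x]
  proof eventually_elim
    case (elim \<omega>)
    have "nrm x \<omega> \<le> r \<omega> / 2" by (simp add: r_def)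
    then show ?case unfolding elim(1) using r2[of \<omega>] by (simp add: field_simps)
  qed
  moreover have "x = sm (\<lambda>\<omega>. complex_of_real (r \<omega>)) (sm (\<lambda>\<omega>. complex_of_real (1 / r \<omega>)) x)"
  proof -
    have "r \<omega> \<noteq> 0" for \<omega> using r2[of \<omega>] by auto
    then show ?thesis by (simp add: sm_sm)
  qed
  ultimately show ?thesis by (intro that[of "\<lambda>\<omega>. complex_of_real (r \<omega>)"]) auto
qed

end

section \<open>Counting dyadic steps\<close>

definition steps :: "nat \<Rightarrow> real \<Rightarrow> nat" where
  "steps n t = nat \<lfloor>2 ^ n * t\<rfloor>"

lemma steps_le: "0 \<le> t \<Longrightarrow> real (steps n t) \<le> 2 ^ n * t"
  and steps_gt: "2 ^ n * t < real (steps n t) + 1"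
  unfolding steps_def by (simp, linarith)

text \<open>\<open>d\<close> is the carry of the two fractional parts, so rounding disturbs
  additivity by at most one step of length \<open>2^-n\<close>.\<close>

lemma steps_add:
  assumes "0 \<le> s" "0 \<le> t"
  obtains d where "d \<le> 1" "steps n (s + t) = steps n s + steps n t + d"
proof -
  have "\<lfloor>2 ^ n * s\<rfloor> \<ge> 0" "\<lfloor>2 ^ n * t\<rfloor> \<ge> 0" "\<lfloor>2 ^ n * (s + t)\<rfloor> \<ge> 0" using assms by auto
  moreover have "\<lfloor>2 ^ n * (s + t)\<rfloor> = \<lfloor>2 ^ n * s\<rfloor> + \<lfloor>2 ^ n * t\<rfloor> \<or> \<lfloor>2 ^ n * (s + t)\<rfloor> = \<lfloor>2 ^ n * s\<rfloor> + \<lfloor>2 ^ n * t\<rfloor> + 1"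
    unfolding distrib_left by linarith
  ultimately have "steps n (s + t) = steps n s + steps n t + 0 \<or> steps n (s + t) = steps n s + steps n t + 1"
    unfolding steps_def by linarith
  then show ?thesis using that[of 0] that[of 1] by auto
qed

text \<open>\<open>L\<close> counts the fine steps that lie beyond the last full coarse
  interval.\<close>

lemma steps_refine:
  assumes "0 \<le> t"
  obtains L where "L \<le> 2 ^ j" "steps (n + j) t = 2 ^ j * steps n t + L"
proof -
  have "2 ^ j * real (steps n t) \<le> 2 ^ j * (2 ^ n * t)"
    by (intro mult_left_mono steps_le assms) auto
  also have "2 ^ j * (2 ^ n * t) = 2 ^ (n + j) * t" by (simp add: power_add)
  also have "\<dots> < real (steps (n + j) t) + 1" by (rule steps_gt)
  finally have "2 ^ j * real (steps n t) < real (steps (n + j) t) + 1" .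
  then have "real (2 ^ j * steps n t) < real (steps (n + j) t + 1)" by simp
  then have 1: "2 ^ j * steps n t \<le> steps (n + j) t" unfolding of_nat_less_iff by simp
  have "real (steps (n + j) t) \<le> 2 ^ j * (2 ^ n * t)"
    using steps_le[OF assms, of "n + j"] by (simp add: power_add mult_ac)
  also have "\<dots> < 2 ^ j * (real (steps n t) + 1)"
    by (intro mult_strict_left_mono steps_gt) auto
  finally have "real (steps (n + j) t) < real (2 ^ j * (steps n t + 1))" by (simp add: algebra_simps)
  then have "steps (n + j) t < 2 ^ j * (steps n t + 1)" unfolding of_nat_less_iff .
  then show ?thesis using 1 by (intro that[of "steps (n + j) t - 2 ^ j * steps n t"]) auto
qed

text \<open>The condition on \<open>opnorm\<close> is replaced by contractivity of each
  \<open>T t\<close>; \<open>contraction_C0_semigroup_iff\<close> shows that nothing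
  changes.\<close>

locale contr_semigroup = complete_RN_space M sm nrm
  for M :: "'w measure" and sm :: "('w \<Rightarrow> complex) \<Rightarrow> 's::ab_group_add \<Rightarrow> 's" and nrm +
  fixes T :: "real \<Rightarrow> 's \<Rightarrow> 's"
  assumes contr_T: "0 \<le> t \<Longrightarrow> contr (T t)"
    and T_0: "T 0 x = x"
    and T_add: "0 \<le> s \<Longrightarrow> 0 \<le> t \<Longrightarrow> T s (T t x) = T (s + t) x"
    and T_cont: "conv (\<lambda>t. T t x) x (at_right 0)"
begin

lemma hom_T: "0 \<le> t \<Longrightarrow> hom (T t)"
  by (rule contr_hom[OF contr_T])

lemma T_commute: "0 \<le> s \<Longrightarrow> 0 \<le> t \<Longrightarrow> T s (T t x) = T t (T s x)"
  by (simp add: T_add add.commute)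

lemma T_eps:
  assumes "0 < e"
  obtains \<delta> where "0 < \<delta>" "\<And>s. 0 \<le> s \<Longrightarrow> s < \<delta> \<Longrightarrow> rho (T s x - x) < e"
proof -
  obtain \<delta> where \<delta>: "0 < \<delta>" "\<And>s. 0 < s \<Longrightarrow> s < \<delta> \<Longrightarrow> rho (T s x - x) < e"
    using conv_epsD[OF T_cont assms, of x] by (auto simp: eventually_at_right_field)
  show ?thesis
  proof (rule that[OF \<delta>(1)])
    fix s :: real assume "0 \<le> s" "s < \<delta>"
    then show "rho (T s x - x) < e" using \<delta>(2)[of s] assms by (cases "s = 0") (auto simp: T_0)
  qed
qed

section \<open>Dyadic Riemann sums along an orbit\<close>

definition rsum :: "nat \<Rightarrow> nat \<Rightarrow> 's \<Rightarrow> 's" where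
  "rsum n K x = rs (1 / 2 ^ n) (\<Sum>k<K. T (real k / 2 ^ n) x)"

lemma hom_rsum: "hom (rsum n K)"
  unfolding hom_def rsum_def
  by (auto simp: hom_add[OF hom_T] hom_sm[OF hom_T] sum.distrib sm_add_right sm_sum_right sm_commute)

lemma nrm_rsum: "AE \<omega> in M. nrm (rsum n K x) \<omega> \<le> (real K / 2 ^ n) * nrm x \<omega>"
proof -
  have "AE \<omega> in M. \<forall>k. nrm (T (real k / 2 ^ n) x) \<omega> \<le> nrm x \<omega>"
    unfolding AE_all_countable by (intro allI contr_nrm contr_T) auto
  then show ?thesis
    using nrm_rs[of "1 / 2 ^ n" "\<Sum>k<K. T (real k / 2 ^ n) x"] nrm_sum[of "{..<K}" "\<lambda>k. T (real k / 2 ^ n) x", simplified]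
    unfolding rsum_def
  proof eventually_elim
    case (elim \<omega>)
    have "(\<Sum>k<K. nrm (T (real k / 2 ^ n) x) \<omega>) \<le> (\<Sum>k<K. nrm x \<omega>)"
      using elim by (intro sum_mono) auto
    then show ?case using elim by (simp add: divide_right_mono)
  qed
qed

lemma T_rsum: "0 \<le> s \<Longrightarrow> T s (rsum n K x) = rsum n K (T s x)"
  unfolding rsum_def by (simp add: hom_sm[OF hom_T] hom_sum[OF hom_T] T_commute[of s])

lemma rsum_add: "rsum n (K + L) x = rsum n K x + T (real K / 2 ^ n) (rsum n L x)"
proof -
  have "(\<Sum>k<K + L. T (real k / 2 ^ n) x) = (\<Sum>k<K. T (real k / 2 ^ n) x) + (\<Sum>k<L. T (real (K + k) / 2 ^ n) x)"
    by (induction L) (auto simp: add.assoc)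
  then show ?thesis
    unfolding rsum_def
    by (simp add: sm_add_right hom_sm[OF hom_T] hom_sum[OF hom_T] T_add add_divide_distrib)
qed

text \<open>By the semigroup law the orbit on each coarse interval is a shift of the orbit on the
  first one. Refining the grid thus amounts to replacing \<open>x\<close>, inside the unchanged
  coarse sum, by the mean of its orbit over one coarse interval. Comparing two levels reduces to
  comparing that mean with \<open>x\<close>.\<close>

lemma rsum_refine: "rsum (n + j) (2 ^ j * K) x = rsum n K (rs (2 ^ n) (rsum (n + j) (2 ^ j) x))"
proof (induction K)
  case 0
  then show ?case by (simp add: rsum_def)
next
  case (Suc K)
  have "rsum (n + j) (2 ^ j * Suc K) x = rsum (n + j) (2 ^ j * K) x + T (real (2 ^ j * K) / 2 ^ (n + j)) (rsum (n + j) (2 ^ j) x)"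
    using rsum_add[of "n + j" "2 ^ j * K" "2 ^ j" x] by (simp add: add.commute)
  also have "real (2 ^ j * K) / 2 ^ (n + j) = real K / 2 ^ n" by (simp add: power_add)
  also have "rsum (n + j) (2 ^ j) x = rsum n 1 (rs (2 ^ n) (rsum (n + j) (2 ^ j) x))"
    unfolding rsum_def[of n] by (simp add: T_0 rs_rs del: of_real_divide of_real_power)
  finally show ?case unfolding Suc using rsum_add[of n K 1] by simp
qed

text \<open>The difference consists of increments with weight \<open>c\<close> and of
  \<open>x\<close> with the missing mass \<open>1 - c * real K\<close>. These weights form a convex
  combination of vectors of norm at most 1, so the bound does not deteriorate as the number of
  sample points grows.\<close>

lemma rho_average_diff:
  assumes x: "AE \<omega> in M. nrm x \<omega> \<le> 1 / 2" and c: "0 \<le> c" "c * real K \<le> 1"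
    and e: "0 \<le> e" "\<And>k. k < K \<Longrightarrow> rho (T (real k / 2 ^ n) x - x) \<le> e"
  shows "rho (rs c (\<Sum>k<K. T (real k / 2 ^ n) x) - x) \<le> e + (1 - c * real K)"
proof -
  define y where "y k = (if k < K then T (real k / 2 ^ n) x - x else x)" for k
  define w where "w k = (if k < K then c else 1 - c * real K)" for k
  have w0: "0 \<le> w k" for k using c by (simp add: w_def)
  have y1: "AE \<omega> in M. nrm (y k) \<omega> \<le> 1" for k
  proof (cases "k < K")
    case True
    have k: "0 \<le> real k / 2 ^ n" by simp
    have "AE \<omega> in M. nrm (T (real k / 2 ^ n) x - x) \<omega> \<le> 1"
      using nrm_diff_triangle[of "T (real k / 2 ^ n) x" x] contr_nrm[OF contr_T[OF k], of x] x
      by eventually_elim simp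
    then show ?thesis by (simp add: y_def True)
  qed (use x in \<open>auto simp: y_def elim: eventually_mono\<close>)
  have eq: "rs c (\<Sum>k<K. T (real k / 2 ^ n) x) - x = (\<Sum>k<K. rs c (y k)) + rs (- (1 - c * real K)) (y K)"
  proof -
    have "(\<Sum>k<K. rs c (y k)) = (\<Sum>k<K. rs c (T (real k / 2 ^ n) x) - rs c x)"
      by (intro sum.cong) (auto simp: y_def sm_diff_right)
    also have "\<dots> = rs c (\<Sum>k<K. T (real k / 2 ^ n) x) - rs (real K) (rs c x)"
      by (simp add: sum_subtractf sm_sum_right sum_const_rs)
    also have "rs (real K) (rs c x) = rs (c * real K) x" unfolding rs_rs by (simp add: mult.commute)
    finally have 1: "(\<Sum>k<K. rs c (y k)) = rs c (\<Sum>k<K. T (real k / 2 ^ n) x) - rs (c * real K) x" .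
    have "rs (c * real K - 1) x = rs (c * real K) x - x" by (simp only: rs_diff_left rs_1)
    moreover have "- (1 - c * real K) = c * real K - 1" by simp
    ultimately show ?thesis unfolding 1 by (simp add: y_def del: of_real_diff)
  qed
  have "AE \<omega> in M. \<forall>k. nrm (rs c (y k)) \<omega> = c * nrm (y k) \<omega>"
    unfolding AE_all_countable using nrm_rs[of c] c(1) by auto
  then have bound: "AE \<omega> in M. nrm (rs c (\<Sum>k<K. T (real k / 2 ^ n) x) - x) \<omega> \<le> (\<Sum>k<Suc K. w k * nrm (y k) \<omega>)"
    using nrm_triangle[of "\<Sum>k<K. rs c (y k)" "rs (- (1 - c * real K)) (y K)"]
      nrm_sum[of "{..<K}" "\<lambda>k. rs c (y k)", OF finite_lessThan] nrm_rs[of "- (1 - c * real K)" "y K"]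
    unfolding eq
  proof eventually_elim
    case (elim \<omega>)
    have "(\<Sum>k<K. nrm (rs c (y k)) \<omega>) = (\<Sum>k<K. w k * nrm (y k) \<omega>)"
      using elim by (intro sum.cong) (auto simp: w_def)
    moreover have "\<bar>- (1 - c * real K)\<bar> = w K" using c by (simp add: w_def)
    ultimately show ?case using elim by simp
  qed
  have "rho (rs c (\<Sum>k<K. T (real k / 2 ^ n) x) - x) \<le> (\<Sum>k<Suc K. w k * rho (y k))"
    by (rule rho_weighted_sum[OF _ w0 y1 bound]) auto
  also have "\<dots> \<le> (\<Sum>k<K. c * e) + (1 - c * real K) * 1"
  proof -
    show ?thesis unfolding sum.lessThan_Suc
      by (intro add_mono sum_mono mult_mono) (use c e in \<open>auto simp: w_def y_def rho_nonneg rho_le_1\<close>)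
  qed
  also have "\<dots> \<le> e + (1 - c * real K)"
    using mult_right_mono[OF c(2) e(1)] by (simp add: mult_ac)
  finally show ?thesis .
qed

lemma rsum_conv_small:
  assumes x: "AE \<omega> in M. nrm x \<omega> \<le> 1 / 2" and t: "0 \<le> t"
  shows "\<exists>y. conv (\<lambda>n. rsum n (steps n t) x) y sequentially"
proof (rule Cauchy_conv)
  fix e :: real assume e: "0 < e"
  \<comment> \<open>The coarse sum multiplies errors by at most \<open>t\<close>, so
    \<open>t * e' \<le> e / 2\<close> is wanted; \<open>t + 1\<close> keeps the denominator positive
    when \<open>t = 0\<close>.\<close>
  define e' where "e' = e / (2 * (t + 1))"
  have e': "0 < e'" using e t by (simp add: e'_def)
  obtain \<delta> where \<delta>: "0 < \<delta>" "\<And>s. 0 \<le> s \<Longrightarrow> s < \<delta> \<Longrightarrow> rho (T s x - x) < e'"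
    using T_eps[OF e', of x] by blast
  have "(\<lambda>n. (1 / 2) ^ n) \<longlonglongrightarrow> (0::real)" by (rule LIMSEQ_realpow_zero) auto
  then have "\<forall>\<^sub>F n in sequentially. (1 / 2) ^ n < min \<delta> (e / 2)"
    using \<delta>(1) e by (intro order_tendstoD(2)) auto
  then obtain n where n: "(1 / 2) ^ n < min \<delta> (e / 2)" by (auto simp: eventually_sequentially)
  have "rho (rsum m (steps m t) x - rsum n (steps n t) x) < e" if "m \<ge> n" for m
  proof -
    obtain j where m: "m = n + j" using \<open>m \<ge> n\<close> le_Suc_ex by blast
    obtain L where L: "L \<le> 2 ^ j" "steps m t = 2 ^ j * steps n t + L"
      using steps_refine[OF t, of j n] unfolding m by blast
    define q where "q = real (2 ^ j * steps n t) / 2 ^ m"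
    have q0: "0 \<le> q" by (simp add: q_def)
    \<comment> \<open>\<open>Q\<close> is the mean of the orbit over the first coarse interval; all
      its \<open>2 ^ j\<close> sample times are smaller than \<open>2^-n\<close>.\<close>
    define Q where "Q = rs (2 ^ n) (rsum m (2 ^ j) x)"
    have Q: "Q = rs (1 / 2 ^ j) (\<Sum>k<2 ^ j. T (real k / 2 ^ m) x)"
      unfolding Q_def rsum_def rs_rs m by (simp add: power_add)
    have rQ: "rho (Q - x) \<le> e'"
    proof -
      have "rho (Q - x) \<le> e' + (1 - 1 / 2 ^ j * real (2 ^ j))"
        unfolding Q
      proof (rule rho_average_diff[OF x])
        fix k :: nat assume "k < 2 ^ j"
        then have "real k < 2 ^ j" by (metis of_nat_less_iff of_nat_numeral of_nat_power)
        then have "real k / 2 ^ m < (1 / 2) ^ n" by (simp add: m power_add field_simps power_divide)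
        then show "rho (T (real k / 2 ^ m) x - x) \<le> e'" using \<delta>(2)[of "real k / 2 ^ m"] n by auto
      qed (use e' in auto)
      then show ?thesis by simp
    qed
    have Q1: "AE \<omega> in M. nrm (Q - x) \<omega> \<le> 1"
    proof -
      have "AE \<omega> in M. nrm Q \<omega> \<le> nrm x \<omega>"
        using nrm_rs[of "2 ^ n" "rsum m (2 ^ j) x"] nrm_rsum[of m "2 ^ j" x] unfolding Q_def
        by eventually_elim (simp add: m power_add field_simps)
      then show ?thesis using nrm_diff_triangle[of Q x] x by eventually_elim simp
    qed
    have eq: "rsum m (steps m t) x - rsum n (steps n t) x = rsum n (steps n t) (Q - x) + T q (rsum m L x)"
      unfolding L(2) rsum_add q_def Q_def hom_diff[OF hom_rsum] unfolding m rsum_refine by simp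
    \<comment> \<open>Index 0 is the coarse sum of \<open>Q - x\<close>, of total length at most
      \<open>t\<close>; the other index is the remainder, of length at most one coarse
      interval.\<close>
    define w where "w i = (if i = (0::nat) then t else 1 / 2 ^ n)" for i
    define y where "y i = (if i = (0::nat) then Q - x else x)" for i
    have "AE \<omega> in M. nrm (rsum m (steps m t) x - rsum n (steps n t) x) \<omega> \<le> t * nrm (Q - x) \<omega> + 1 / 2 ^ n * nrm x \<omega>"
      using nrm_triangle[of "rsum n (steps n t) (Q - x)" "T q (rsum m L x)"]
        nrm_rsum[of n "steps n t" "Q - x"] contr_nrm[OF contr_T[OF q0], of "rsum m L x"] nrm_rsum[of m L x]
        nrm_nonneg[of x] nrm_nonneg[of "Q - x"]
      unfolding eq
    proof eventually_elim
      case (elim \<omega>)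
      have "real (steps n t) / 2 ^ n \<le> t" using steps_le[OF t, of n] by (simp add: field_simps)
      then have "real (steps n t) / 2 ^ n * nrm (Q - x) \<omega> \<le> t * nrm (Q - x) \<omega>"
        using elim by (intro mult_right_mono)
      moreover have "real L \<le> 2 ^ j" using L(1) by (metis of_nat_le_iff of_nat_numeral of_nat_power)
      then have "real L / 2 ^ m \<le> 1 / 2 ^ n" by (simp add: m power_add field_simps)
      then have "real L / 2 ^ m * nrm x \<omega> \<le> 1 / 2 ^ n * nrm x \<omega>"
        using elim by (intro mult_right_mono)
      ultimately show ?case using elim by simp
    qed
    then have "AE \<omega> in M. nrm (rsum m (steps m t) x - rsum n (steps n t) x) \<omega> \<le> (\<Sum>i\<in>{0, 1}. w i * nrm (y i) \<omega>)"
      by (simp add: w_def y_def)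
    then have "rho (rsum m (steps m t) x - rsum n (steps n t) x) \<le> (\<Sum>i\<in>{0, 1}. w i * rho (y i))"
    proof (rule rho_weighted_sum[rotated -1])
      fix k :: nat
      show "0 \<le> w k" using t by (simp add: w_def)
      show "AE \<omega> in M. nrm (y k) \<omega> \<le> 1" using Q1 x by (auto simp: y_def elim: eventually_mono)
    qed auto
    also have "\<dots> = t * rho (Q - x) + (1 / 2) ^ n * rho x" by (simp add: w_def y_def power_divide)
    also have "\<dots> < e"
    proof -
      have "(1 / 2) ^ n * rho x \<le> (1 / 2) ^ n * 1" by (intro mult_left_mono rho_le_1) auto
      moreover have "t * rho (Q - x) \<le> t * e'" using rQ t by (intro mult_left_mono)
      moreover have "t * e' \<le> e / 2" using t e by (simp add: e'_def field_simps)
      moreover have "(1 / 2) ^ n < e / 2" using n by simp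
      ultimately show ?thesis by linarith
    qed
    finally show ?thesis .
  qed
  then show "\<exists>N. \<forall>n\<ge>N. rho (rsum n (steps n t) x - rsum N (steps N t) x) < e" by blast
qed

lemma rsum_conv:
  assumes "0 \<le> t"
  shows "\<exists>y. conv (\<lambda>n. rsum n (steps n t) x) y sequentially"
proof -
  obtain \<zeta> x' where \<zeta>: "\<zeta> \<in> borel_measurable M" and x: "x = sm \<zeta> x'" "AE \<omega> in M. nrm x' \<omega> \<le> 1 / 2"
    by (rule normalize)
  obtain y where "conv (\<lambda>n. rsum n (steps n t) x') y sequentially"
    using rsum_conv_small[OF x(2) assms] by blast
  from conv_sm[OF \<zeta> this] show ?thesis by (auto simp: x(1) hom_sm[OF hom_rsum \<zeta>])
qed

section \<open>The orbit integral\<close>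

definition integ :: "real \<Rightarrow> 's \<Rightarrow> 's" where
  "integ t x = (SOME y. conv (\<lambda>n. rsum n (steps n t) x) y sequentially)"

lemma integ_conv: "0 \<le> t \<Longrightarrow> conv (\<lambda>n. rsum n (steps n t) x) (integ t x) sequentially"
  unfolding integ_def by (rule someI_ex[OF rsum_conv])

lemma integ_eqI: "0 \<le> t \<Longrightarrow> conv (\<lambda>n. rsum n (steps n t) x) y sequentially \<Longrightarrow> integ t x = y"
  by (rule conv_unique[OF _ integ_conv]) auto

lemma hom_integ: "0 \<le> t \<Longrightarrow> hom (integ t)"
  unfolding hom_def
  by (auto intro!: integ_eqI conv_add conv_sm integ_conv simp: hom_add[OF hom_rsum] hom_sm[OF hom_rsum])

lemma nrm_rsum_steps: "0 \<le> t \<Longrightarrow> AE \<omega> in M. nrm (rsum n (steps n t) x) \<omega> \<le> t * nrm x \<omega>"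
  using nrm_rsum[of n "steps n t" x] nrm_nonneg[of x]
proof eventually_elim
  case (elim \<omega>)
  have "real (steps n t) / 2 ^ n \<le> t" using steps_le[OF elim(1), of n] by (simp add: field_simps)
  then show ?case using elim mult_right_mono by (metis order_trans)
qed

lemma nrm_integ: "0 \<le> t \<Longrightarrow> AE \<omega> in M. nrm (integ t x) \<omega> \<le> t * nrm x \<omega>"
  by (rule nrm_limit_le[OF _ integ_conv]) (auto intro!: always_eventually nrm_rsum_steps)

lemma integ_bounded_conv:
  assumes t: "0 \<le> t" and "conv f x F"
  shows "conv (\<lambda>s. integ t (f s)) (integ t x) F"
proof (rule conv_rho_mono)
  show "conv (\<lambda>s. rs t (f s)) (rs t x) F" by (rule conv_sm) (use assms in auto)
  show "AE \<omega> in M. nrm (integ t (f s) - integ t x) \<omega> \<le> nrm (rs t (f s) - rs t x) \<omega>" for s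
    using nrm_integ[OF t, of "f s - x"] nrm_rs[of t "f s - x"]
    unfolding hom_diff[OF hom_integ[OF t]] sm_diff_right[OF borel_measurable_const]
    by eventually_elim (use t in simp)
qed

lemma T_integ: "0 \<le> s \<Longrightarrow> 0 \<le> t \<Longrightarrow> T s (integ t x) = integ t (T s x)"
  by (rule integ_eqI[symmetric]) (use contr_conv[OF contr_T integ_conv] in \<open>auto simp: T_rsum\<close>)

text \<open>A general \<open>s\<close> is not a grid point. With \<open>q n\<close> the last grid
  point not exceeding \<open>s\<close>, \<open>T s\<close> splits into \<open>T (q n)\<close>, which
  respects the grid, and \<open>T (s - q n)\<close>, which is moved onto \<open>x\<close> and tends
  to the identity there. Rounding in \<open>steps\<close> adds at most one further term.\<close>

lemma integ_add:
  assumes s: "0 \<le> s" and t: "0 \<le> t"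
  shows "integ (s + t) x = integ s x + T s (integ t x)"
proof (rule integ_eqI)
  define q where "q n = real (steps n s) / 2 ^ n" for n
  have q0: "0 \<le> q n" for n by (simp add: q_def)
  have qs: "q n \<le> s" "s - q n < (1 / 2) ^ n" for n
  proof -
    show "q n \<le> s" using steps_le[OF s, of n] by (simp add: q_def field_simps)
    have "s < (real (steps n s) + 1) / 2 ^ n" using steps_gt[of n s] by (simp add: field_simps)
    then show "s - q n < (1 / 2) ^ n" by (simp add: q_def add_divide_distrib power_divide)
  qed
  have lim: "conv (\<lambda>n. T (s - q n) x) x sequentially"
  proof (rule conv_epsI)
    fix e :: real assume "0 < e"
    then obtain \<delta> where \<delta>: "0 < \<delta>" "\<And>s. 0 \<le> s \<Longrightarrow> s < \<delta> \<Longrightarrow> rho (T s x - x) < e" using T_eps by blast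
    have "(\<lambda>n. (1 / 2) ^ n) \<longlonglongrightarrow> (0::real)" by (rule LIMSEQ_realpow_zero) auto
    then have "\<forall>\<^sub>F n in sequentially. (1 / 2) ^ n < \<delta>" using \<delta>(1) by (rule order_tendstoD(2))
    then show "\<forall>\<^sub>F n in sequentially. rho (T (s - q n) x - x) < e"
    proof eventually_elim
      case (elim n)
      then show ?case using qs[of n] by (intro \<delta>(2)) auto
    qed
  qed
  have main: "conv (\<lambda>n. rsum n (steps n (s + t)) x - (rsum n (steps n s) x + T s (rsum n (steps n t) x))) 0 sequentially"
  proof (rule conv_rho_le)
    have "conv (\<lambda>n. rs t (T (s - q n) x)) (rs t x) sequentially" by (rule conv_sm[OF _ lim]) auto
    moreover have "conv (\<lambda>n. rs ((1 / 2) ^ n) x) (rs 0 x) sequentially"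
      by (rule conv_rs_left, rule LIMSEQ_realpow_zero) auto
    ultimately show "(\<lambda>n. rho (rs t (T (s - q n) x) - rs t x) + rho (rs ((1 / 2) ^ n) x)) \<longlonglongrightarrow> 0"
      unfolding conv_iff using tendsto_add by fastforce
    show "\<forall>\<^sub>F n in sequentially. rho (rsum n (steps n (s + t)) x - (rsum n (steps n s) x + T s (rsum n (steps n t) x)) - 0)
        \<le> rho (rs t (T (s - q n) x) - rs t x) + rho (rs ((1 / 2) ^ n) x)"
    proof (rule always_eventually, rule allI, rule rho_le_add)
      fix n
      obtain d where d: "d \<le> 1" "steps n (s + t) = steps n s + steps n t + d" by (rule steps_add[OF s t])
      define q' where "q' = real (steps n s + steps n t) / 2 ^ n"
      have q'0: "0 \<le> q'" by (simp add: q'_def)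
      let ?I = "rsum n (steps n t)"
      have "T s (?I x) = T (q n) (?I (T (s - q n) x))"
        using T_add[OF q0, of "s - q n" n "?I x"] qs by (simp add: T_rsum)
      then have eq: "rsum n (steps n (s + t)) x - (rsum n (steps n s) x + T s (?I x)) - 0
          = T q' (rsum n d x) - T (q n) (?I (T (s - q n) x - x))"
        unfolding d(2) rsum_add[of n "steps n s + steps n t"] rsum_add[of n "steps n s"] q'_def
          hom_diff[OF hom_rsum] hom_diff[OF hom_T[OF q0]] by (simp add: q_def algebra_simps)
      show "AE \<omega> in M. nrm (rsum n (steps n (s + t)) x - (rsum n (steps n s) x + T s (?I x)) - 0) \<omega>
          \<le> nrm (rs t (T (s - q n) x) - rs t x) \<omega> + nrm (rs ((1 / 2) ^ n) x) \<omega>"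
        using nrm_diff_triangle[of "T q' (rsum n d x)" "T (q n) (?I (T (s - q n) x - x))"]
          contr_nrm[OF contr_T[OF q0], of n "?I (T (s - q n) x - x)"] nrm_rsum_steps[OF t, of n "T (s - q n) x - x"]
          contr_nrm[OF contr_T[OF q'0], of "rsum n d x"] nrm_rsum[of n d x] nrm_nonneg[of x]
          nrm_rs[of t "T (s - q n) x - x"] nrm_rs[of "(1 / 2) ^ n" x]
        unfolding eq sm_diff_right[OF borel_measurable_const]
      proof eventually_elim
        case (elim \<omega>)
        have "real d / 2 ^ n * nrm x \<omega> \<le> (1 / 2) ^ n * nrm x \<omega>"
          using elim d(1) by (intro mult_right_mono) (auto simp: power_divide divide_right_mono)
        then show ?case using elim t by (simp add: power_divide)
      qed
    qed
  qed
  have "conv (\<lambda>n. (rsum n (steps n (s + t)) x - (rsum n (steps n s) x + T s (rsum n (steps n t) x)))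
      + (rsum n (steps n s) x + T s (rsum n (steps n t) x))) (0 + (integ s x + T s (integ t x))) sequentially"
    by (intro conv_add main contr_conv[OF contr_T[OF s]] integ_conv s t)
  then show "conv (\<lambda>n. rsum n (steps n (s + t)) x) (integ s x + T s (integ t x)) sequentially" by simp
qed (use s t in auto)

text \<open>For a normalized vector and fixed \<open>s\<close>, the grid average misses mass at most
  \<open>2^-n / s\<close>, which disappears as \<open>n\<close> grows, before \<open>s\<close> tends
  to 0. Linearity over random scalars removes the normalization.\<close>

lemma integ_mean: "conv (\<lambda>s. rs (1 / s) (integ s x)) x (at_right 0)"
proof -
  have small: "conv (\<lambda>s. rs (1 / s) (integ s x)) x (at_right 0)" if x: "AE \<omega> in M. nrm x \<omega> \<le> 1 / 2" for x
  proof (rule conv_epsI)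
    fix e :: real assume e: "0 < e"
    then obtain \<delta> where \<delta>: "0 < \<delta>" "\<And>s. 0 \<le> s \<Longrightarrow> s < \<delta> \<Longrightarrow> rho (T s x - x) < e / 2"
      using T_eps[of "e / 2"] by auto
    have "rho (rs (1 / s) (integ s x) - x) < e" if s: "0 < s" "s < \<delta>" for s
    proof -
      have le: "rho (rs (1 / s) (rsum n (steps n s) x) - x) \<le> e / 2 + (1 / s) * (1 / 2) ^ n" for n
      proof -
        let ?K = "steps n s" and ?c = "1 / s * (1 / 2 ^ n)"
        have K: "real ?K \<le> 2 ^ n * s" "2 ^ n * s < real ?K + 1" using steps_le[of s n] steps_gt[of n s] s by auto
        have "rs (1 / s) (rsum n ?K x) = rs ?c (\<Sum>k<?K. T (real k / 2 ^ n) x)"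
          unfolding rsum_def rs_rs ..
        moreover have "rho (rs ?c (\<Sum>k<?K. T (real k / 2 ^ n) x) - x) \<le> e / 2 + (1 - ?c * real ?K)"
        proof (rule rho_average_diff[OF x])
          fix k assume "k < ?K"
          then have "real k < 2 ^ n * s" using K(1) by linarith
          then have "real k / 2 ^ n < s" by (simp add: field_simps)
          then show "rho (T (real k / 2 ^ n) x - x) \<le> e / 2"
            using \<delta>(2)[of "real k / 2 ^ n"] s by simp
        qed (use s K e in \<open>auto simp: field_simps\<close>)
        moreover have "1 - ?c * real ?K \<le> (1 / s) * (1 / 2) ^ n"
        proof -
          have "1 = ?c * (2 ^ n * s)" using s by simp
          also have "\<dots> \<le> ?c * (real ?K + 1)" using K s by (intro mult_left_mono) auto
          finally show ?thesis by (simp add: distrib_left power_divide)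
        qed
        ultimately show ?thesis by simp
      qed
      have "conv (\<lambda>n. rs (1 / s) (rsum n (steps n s) x)) (rs (1 / s) (integ s x)) sequentially"
        using s by (intro conv_sm integ_conv) auto
      then have "(\<lambda>n. rho (rs (1 / s) (rsum n (steps n s) x) - rs (1 / s) (integ s x)) + (e / 2 + (1 / s) * (1 / 2) ^ n))
          \<longlonglongrightarrow> 0 + (e / 2 + (1 / s) * 0)"
        unfolding conv_iff by (intro tendsto_intros LIMSEQ_realpow_zero) auto
      moreover have "rho (rs (1 / s) (integ s x) - x) \<le> rho (rs (1 / s) (rsum n (steps n s) x) - rs (1 / s) (integ s x)) + (e / 2 + (1 / s) * (1 / 2) ^ n)" for n
        using rho_triangle[of "rs (1 / s) (integ s x)" x "rs (1 / s) (rsum n (steps n s) x)"] le[of n]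
          rho_minus_commute[of "rs (1 / s) (integ s x)" "rs (1 / s) (rsum n (steps n s) x)"] by linarith
      ultimately have "rho (rs (1 / s) (integ s x) - x) \<le> 0 + (e / 2 + (1 / s) * 0)"
        by (intro LIMSEQ_le_const) auto
      then show ?thesis using e by simp
    qed
    then show "\<forall>\<^sub>F s in at_right 0. rho (rs (1 / s) (integ s x) - x) < e"
      using \<delta>(1) by (auto simp: eventually_at_right_field)
  qed
  obtain \<zeta> x' where \<zeta>: "\<zeta> \<in> borel_measurable M" and x: "x = sm \<zeta> x'" "AE \<omega> in M. nrm x' \<omega> \<le> 1 / 2"
    by (rule normalize)
  have 1: "conv (\<lambda>s. sm \<zeta> (rs (1 / s) (integ s x'))) (sm \<zeta> x') (at_right 0)"
    by (rule conv_sm[OF \<zeta> small[OF x(2)]])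
  have 2: "\<forall>\<^sub>F s in at_right 0. rs (1 / s) (integ s x) = sm \<zeta> (rs (1 / s) (integ s x'))"
    unfolding x(1) eventually_at_right_field
    by (intro exI[of _ 1]) (auto simp: hom_sm[OF hom_integ \<zeta>] sm_commute[OF \<zeta>])
  show ?thesis using conv_cong[OF 2 1] by (simp only: x(1)[symmetric])
qed

end

section \<open>Generators\<close>

context contr_semigroup
begin

text \<open>The graph of the generator is kept as a relation, so that it can be studied before an
  operator \<open>A\<close> and a domain \<open>D\<close> are given.\<close>

definition gen_lim :: "'s \<Rightarrow> 's \<Rightarrow> bool" where
  "gen_lim x y \<longleftrightarrow> conv (\<lambda>t. rs (1 / t) (T t x - x)) y (at_right 0)"

lemma gen_lim_unique: "gen_lim x y \<Longrightarrow> gen_lim x y' \<Longrightarrow> y = y'"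
  unfolding gen_lim_def by (rule conv_unique[rotated]) auto

lemma gen_lim_sm:
  assumes "\<zeta> \<in> borel_measurable M" "gen_lim x y"
  shows "gen_lim (sm \<zeta> x) (sm \<zeta> y)"
  unfolding gen_lim_def
proof (rule conv_cong)
  show "conv (\<lambda>t. sm \<zeta> (rs (1 / t) (T t x - x))) (sm \<zeta> y) (at_right 0)"
    using assms by (intro conv_sm) (auto simp: gen_lim_def)
  show "\<forall>\<^sub>F t in at_right 0. rs (1 / t) (T t (sm \<zeta> x) - sm \<zeta> x) = sm \<zeta> (rs (1 / t) (T t x - x))"
    unfolding eventually_at_right_field
    by (intro exI[of _ 1]) (auto simp: hom_sm[OF hom_T] assms sm_diff_right[symmetric] sm_commute)
qed

text \<open>Splitting the integral up to \<open>s + t\<close> in both orders exchanges the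
  increments: \<open>T s - I\<close> on the integral up to \<open>t\<close> equals
  \<open>T t - I\<close> on the integral up to \<open>s\<close>. Divided by \<open>s\<close>, the
  latter converges by \<open>integ_mean\<close>.\<close>

lemma gen_lim_integ:
  assumes t: "0 \<le> t"
  shows "gen_lim (integ t x) (T t x - x)"
  unfolding gen_lim_def
proof (rule conv_cong)
  show "conv (\<lambda>s. T t (rs (1 / s) (integ s x)) - rs (1 / s) (integ s x)) (T t x - x) (at_right 0)"
    by (intro conv_diff contr_conv[OF contr_T[OF t]] integ_mean)
  show "\<forall>\<^sub>F s in at_right 0. rs (1 / s) (T s (integ t x) - integ t x) = T t (rs (1 / s) (integ s x)) - rs (1 / s) (integ s x)"
    unfolding eventually_at_right_field
  proof (intro exI[of _ 1] conjI allI impI)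
    fix s :: real assume "0 < s"
    then have "integ s x + T s (integ t x) = integ t x + T t (integ s x)"
      using integ_add[of s t x] integ_add[of t s x] t by (simp add: add.commute)
    then have "T s (integ t x) - integ t x = T t (integ s x) - integ s x" by (simp add: algebra_simps)
    then show "rs (1 / s) (T s (integ t x) - integ t x) = T t (rs (1 / s) (integ s x)) - rs (1 / s) (integ s x)"
      by (simp add: sm_diff_right hom_sm[OF hom_T[OF t]])
  qed simp
qed

text \<open>The generator at \<open>integ t x\<close> is computed twice, once as
  \<open>T t x - x\<close> and once by moving the difference quotient inside the integral.\<close>

lemma gen_lim_orbit:
  assumes t: "0 \<le> t" and xy: "gen_lim x y"
  shows "T t x - x = integ t y"
proof (rule gen_lim_unique[OF gen_lim_integ[OF t]])
  show "gen_lim (integ t x) (integ t y)"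
    unfolding gen_lim_def
  proof (rule conv_cong)
    show "conv (\<lambda>s. integ t (rs (1 / s) (T s x - x))) (integ t y) (at_right 0)"
      using xy unfolding gen_lim_def by (rule integ_bounded_conv[OF t])
    show "\<forall>\<^sub>F s in at_right 0. rs (1 / s) (T s (integ t x) - integ t x) = integ t (rs (1 / s) (T s x - x))"
      unfolding eventually_at_right_field
      by (intro exI[of _ 1]) (auto simp: hom_sm[OF hom_integ] hom_diff[OF hom_integ] T_integ t)
  qed
qed

text \<open>The limit is taken in the integrated equation \<open>T t x - x = integ t y\<close>,
  whose two sides depend continuously on the vectors; \<open>integ_mean\<close> then differentiates
  it at 0.\<close>

lemma gen_lim_closed:
  assumes fg: "\<And>n. gen_lim (f n) (g n)" and f: "conv f x sequentially" and g: "conv g y sequentially"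
  shows "gen_lim x y"
proof -
  have eq: "T t x - x = integ t y" if t: "0 \<le> t" for t
  proof (rule conv_unique)
    show "conv (\<lambda>n. T t (f n) - f n) (T t x - x) sequentially"
      by (intro conv_diff contr_conv[OF contr_T[OF t]] f)
    show "conv (\<lambda>n. T t (f n) - f n) (integ t y) sequentially"
      unfolding gen_lim_orbit[OF t fg] by (rule integ_bounded_conv[OF t g])
  qed simp
  show ?thesis
    unfolding gen_lim_def
    by (rule conv_cong[OF _ integ_mean]) (auto simp: eventually_at_right_field eq intro!: exI[of _ 1])
qed

lemma gen_lim_dense: "\<exists>f. (\<forall>n. \<exists>y. gen_lim (f n) y) \<and> conv f x sequentially"
proof (intro exI conjI allI)
  let ?s = "\<lambda>n. 1 / real (Suc n)"
  have "filterlim ?s (at_right 0) sequentially"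
    unfolding filterlim_at
    using LIMSEQ_inverse_real_of_nat by (auto simp: inverse_eq_divide intro!: always_eventually)
  then show "conv (\<lambda>n. rs (1 / ?s n) (integ (?s n) x)) x sequentially"
    by (rule conv_compose[OF integ_mean])
  show "gen_lim (rs (1 / ?s n) (integ (?s n) x)) (rs (1 / ?s n) (T (?s n) x - x))" for n
    by (intro gen_lim_sm gen_lim_integ) auto
qed

text \<open>Since \<open>cmod (\<xi> + 1 / s) - 1 / s \<ge> Re \<xi>\<close>, the difference quotients of a contraction semigroup
  are dissipative, and this passes to the limit.\<close>
lemma gen_lim_dissipative:
  assumes [measurable]: "\<xi> \<in> borel_measurable M" and xy: "gen_lim x y"
  shows "AE \<omega> in M. Re (\<xi> \<omega>) * nrm x \<omega> \<le> nrm (sm \<xi> x - y) \<omega>"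
proof (rule nrm_limit_ge)
  show "conv (\<lambda>s. sm \<xi> x - rs (1 / s) (T s x - x)) (sm \<xi> x - y) (at_right 0)"
    using xy unfolding gen_lim_def by (intro conv_diff conv_const)
  show "\<forall>\<^sub>F s in at_right 0. AE \<omega> in M. Re (\<xi> \<omega>) * nrm x \<omega> \<le> nrm (sm \<xi> x - rs (1 / s) (T s x - x)) \<omega>"
    unfolding eventually_at_right_field
  proof (intro exI[of _ 1] conjI allI impI)
    fix s :: real assume s: "0 < s"
    then have s0: "0 \<le> s" by simp
    let ?\<zeta> = "\<lambda>\<omega>. \<xi> \<omega> + complex_of_real (1 / s)"
    have \<zeta>: "?\<zeta> \<in> borel_measurable M" by measurable
    let ?z = "sm \<xi> x - rs (1 / s) (T s x - x)"
    have eq: "sm ?\<zeta> x = ?z + rs (1 / s) (T s x)"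
      using sm_add_left[of \<xi> "\<lambda>_. complex_of_real (1 / s)" x]
      by (simp add: sm_diff_right del: of_real_divide)
    show "AE \<omega> in M. Re (\<xi> \<omega>) * nrm x \<omega> \<le> nrm ?z \<omega>"
      using nrm_sm[OF \<zeta>, of x] nrm_triangle[of ?z "rs (1 / s) (T s x)"] nrm_rs[of "1 / s" "T s x"]
        contr_nrm[OF contr_T[OF s0], of x] nrm_nonneg[of x]
      unfolding eq
    proof eventually_elim
      case (elim \<omega>)
      have "Re (\<xi> \<omega>) + 1 / s \<le> cmod (?\<zeta> \<omega>)" using complex_Re_le_cmod[of "?\<zeta> \<omega>"] by simp
      then have "(Re (\<xi> \<omega>) + 1 / s) * nrm x \<omega> \<le> cmod (?\<zeta> \<omega>) * nrm x \<omega>"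
        using elim by (intro mult_right_mono)
      moreover have "\<bar>1 / s\<bar> * nrm (T s x) \<omega> \<le> 1 / s * nrm x \<omega>"
        using elim s by (simp add: divide_right_mono)
      ultimately show ?case using elim by (simp add: distrib_right)
    qed
  qed simp
qed auto

text \<open>For \<open>0 \<le> t\<close> the random exponential has modulus at most 1 almost surely,
  so the whole integral theory becomes available for the rescaled semigroup.\<close>

lemma contr_semigroup_rescaled:
  assumes [measurable]: "\<xi> \<in> borel_measurable M" and \<xi>: "AE \<omega> in M. 0 \<le> Re (\<xi> \<omega>)"
  shows "contr_semigroup M sm nrm (\<lambda>t x. sm (\<lambda>\<omega>. exp (- (of_real t * \<xi> \<omega>))) (T t x))"
proof unfold_locales
  let ?e = "\<lambda>t \<omega>. exp (- (complex_of_real t * \<xi> \<omega>))"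
  have e [measurable]: "?e t \<in> borel_measurable M" for t by measurable
  have e_le: "AE \<omega> in M. cmod (?e t \<omega>) \<le> 1" if "0 \<le> t" for t
    using \<xi> by eventually_elim (use that in simp)
  show "contr (\<lambda>x. sm (?e t) (T t x))" if t: "0 \<le> t" for t
    unfolding contr_def
  proof (intro conjI allI)
    show "hom (\<lambda>x. sm (?e t) (T t x))"
      unfolding hom_def by (auto simp: hom_add[OF hom_T] hom_sm[OF hom_T] t sm_add_right sm_commute)
    show "AE \<omega> in M. nrm (sm (?e t) (T t x)) \<omega> \<le> nrm x \<omega>" for x
      using nrm_sm[OF e, of t "T t x"] e_le[OF t] contr_nrm[OF contr_T[OF t], of x] nrm_nonneg[of "T t x"]
    proof eventually_elim
      case (elim \<omega>)
      then have "cmod (?e t \<omega>) * nrm (T t x) \<omega> \<le> 1 * nrm (T t x) \<omega>" by (intro mult_right_mono)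
      then show ?case using elim by linarith
    qed
  qed
  show "sm (?e 0) (T 0 x) = x" for x by (simp add: T_0)
  show "sm (?e s) (T s (sm (?e t) (T t x))) = sm (?e (s + t)) (T (s + t) x)" if "0 \<le> s" "0 \<le> t" for s t x
    using that by (simp add: hom_sm[OF hom_T] T_add sm_sm exp_add[symmetric] ring_distribs)
  show "conv (\<lambda>t. sm (?e t) (T t x)) x (at_right 0)" for x
  proof (rule conv_rho_le)
    have "conv (\<lambda>t. sm (?e t) x) (sm (\<lambda>_. 1) x) (at_right 0)"
    proof (rule conv_sm_left)
      fix \<omega>
      have "((\<lambda>t. ?e t \<omega>) \<longlongrightarrow> exp (- (complex_of_real 0 * \<xi> \<omega>))) (at_right 0)"
        by (intro tendsto_intros)
      then show "((\<lambda>t. ?e t \<omega>) \<longlongrightarrow> 1) (at_right 0)" by simp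
    qed auto
    then show "((\<lambda>t. rho (T t x - x) + rho (sm (?e t) x - x)) \<longlongrightarrow> 0) (at_right 0)"
      using T_cont[of x] unfolding conv_iff using tendsto_add by fastforce
    show "\<forall>\<^sub>F t in at_right 0. rho (sm (?e t) (T t x) - x) \<le> rho (T t x - x) + rho (sm (?e t) x - x)"
      unfolding eventually_at_right_field
    proof (intro exI[of _ 1] conjI allI impI)
      fix t :: real assume "0 < t"
      then have t: "0 \<le> t" by simp
      \<comment> \<open>Semigroup and scalar are perturbed one after the other; the scalar in front
        of the first term has modulus at most 1.\<close>
      have eq: "sm (?e t) (T t x) - x = sm (?e t) (T t x - x) + (sm (?e t) x - x)"
        by (simp add: sm_diff_right)
      have le: "rho (sm (?e t) (T t x - x)) \<le> rho (T t x - x)"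
      proof (rule rho_mono)
        show "AE \<omega> in M. nrm (sm (?e t) (T t x - x)) \<omega> \<le> nrm (T t x - x) \<omega>"
          using nrm_sm[OF e, of t "T t x - x"] e_le[OF t] nrm_nonneg[of "T t x - x"]
          by eventually_elim (metis mult_left_le_one_le norm_ge_zero)
      qed
      have "rho (sm (?e t) (T t x) - x) \<le> rho (sm (?e t) (T t x - x)) + rho (sm (?e t) x - x)"
        unfolding eq by (rule rho_le_add[OF nrm_triangle])
      then show "rho (sm (?e t) (T t x) - x) \<le> rho (T t x - x) + rho (sm (?e t) x - x)"
        using le by linarith
    qed simp
  qed
qed

text \<open>With \<open>S t = exp (- t \<xi>) (T t)\<close>, the Laplace integral of the orbit of \<open>y\<close> is
  \<open>\<integral>\<^sub>0\<^sup>1 S s v ds\<close> where \<open>v = \<Sum>k. S k y\<close> solves \<open>v - S 1 v = y\<close>; only an integral over a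
  bounded interval is needed.\<close>
lemma gen_lim_resolvent_surj:
  assumes [measurable]: "\<xi> \<in> borel_measurable M" and \<xi>: "AE \<omega> in M. 0 < Re (\<xi> \<omega>)"
  shows "\<exists>z. gen_lim z (sm \<xi> z - y)"
proof -
  define e where "e t \<omega> = exp (- (complex_of_real t * \<xi> \<omega>))" for t \<omega>
  define S where "S t x = sm (e t) (T t x)" for t x
  have em [measurable]: "e t \<in> borel_measurable M" for t unfolding e_def by measurable
  interpret S: contr_semigroup M sm nrm S
    unfolding S_def[abs_def] e_def[abs_def]
    by (rule contr_semigroup_rescaled) (use \<xi> in \<open>auto elim: eventually_mono\<close>)
  \<comment> \<open>\<open>r\<close> is the modulus of \<open>exp (- \<xi>)\<close>. It is below 1
    almost surely but possibly not uniformly, so the tails \<open>g\<close> below are geometric with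
    a random ratio.\<close>
  define r where "r \<omega> = exp (- Re (\<xi> \<omega>))" for \<omega>
  have [measurable]: "r \<in> borel_measurable M" unfolding r_def by measurable
  have r01: "AE \<omega> in M. 0 < r \<omega> \<and> r \<omega> < 1" using \<xi> by eventually_elim (simp add: r_def)
  have S_nrm: "AE \<omega> in M. \<forall>k::nat. nrm (S (real k) y) \<omega> \<le> r \<omega> ^ k * nrm y \<omega>"
    unfolding AE_all_countable
  proof
    fix k :: nat
    show "AE \<omega> in M. nrm (S (real k) y) \<omega> \<le> r \<omega> ^ k * nrm y \<omega>"
      using nrm_sm[OF em, of "real k" "T (real k) y"] contr_nrm[OF contr_T[OF of_nat_0_le_iff], of k y]
      unfolding S_def
    proof eventually_elim
      case (elim \<omega>)
      have "cmod (e (real k) \<omega>) = r \<omega> ^ k" by (simp add: e_def r_def exp_of_nat_mult[symmetric])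
      then show ?case using elim mult_left_mono[of "nrm (T (real k) y) \<omega>" "nrm y \<omega>" "r \<omega> ^ k"]
        by (simp add: r_def)
    qed
  qed
  define v where "v n = (\<Sum>k<n. S (real k) y)" for n :: nat
  define g where "g n \<omega> = r \<omega> ^ n * (nrm y \<omega> / (1 - r \<omega>))" for n \<omega>
  have gm [measurable]: "g n \<in> borel_measurable M" for n unfolding g_def by measurable
  have "\<exists>v\<^sub>0. conv v v\<^sub>0 sequentially"
  proof (rule Cauchy_conv_nrm[OF gm])
    fix n m :: nat assume nm: "n \<le> m"
    have eq: "v m - v n = (\<Sum>k\<in>{n..<m}. S (real k) y)"
      unfolding v_def lessThan_atLeast0 using sum_diff_nat_ivl[of 0 n m "\<lambda>k. S (real k) y"] nm by simp
    show "AE \<omega> in M. nrm (v m - v n) \<omega> \<le> g n \<omega>"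
      using S_nrm r01 nrm_nonneg[of y] nrm_sum[of "{n..<m}" "\<lambda>k. S (real k) y", OF finite_atLeastLessThan]
      unfolding eq
    proof eventually_elim
      case (elim \<omega>)
      have r1: "r \<omega> \<noteq> 1" using elim by auto
      have "(\<Sum>k\<in>{n..<m}. nrm (S (real k) y) \<omega>) \<le> (\<Sum>k\<in>{n..<m}. r \<omega> ^ k * nrm y \<omega>)"
        using elim by (intro sum_mono) auto
      also have "\<dots> = (r \<omega> ^ n - r \<omega> ^ m) / (1 - r \<omega>) * nrm y \<omega>"
        using sum_gp[of "r \<omega>" n "m - 1"] nm elim(2)
        by (cases "n = m") (auto simp: sum_distrib_right[symmetric] atLeastLessThanSuc_atLeastAtMost[symmetric])
      also have "\<dots> \<le> g n \<omega>"
        using elim by (simp add: g_def divide_right_mono mult_right_mono mult_left_mono divide_le_cancel)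
      finally show ?case using elim by simp
    qed
  next
    have "(\<lambda>n. pmag (g n)) \<longlonglongrightarrow> pmag (\<lambda>_. 0)"
    proof (rule pmag_tendsto_AE)
      show "AE \<omega> in M. (\<lambda>n. g n \<omega>) \<longlonglongrightarrow> 0"
        using r01
      proof eventually_elim
        case (elim \<omega>)
        then have "(\<lambda>n. r \<omega> ^ n) \<longlonglongrightarrow> 0" by (intro LIMSEQ_realpow_zero) auto
        then show ?case unfolding g_def by (rule tendsto_mult_left_zero)
      qed
    qed auto
    then show "(\<lambda>n. pmag (g n)) \<longlonglongrightarrow> 0" by simp
  qed
  then obtain v\<^sub>0 where v0: "conv v v\<^sub>0 sequentially" by blast
  \<comment> \<open>Applying \<open>S 1\<close> shifts the series by one index and removes its first
    term \<open>y\<close>.\<close>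
  have "S 1 v\<^sub>0 = v\<^sub>0 - y"
  proof (rule conv_unique[of sequentially "\<lambda>n. S 1 (v n)"])
    show "conv (\<lambda>n. S 1 (v n)) (S 1 v\<^sub>0) sequentially"
      by (rule contr_conv[OF S.contr_T v0]) simp
    have "S 1 (v n) = v (Suc n) - y" for n
    proof -
      have "S 1 (v n) = (\<Sum>k<n. S (real (Suc k)) y)"
        unfolding v_def by (simp add: hom_sum[OF S.hom_T] S.T_add)
      then show ?thesis unfolding v_def sum.lessThan_Suc_shift by (simp add: S.T_0)
    qed
    then show "conv (\<lambda>n. S 1 (v n)) (v\<^sub>0 - y) sequentially"
      using conv_diff[OF conv_compose[OF v0 filterlim_Suc] conv_const[of y]] by simp
  qed simp
  then have z: "S.gen_lim (S.integ 1 v\<^sub>0) (- y)"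
    using S.gen_lim_integ[of 1 v\<^sub>0] by simp
  define z where "z = S.integ 1 v\<^sub>0"
  define u where "u t = rs (1 / t) (S t z - z)" for t
  have u: "conv u (- y) (at_right 0)" using z unfolding S.gen_lim_def u_def[abs_def] z_def .
  \<comment> \<open>Undoing the rescaling multiplies by \<open>e (- t)\<close>, the exponential of
    \<open>t * \<xi>\<close>. It tends to 1 pointwise but may be unbounded in \<omega>; for
    \<open>t < 1\<close> the fixed random variable \<open>exp (cmod \<xi>)\<close> dominates
    it.\<close>
  have u': "conv (\<lambda>t. sm (e (- t)) (u t)) (- y) (at_right 0)"
  proof -
    have 1: "conv (\<lambda>t. sm (e (- t)) (- y)) (sm (\<lambda>_. 1) (- y)) (at_right 0)"
    proof (rule conv_sm_left)
      fix \<omega>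
      have "((\<lambda>t. e (- t) \<omega>) \<longlongrightarrow> exp (- (complex_of_real (- 0) * \<xi> \<omega>))) (at_right 0)"
        unfolding e_def by (intro tendsto_intros)
      then show "((\<lambda>t. e (- t) \<omega>) \<longlongrightarrow> 1) (at_right 0)" by simp
    qed auto
    have 2: "conv (\<lambda>t. sm (e (- t)) (u t - (- y))) 0 (at_right 0)"
    proof (rule conv_nrm_le)
      show "((\<lambda>t. pmag (\<lambda>\<omega>. exp (cmod (\<xi> \<omega>)) * nrm (u t - (- y)) \<omega>)) \<longlongrightarrow> 0) (at_right 0)"
        by (rule pmag_mult_tendsto) (use u in \<open>auto simp: conv_iff rho_def\<close>)
      show "\<forall>\<^sub>F t in at_right 0. AE \<omega> in M. nrm (sm (e (- t)) (u t - (- y)) - 0) \<omega> \<le> exp (cmod (\<xi> \<omega>)) * nrm (u t - (- y)) \<omega>"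
        unfolding eventually_at_right_field
      proof (intro exI[of _ 1] conjI allI impI)
        fix t :: real assume t: "0 < t" "t < 1"
        show "AE \<omega> in M. nrm (sm (e (- t)) (u t - (- y)) - 0) \<omega> \<le> exp (cmod (\<xi> \<omega>)) * nrm (u t - (- y)) \<omega>"
          using nrm_sm[OF em, of "- t" "u t - (- y)"] nrm_nonneg[of "u t - (- y)"]
        proof eventually_elim
          case (elim \<omega>)
          have "t * Re (\<xi> \<omega>) \<le> 1 * cmod (\<xi> \<omega>)"
            using t complex_Re_le_cmod[of "\<xi> \<omega>"] abs_Re_le_cmod[of "\<xi> \<omega>"]
            by (intro order_trans[OF mult_left_mono mult_right_mono]) auto
          then have "cmod (e (- t) \<omega>) \<le> exp (cmod (\<xi> \<omega>))" by (simp add: e_def)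
          then show ?case using elim by (simp add: mult_right_mono)
        qed
      qed simp
    qed auto
    have "conv (\<lambda>t. sm (e (- t)) (u t - (- y)) + sm (e (- t)) (- y)) (0 + sm (\<lambda>_. 1) (- y)) (at_right 0)"
      by (rule conv_add[OF 2 1])
    then show ?thesis by (simp add: sm_add_right[symmetric])
  qed
  have lim: "conv (\<lambda>t. sm (\<lambda>\<omega>. (e (- t) \<omega> - 1) / complex_of_real t) z) (sm \<xi> z) (at_right 0)"
  proof (rule conv_sm_left)
    fix \<omega>
    have "((\<lambda>h. exp (h * \<xi> \<omega>)) has_field_derivative \<xi> \<omega>) (at 0)"
      by (auto intro!: derivative_eq_intros)
    then have "((\<lambda>h. (exp (h * \<xi> \<omega>) - 1) / h) \<longlongrightarrow> \<xi> \<omega>) (at 0)"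
      by (simp add: has_field_derivative_iff)
    moreover have "filterlim complex_of_real (at 0) (at_right 0)"
      unfolding filterlim_at
    proof
      show "\<forall>\<^sub>F t in at_right 0. complex_of_real t \<in> UNIV \<and> complex_of_real t \<noteq> 0"
        by (auto simp: eventually_at_right_field intro!: exI[of _ 1])
      have "((\<lambda>t. complex_of_real t) \<longlongrightarrow> complex_of_real 0) (at_right 0)" by (intro tendsto_intros)
      then show "(complex_of_real \<longlongrightarrow> 0) (at_right 0)" by simp
    qed
    ultimately show "((\<lambda>t. (e (- t) \<omega> - 1) / complex_of_real t) \<longlongrightarrow> \<xi> \<omega>) (at_right 0)"
      unfolding e_def using filterlim_compose by fastforce
  qed auto
  \<comment> \<open>Product rule for \<open>T t z = sm (e (- t)) (S t z)\<close>: the scalar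
    contributes \<open>sm \<xi> z\<close>, the rescaled orbit contributes
    \<open>- y\<close>.\<close>
  have "gen_lim z (sm \<xi> z - y)"
    unfolding gen_lim_def
  proof (rule conv_cong)
    show "conv (\<lambda>t. sm (\<lambda>\<omega>. (e (- t) \<omega> - 1) / complex_of_real t) z + sm (e (- t)) (u t)) (sm \<xi> z - y) (at_right 0)"
      using conv_add[OF lim u'] by simp
    show "\<forall>\<^sub>F t in at_right 0. rs (1 / t) (T t z - z) = sm (\<lambda>\<omega>. (e (- t) \<omega> - 1) / complex_of_real t) z + sm (e (- t)) (u t)"
      unfolding eventually_at_right_field
    proof (intro exI[of _ 1] conjI allI impI)
      fix t :: real assume t: "0 < t"
      have "sm (e (- t)) (S t z) = T t z"
        by (simp add: S_def sm_sm e_def exp_add[symmetric])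
      then have 1: "sm (e (- t)) (u t) = rs (1 / t) (T t z) - rs (1 / t) (sm (e (- t)) z)"
        unfolding u_def by (subst sm_commute) (auto simp: sm_diff_right)
      have "sm (\<lambda>\<omega>. (e (- t) \<omega> - 1) / complex_of_real t) z = rs (1 / t) (sm (\<lambda>\<omega>. e (- t) \<omega> - 1) z)"
        by (simp add: sm_sm)
      also have "\<dots> = rs (1 / t) (sm (e (- t)) z) - rs (1 / t) z"
        by (simp add: sm_diff_left sm_diff_right)
      finally show "rs (1 / t) (T t z - z) = sm (\<lambda>\<omega>. (e (- t) \<omega> - 1) / complex_of_real t) z + sm (e (- t)) (u t)"
        unfolding 1 by (simp add: sm_diff_right)
    qed simp
  qed
  then show ?thesis ..
qed

end

section \<open>Semigroups from resolvents\<close>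

context RN_space
begin

text \<open>Equicontinuity reduces strong convergence to a dense set. Contractivity is asked for
  eventually only, because \<open>T t\<close> is controlled for \<open>0 \<le> t\<close>.\<close>

lemma contr_conv_dense:
  assumes V: "\<forall>\<^sub>F t in F. contr (V t)"
    and dense: "\<And>x. \<exists>f. (\<forall>n. f n \<in> G) \<and> conv f x sequentially"
    and G: "\<And>z. z \<in> G \<Longrightarrow> conv (\<lambda>t. V t z) z F"
  shows "conv (\<lambda>t. V t x) x F"
proof (rule conv_epsI)
  fix e :: real assume e: "0 < e"
  obtain f where f: "\<And>n. f n \<in> G" "conv f x sequentially" using dense by metis
  then obtain k where k: "rho (f k - x) < e / 3"
    using conv_epsD[of f x sequentially "e / 3"] e by (auto simp: eventually_sequentially)
  have "\<forall>\<^sub>F t in F. rho (V t (f k) - f k) < e / 3"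
    by (rule conv_epsD[OF G[OF f(1)]]) (use e in auto)
  with V show "\<forall>\<^sub>F t in F. rho (V t x - x) < e"
  proof eventually_elim
    case (elim t)
    have "rho (V t x - V t (f k)) < e / 3"
      using contr_rho_diff[OF elim(1), of x "f k"] k rho_minus_commute[of x "f k"] by simp
    then show ?case
      using rho_triangle[of "V t x" x "V t (f k)"] rho_triangle[of "V t (f k)" x "f k"] elim(2) k by linarith
  qed
qed

lemma rs_half: "rs (h / 2) x + rs (h / 2) x = rs h x"
  unfolding rs_add_left[symmetric] by simp

end

text \<open>With \<open>h = 2^-n\<close>, \<open>J n\<close> is one implicit Euler step, the inverse
  of \<open>I - h A\<close>; \<open>J_right\<close> and \<open>J_left\<close> are the two inverse
  relations.\<close>

locale resolvent_family = complete_RN_space M sm nrm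
  for M :: "'w measure" and sm :: "('w \<Rightarrow> complex) \<Rightarrow> 's::ab_group_add \<Rightarrow> 's" and nrm +
  fixes A :: "'s \<Rightarrow> 's" and D :: "'s set" and J :: "nat \<Rightarrow> 's \<Rightarrow> 's"
  assumes dense: "\<exists>f. (\<forall>n. f n \<in> D) \<and> conv f x sequentially"
    and contr_J: "contr (J n)"
    and J_in_D: "J n x \<in> D"
    and J_right: "J n x - x = rs (1 / 2 ^ n) (A (J n x))"
    and J_left: "x \<in> D \<Longrightarrow> J n x - x = rs (1 / 2 ^ n) (J n (A x))"
begin

lemma A_J:
  assumes "x \<in> D"
  shows "A (J n x) = J n (A x)"
proof -
  have "rs (2 ^ n) (rs (1 / 2 ^ n) (A (J n x))) = rs (2 ^ n) (rs (1 / 2 ^ n) (J n (A x)))"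
    using J_right[of n x] J_left[OF assms, of n] by simp
  then show ?thesis unfolding rs_rs by simp
qed

lemma nrm_J_diff:
  assumes "x \<in> D"
  shows "AE \<omega> in M. nrm (J n x - x) \<omega> \<le> 1 / 2 ^ n * nrm (A x) \<omega>"
  using nrm_rs[of "1 / 2 ^ n" "J n (A x)"] contr_nrm[OF contr_J, of n "A x"]
  unfolding J_left[OF assms, symmetric] by eventually_elim (simp add: divide_right_mono)

lemma nrm_J_pow_diff:
  assumes x: "x \<in> D"
  shows "AE \<omega> in M. nrm ((J n ^^ k) x - x) \<omega> \<le> real k / 2 ^ n * nrm (A x) \<omega>"
proof (induction k)
  case 0
  show ?case using nrm_zero by eventually_elim simp
next
  case (Suc k)
  have eq: "(J n ^^ Suc k) x - x = J n ((J n ^^ k) x - x) + (J n x - x)"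
    by (simp add: hom_diff[OF contr_hom[OF contr_J]])
  show ?case
    using Suc nrm_J_diff[OF x, of n] nrm_triangle[of "J n ((J n ^^ k) x - x)" "J n x - x"]
      contr_nrm[OF contr_J, of n "(J n ^^ k) x - x"]
    unfolding eq by eventually_elim (simp add: add_divide_distrib distrib_right)
qed

lemma J_conv: "conv (\<lambda>n. J n x) x sequentially"
proof (rule contr_conv_dense[OF _ dense])
  fix z assume z: "z \<in> D"
  have "conv (\<lambda>n. rs ((1 / 2) ^ n) (A z)) (rs 0 (A z)) sequentially"
    by (rule conv_rs_left, rule LIMSEQ_realpow_zero) auto
  then have "conv (\<lambda>n. rs ((1 / 2) ^ n) (A z)) 0 sequentially" by simp
  then show "conv (\<lambda>n. J n z) z sequentially"
  proof (rule conv_rho_mono[rotated])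
    fix n
    show "AE \<omega> in M. nrm (J n z - z) \<omega> \<le> nrm (rs ((1 / 2) ^ n) (A z) - 0) \<omega>"
      using nrm_J_diff[OF z, of n] nrm_rs[of "(1 / 2) ^ n" "A z"]
      by eventually_elim (simp add: power_divide)
  qed
qed (simp add: contr_J)

section \<open>The error of the Euler scheme under halving of the step\<close>

definition D2 :: "'s set" where
  "D2 = {x \<in> D. A x \<in> D}"

text \<open>\<open>J n\<close> maps into \<open>D\<close> and commutes with \<open>A\<close> there,
  so two applications land in the domain of the square.\<close>

lemma D2_dense: "\<exists>f. (\<forall>n. f n \<in> D2) \<and> conv f x sequentially"
proof (intro exI conjI allI)
  show "J n (J n x) \<in> D2" for n by (simp add: D2_def J_in_D A_J)
  have "conv (\<lambda>n. J n (J n x) - J n x) 0 sequentially"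
  proof (rule conv_rho_mono[OF _ J_conv[of x]])
    show "AE \<omega> in M. nrm (J n (J n x) - J n x - 0) \<omega> \<le> nrm (J n x - x) \<omega>" for n
      using contr_nrm_diff[OF contr_J, of n "J n x" x] by simp
  qed
  from conv_add[OF this J_conv[of x]] show "conv (\<lambda>n. J n (J n x)) x sequentially" by simp
qed

lemma J_D2: "x \<in> D2 \<Longrightarrow> J n x \<in> D2"
  by (simp add: D2_def J_in_D A_J)

lemma A_A_J: "x \<in> D2 \<Longrightarrow> A (A (J n x)) = J n (A (A x))"
  by (simp add: D2_def A_J)

text \<open>With \<open>h = 2^-n\<close> and \<open>y = A x\<close>, two half steps and one full
  step share the first-order term \<open>h y\<close>. What remains compares \<open>y\<close> with
  its images under the steps. In units of \<open>h^2 * nrm (A y)\<close> the three contributions are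
  1/2, 1/4 and 1, and their sum 7/4 is rounded up to 2.\<close>

lemma nrm_J_refine:
  assumes "x \<in> D2"
  shows "AE \<omega> in M. nrm (J (Suc n) (J (Suc n) x) - J n x) \<omega> \<le> 2 * (1 / 2 ^ n)\<^sup>2 * nrm (A (A x)) \<omega>"
proof -
  let ?K = "J (Suc n)" and ?h = "1 / 2 ^ n :: real"
  define y where "y = A x"
  have x: "x \<in> D" and y: "y \<in> D" using assms by (auto simp: D2_def y_def)
  have h2: "1 / 2 ^ Suc n = ?h / 2" by simp
  have hK: "hom ?K" by (rule contr_hom[OF contr_J])
  have K: "?K x - x = rs (?h / 2) (?K y)" using J_left[OF x, of "Suc n"] unfolding h2 y_def .
  have KK: "?K (?K x) - ?K x = rs (?h / 2) (?K (?K y))"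
    unfolding hom_diff[OF hK, symmetric] K by (rule hom_sm[OF hK]) simp
  have Jx: "J n x - x = rs ?h (J n y)" using J_left[OF x, of n] unfolding y_def .
  have "?K (?K x) - J n x = (?K (?K x) - ?K x) + (?K x - x) - (J n x - x)" by simp
  also have "\<dots> = (rs (?h / 2) (?K (?K y) - y) + rs (?h / 2) (?K y - y)) - rs ?h (J n y - y)"
    unfolding KK K Jx sm_diff_right[OF borel_measurable_const] using rs_half[of ?h y]
    by (simp add: algebra_simps del: of_real_divide)
  finally have eq: "?K (?K x) - J n x = (rs (?h / 2) (?K (?K y) - y) + rs (?h / 2) (?K y - y)) - rs ?h (J n y - y)" .
  have KKy: "?K (?K y) - y = (J (Suc n) ^^ 2) y - y" by (simp add: numeral_2_eq_2)
  show ?thesis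
    using nrm_diff_triangle[of "rs (?h / 2) (?K (?K y) - y) + rs (?h / 2) (?K y - y)" "rs ?h (J n y - y)"]
      nrm_triangle[of "rs (?h / 2) (?K (?K y) - y)" "rs (?h / 2) (?K y - y)"]
      nrm_rs[of "?h / 2" "?K (?K y) - y"] nrm_rs[of "?h / 2" "?K y - y"] nrm_rs[of ?h "J n y - y"]
      nrm_J_pow_diff[OF y, of 2 "Suc n"] nrm_J_diff[OF y, of "Suc n"] nrm_J_diff[OF y, of n] nrm_nonneg[of "A y"]
    unfolding eq[symmetric] KKy[symmetric] y_def[symmetric]
  proof eventually_elim
    case (elim \<omega>)
    define a where "a = nrm (A y) \<omega>"
    define h :: real where "h = 1 / 2 ^ n"
    have h0: "0 < h" by (simp add: h_def)
    have b1: "h / 2 * nrm (?K (?K y) - y) \<omega> \<le> h / 2 * (h * a)"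
      using elim(6) h0 by (intro mult_left_mono) (auto simp: h_def a_def)
    have b2: "h / 2 * nrm (?K y - y) \<omega> \<le> h / 2 * (h / 2 * a)"
      using elim(7) h0 by (intro mult_left_mono) (auto simp: h_def a_def)
    have b3: "h * nrm (J n y - y) \<omega> \<le> h * (h * a)"
      using elim(8) h0 by (intro mult_left_mono) (auto simp: h_def a_def)
    have "0 \<le> h * h * a" using elim(9) h0 by (simp add: a_def)
    have abs_h: "\<bar>h / 2\<bar> = h / 2" "\<bar>h\<bar> = h" using h0 by auto
    have "nrm (?K (?K x) - J n x) \<omega> \<le> h / 2 * (h * a) + h / 2 * (h / 2 * a) + h * (h * a)"
      using elim(1-5) b1 b2 b3 unfolding h_def[symmetric] abs_h by linarith
    also have "\<dots> = 7 / 4 * (h * h * a)" by simp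
    also have "\<dots> \<le> 2 * (h * h * a)" by (rule mult_right_mono[OF _ \<open>0 \<le> h * h * a\<close>]) simp
    also have "\<dots> = 2 * h\<^sup>2 * a" by (simp add: power2_eq_square)
    finally show ?case by (simp only: h_def a_def)
  qed
qed

text \<open>Local errors add up without amplification, since all later steps are contractions. The
  induction varies \<open>x\<close> because the remaining steps start from \<open>J n x\<close>;
  commutation with \<open>A\<close> keeps the second-order quantity of that point below the one of
  \<open>x\<close>.\<close>

lemma nrm_J_pow_refine:
  "x \<in> D2 \<Longrightarrow> AE \<omega> in M. nrm ((J (Suc n) ^^ (2 * N)) x - (J n ^^ N) x) \<omega> \<le> real N * (2 * (1 / 2 ^ n)\<^sup>2 * nrm (A (A x)) \<omega>)"
proof (induction N arbitrary: x)
  case 0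
  show ?case using nrm_zero by eventually_elim simp
next
  case (Suc N)
  let ?K = "J (Suc n)"
  have K: "contr (?K ^^ (2 * N))" by (intro contr_funpow contr_J)
  have "(?K ^^ (2 * Suc N)) x = (?K ^^ (2 * N)) (?K (?K x))"
    using funpow_add[of "2 * N" 2 ?K] by (simp add: numeral_2_eq_2)
  moreover have "(J n ^^ Suc N) x = (J n ^^ N) (J n x)" by (simp add: funpow_swap1)
  ultimately have eq: "(?K ^^ (2 * Suc N)) x - (J n ^^ Suc N) x
      = (?K ^^ (2 * N)) (?K (?K x) - J n x) + ((?K ^^ (2 * N)) (J n x) - (J n ^^ N) (J n x))"
    by (simp add: hom_diff[OF contr_hom[OF K]])
  show ?case
    using nrm_triangle[of "(?K ^^ (2 * N)) (?K (?K x) - J n x)" "(?K ^^ (2 * N)) (J n x) - (J n ^^ N) (J n x)"]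
      contr_nrm[OF K, of "?K (?K x) - J n x"] nrm_J_refine[OF Suc.prems, of n]
      Suc.IH[OF J_D2[OF Suc.prems, of n]] contr_nrm[OF contr_J, of n "A (A x)"]
    unfolding eq A_A_J[OF Suc.prems]
  proof eventually_elim
    case (elim \<omega>)
    have "real N * (2 * (1 / 2 ^ n)\<^sup>2 * nrm (J n (A (A x))) \<omega>) \<le> real N * (2 * (1 / 2 ^ n)\<^sup>2 * nrm (A (A x)) \<omega>)"
      using elim(5) by (intro mult_left_mono) auto
    then show ?case using elim(1-4) by (simp only: of_nat_Suc distrib_right mult_1)
  qed
qed

definition U :: "nat \<Rightarrow> real \<Rightarrow> 's \<Rightarrow> 's" where
  "U n t = J n ^^ steps n t"

lemma contr_U: "contr (U n t)"
  unfolding U_def by (intro contr_funpow contr_J)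

text \<open>At most \<open>2^n t\<close> coarse steps contribute order \<open>4^-n\<close> each,
  which gives the term with \<open>A (A x)\<close>; the at most two unmatched half steps give the
  term with \<open>A x\<close>.\<close>

lemma nrm_U_Suc:
  assumes x: "x \<in> D2" and t: "0 \<le> t"
  shows "AE \<omega> in M. nrm (U (Suc n) t x - U n t x) \<omega> \<le> 1 / 2 ^ n * (2 * t * nrm (A (A x)) \<omega> + nrm (A x) \<omega>)"
proof -
  let ?K = "J (Suc n)" and ?N = "steps n t"
  obtain L where L: "L \<le> 2" "steps (Suc n) t = 2 * ?N + L"
    using steps_refine[OF t, of 1 n] by auto
  have xD: "x \<in> D" using x by (simp add: D2_def)
  have K: "contr (?K ^^ (2 * ?N))" by (intro contr_funpow contr_J)
  have eq: "U (Suc n) t x - U n t x = (?K ^^ (2 * ?N)) ((?K ^^ L) x - x) + ((?K ^^ (2 * ?N)) x - (J n ^^ ?N) x)"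
    by (simp add: U_def L(2) funpow_add hom_diff[OF contr_hom[OF K]])
  have N: "real ?N * (1 / 2 ^ n) \<le> t" using steps_le[OF t, of n] by (simp add: field_simps)
  show ?thesis
    using nrm_triangle[of "(?K ^^ (2 * ?N)) ((?K ^^ L) x - x)" "(?K ^^ (2 * ?N)) x - (J n ^^ ?N) x"]
      contr_nrm[OF K, of "(?K ^^ L) x - x"] nrm_J_pow_diff[OF xD, of L "Suc n"] nrm_J_pow_refine[OF x, of ?N n]
      nrm_nonneg[of "A x"] nrm_nonneg[of "A (A x)"]
    unfolding eq
  proof eventually_elim
    case (elim \<omega>)
    have "real L / 2 ^ Suc n * nrm (A x) \<omega> \<le> 1 / 2 ^ n * nrm (A x) \<omega>"
      using L(1) elim by (intro mult_right_mono) (auto simp: field_simps)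
    moreover have "real ?N * (2 * (1 / 2 ^ n)\<^sup>2 * nrm (A (A x)) \<omega>) \<le> 1 / 2 ^ n * (2 * t * nrm (A (A x)) \<omega>)"
    proof -
      have "(real ?N * (1 / 2 ^ n)) * (2 * (1 / 2 ^ n) * nrm (A (A x)) \<omega>) \<le> t * (2 * (1 / 2 ^ n) * nrm (A (A x)) \<omega>)"
        using N elim by (intro mult_right_mono) auto
      then show ?thesis by (simp add: power2_eq_square mult_ac)
    qed
    ultimately show ?case using elim by (simp add: distrib_left)
  qed
qed

lemma U_conv_D2:
  assumes x: "x \<in> D2" and t: "0 \<le> t"
  shows "\<exists>y. conv (\<lambda>n. U n t x) y sequentially"
proof (rule Cauchy_conv_nrm)
  define C where "C \<omega> = 2 * t * nrm (A (A x)) \<omega> + nrm (A x) \<omega>" for \<omega>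
  have [measurable]: "C \<in> borel_measurable M" unfolding C_def by measurable
  have C0: "AE \<omega> in M. 0 \<le> C \<omega>"
    using nrm_nonneg[of "A x"] nrm_nonneg[of "A (A x)"] by eventually_elim (use t in \<open>simp add: C_def\<close>)
  show "(\<lambda>\<omega>. 2 / 2 ^ n * C \<omega>) \<in> borel_measurable M" for n by measurable
  fix n m :: nat assume "n \<le> m"
  \<comment> \<open>The bound is kept in telescoped form, the sum of the \<open>1 / 2 ^ k\<close>
    for \<open>n \<le> k < m\<close>, so that the induction on \<open>m\<close> closes.\<close>
  then have "AE \<omega> in M. nrm (U m t x - U n t x) \<omega> \<le> (2 / 2 ^ n - 2 / 2 ^ m) * C \<omega>"
  proof (induction m rule: dec_induct)
    case base
    show ?case using nrm_zero by eventually_elim simp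
  next
    case (step m)
    show ?case
      using step.IH nrm_U_Suc[OF x t, of m] nrm_diff_trans[of "U (Suc m) t x" "U n t x" "U m t x"]
      unfolding C_def[symmetric]
    proof eventually_elim
      case (elim \<omega>)
      have "(2 / 2 ^ n - 2 / 2 ^ Suc m) * C \<omega> = (2 / 2 ^ n - 2 / 2 ^ m) * C \<omega> + 1 / 2 ^ m * C \<omega>"
        by (simp add: algebra_simps)
      then show ?case using elim by linarith
    qed
  qed
  then show "AE \<omega> in M. nrm (U m t x - U n t x) \<omega> \<le> 2 / 2 ^ n * C \<omega>"
    using C0
  proof eventually_elim
    case (elim \<omega>)
    have "(2 / 2 ^ n - 2 / 2 ^ m) * C \<omega> \<le> 2 / 2 ^ n * C \<omega>" using elim by (intro mult_right_mono) auto
    then show ?case using elim by linarith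
  qed
next
  let ?C = "\<lambda>\<omega>. 2 * t * nrm (A (A x)) \<omega> + nrm (A x) \<omega>"
  have "(\<lambda>n. pmag (\<lambda>\<omega>. 2 / 2 ^ n * ?C \<omega>)) \<longlonglongrightarrow> pmag (\<lambda>_. 0)"
  proof (rule pmag_tendsto_AE)
    have "(\<lambda>n. 2 / 2 ^ n * ?C \<omega>) \<longlonglongrightarrow> 0" for \<omega>
    proof -
      have "(\<lambda>n. 2 * (1 / 2) ^ n * ?C \<omega>) \<longlonglongrightarrow> 2 * 0 * ?C \<omega>"
        by (intro tendsto_intros LIMSEQ_realpow_zero) auto
      then show ?thesis by (simp add: power_divide)
    qed
    then show "AE \<omega> in M. (\<lambda>n. 2 / 2 ^ n * ?C \<omega>) \<longlonglongrightarrow> 0" by simp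
  qed auto
  then show "(\<lambda>n. pmag (\<lambda>\<omega>. 2 / 2 ^ n * ?C \<omega>)) \<longlonglongrightarrow> 0" by simp
qed

section \<open>The limit semigroup\<close>

definition T :: "real \<Rightarrow> 's \<Rightarrow> 's" where
  "T t x = (SOME y. conv (\<lambda>n. U n t x) y sequentially)"

lemma T_conv: "0 \<le> t \<Longrightarrow> conv (\<lambda>n. U n t x) (T t x) sequentially"
  unfolding T_def
  by (rule someI_ex) (rule Cauchy_conv_dense[where V="\<lambda>n. U n t", OF contr_U D2_dense U_conv_D2])

lemma T_eqI: "0 \<le> t \<Longrightarrow> conv (\<lambda>n. U n t x) y sequentially \<Longrightarrow> T t x = y"
  by (rule conv_unique[OF _ T_conv]) auto

lemma contr_T:
  assumes t: "0 \<le> t"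
  shows "contr (T t)"
  unfolding contr_def hom_def
proof (intro conjI allI impI)
  show "T t (x + y) = T t x + T t y" for x y
    by (rule T_eqI[OF t]) (auto simp: hom_add[OF contr_hom[OF contr_U]] intro!: conv_add T_conv t)
  show "T t (sm \<xi> x) = sm \<xi> (T t x)" if "\<xi> \<in> borel_measurable M" for \<xi> x
    by (rule T_eqI[OF t]) (auto simp: hom_sm[OF contr_hom[OF contr_U] that] intro!: conv_sm T_conv t that)
  show "AE \<omega> in M. nrm (T t x) \<omega> \<le> nrm x \<omega>" for x
    by (rule nrm_limit_le[OF _ T_conv[OF t]]) (auto simp: contr_nrm[OF contr_U])
qed

lemma T_0: "T 0 x = x"
  by (rule T_eqI) (auto simp: U_def steps_def)

text \<open>Rounding leaves at most one surplus factor \<open>J n\<close>, and \<open>J n\<close>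
  tends strongly to the identity. The moving argument \<open>U n t x\<close> inside
  \<open>U n s\<close> is harmless because every \<open>U n s\<close> is a contraction.\<close>

lemma T_add:
  assumes s: "0 \<le> s" and t: "0 \<le> t"
  shows "T s (T t x) = T (s + t) x"
proof (rule T_eqI[symmetric])
  have "conv (\<lambda>n. U n s (U n t x) - U n s (T t x)) 0 sequentially"
  proof (rule conv_rho_mono[OF _ T_conv[OF t, of x]])
    show "AE \<omega> in M. nrm (U n s (U n t x) - U n s (T t x) - 0) \<omega> \<le> nrm (U n t x - T t x) \<omega>" for n
      using contr_nrm_diff[OF contr_U] by simp
  qed
  from conv_add[OF this T_conv[OF s, of "T t x"]]
  have 1: "conv (\<lambda>n. U n s (U n t x)) (T s (T t x)) sequentially" by simp
  have 2: "conv (\<lambda>n. U n (s + t) x - U n s (U n t x)) 0 sequentially"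
  proof (rule conv_rho_mono[OF _ J_conv[of x]])
    fix n
    obtain d where d: "d \<le> 1" "steps n (s + t) = steps n s + steps n t + d" by (rule steps_add[OF s t])
    have eq: "U n (s + t) x = (J n ^^ (steps n s + steps n t)) ((J n ^^ d) x)"
      "U n s (U n t x) = (J n ^^ (steps n s + steps n t)) x"
      by (simp_all add: U_def d(2) funpow_add)
    have "AE \<omega> in M. nrm ((J n ^^ d) x - x) \<omega> \<le> nrm (J n x - x) \<omega>"
    proof (cases d)
      case 0
      then show ?thesis using nrm_zero nrm_nonneg[of "J n x - x"] by (auto elim: eventually_elim2)
    qed (use d(1) in auto)
    then show "AE \<omega> in M. nrm (U n (s + t) x - U n s (U n t x) - 0) \<omega> \<le> nrm (J n x - x) \<omega>"
      using contr_nrm_diff[OF contr_funpow[OF contr_J], of "steps n s + steps n t" n "(J n ^^ d) x" x]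
      unfolding eq diff_0_right by eventually_elim simp
  qed
  show "conv (\<lambda>n. U n (s + t) x) (T s (T t x)) sequentially"
    using conv_add[OF 2 1] by simp
qed (use s t in simp)

text \<open>For \<open>x\<close> in \<open>D\<close> the vector \<open>A x\<close> may lie outside
  \<open>D\<close>, so no second-order remainder is available; \<open>z\<close> in \<open>D\<close>
  stands in for \<open>A x\<close>. Each increment of the scheme is \<open>2^-n\<close> times a
  power of \<open>J n\<close> applied to \<open>A x\<close>, and this power moves \<open>A x\<close>
  by at most \<open>2 * nrm (A x - z)\<close> plus elapsed time times
  \<open>nrm (A z)\<close>.\<close>

lemma nrm_J_pow_taylor:
  assumes x: "x \<in> D" and z: "z \<in> D"
  shows "AE \<omega> in M. nrm ((J n ^^ k) x - x - rs (real k / 2 ^ n) (A x)) \<omega>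
    \<le> real k / 2 ^ n * (2 * nrm (A x - z) \<omega> + real k / 2 ^ n * nrm (A z) \<omega>)"
proof (induction k)
  case 0
  show ?case using nrm_zero by eventually_elim simp
next
  case (Suc k)
  define y where "y = A x"
  have Jk: "contr (J n ^^ k)" for k by (intro contr_funpow contr_J)
  have Jy: "AE \<omega> in M. nrm ((J n ^^ Suc k) y - y) \<omega> \<le> 2 * nrm (y - z) \<omega> + real (Suc k) / 2 ^ n * nrm (A z) \<omega>"
    using nrm_diff_trans[of "(J n ^^ Suc k) y" y "(J n ^^ Suc k) z"] nrm_diff_trans[of "(J n ^^ Suc k) z" y z]
      contr_nrm_diff[OF Jk, of "Suc k" y z] nrm_J_pow_diff[OF z, of "Suc k" n] nrm_minus_commute[of y z]
    by eventually_elim simp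
  have "(J n ^^ Suc k) x - (J n ^^ k) x = (J n ^^ k) (J n x - x)"
    by (simp add: funpow_swap1 hom_diff[OF contr_hom[OF Jk]])
  also have "\<dots> = rs (1 / 2 ^ n) ((J n ^^ Suc k) y)"
    unfolding J_left[OF x] y_def funpow_Suc_right o_apply by (rule hom_sm[OF contr_hom[OF Jk]]) simp
  finally have "(J n ^^ Suc k) x = (J n ^^ k) x + rs (1 / 2 ^ n) ((J n ^^ Suc k) y)" by (simp add: algebra_simps)
  moreover have "rs (real (Suc k) / 2 ^ n) y = rs (real k / 2 ^ n) y + rs (1 / 2 ^ n) y"
    unfolding rs_add_left[symmetric] by (simp add: add_divide_distrib add.commute)
  ultimately have eq: "(J n ^^ Suc k) x - x - rs (real (Suc k) / 2 ^ n) (A x)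
      = ((J n ^^ k) x - x - rs (real k / 2 ^ n) (A x)) + rs (1 / 2 ^ n) ((J n ^^ Suc k) y - y)"
    unfolding y_def[symmetric] sm_diff_right[OF borel_measurable_const] by (simp only: algebra_simps)
  show ?case
    using Suc.IH Jy nrm_triangle[of "(J n ^^ k) x - x - rs (real k / 2 ^ n) (A x)" "rs (1 / 2 ^ n) ((J n ^^ Suc k) y - y)"]
      nrm_rs[of "1 / 2 ^ n" "(J n ^^ Suc k) y - y"] nrm_nonneg[of "A z"]
    unfolding eq y_def
  proof eventually_elim
    case (elim \<omega>)
    define a b where "a = 2 * nrm (A x - z) \<omega>" and "b = nrm (A z) \<omega>"
    define h :: real where "h = 1 / 2 ^ n"
    have h0: "0 < h" by (simp add: h_def)
    have k: "real k / 2 ^ n = real k * h" "real (Suc k) / 2 ^ n = real k * h + h"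
      by (simp_all add: h_def add_divide_distrib add.commute)
    have "h * nrm ((J n ^^ Suc k) (A x) - A x) \<omega> \<le> h * (a + (real k * h + h) * b)"
      using elim(2) h0 unfolding k a_def b_def by (intro mult_left_mono) auto
    moreover have "0 \<le> h * (real k * h) * b" using h0 elim(5) by (simp add: b_def)
    ultimately show ?case using elim(1,3,4) h0
      unfolding k a_def[symmetric] b_def[symmetric] h_def[symmetric] by (simp add: algebra_simps)
  qed
qed

lemma nrm_T_taylor:
  assumes x: "x \<in> D" and z: "z \<in> D" and t: "0 \<le> t"
  shows "AE \<omega> in M. nrm (T t x - x - rs t (A x)) \<omega> \<le> t * (2 * nrm (A x - z) \<omega> + t * nrm (A z) \<omega>)"
proof (rule nrm_limit_le)
  let ?q = "\<lambda>n. real (steps n t) / 2 ^ n"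
  have q: "?q n \<le> t" "t - (1 / 2) ^ n \<le> ?q n" for n
  proof -
    show "?q n \<le> t" using steps_le[OF t, of n] by (simp add: field_simps)
    have "t \<le> (real (steps n t) + 1) / 2 ^ n" using steps_gt[of n t] by (simp add: field_simps)
    then show "t - (1 / 2) ^ n \<le> ?q n" by (simp add: add_divide_distrib power_divide)
  qed
  have "?q \<longlonglongrightarrow> t"
  proof (rule tendsto_sandwich[OF _ _ _ tendsto_const])
    have "(\<lambda>n. t - (1 / 2) ^ n) \<longlonglongrightarrow> t - 0" by (intro tendsto_intros LIMSEQ_realpow_zero) auto
    then show "(\<lambda>n. t - (1 / 2) ^ n) \<longlonglongrightarrow> t" by simp
  qed (use q in auto)
  then show "conv (\<lambda>n. U n t x - x - rs (?q n) (A x)) (T t x - x - rs t (A x)) sequentially"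
    by (intro conv_diff conv_rs_left T_conv t conv_const)
  show "\<forall>\<^sub>F n in sequentially. AE \<omega> in M. nrm (U n t x - x - rs (?q n) (A x)) \<omega> \<le> t * (2 * nrm (A x - z) \<omega> + t * nrm (A z) \<omega>)"
  proof (rule always_eventually, rule allI)
    fix n
    show "AE \<omega> in M. nrm (U n t x - x - rs (?q n) (A x)) \<omega> \<le> t * (2 * nrm (A x - z) \<omega> + t * nrm (A z) \<omega>)"
      using nrm_J_pow_taylor[OF x z, of "steps n t" n] nrm_nonneg[of "A z"] nrm_nonneg[of "A x - z"]
      unfolding U_def
    proof eventually_elim
      case (elim \<omega>)
      have "?q n * (2 * nrm (A x - z) \<omega> + ?q n * nrm (A z) \<omega>) \<le> t * (2 * nrm (A x - z) \<omega> + t * nrm (A z) \<omega>)"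
        using q(1)[of n] elim t by (intro mult_mono add_mono) auto
      then show ?case using elim by linarith
    qed
  qed
qed auto

lemma T_diff_quotient_conv:
  assumes x: "x \<in> D"
  shows "conv (\<lambda>t. rs (1 / t) (T t x - x)) (A x) (at_right 0)"
proof (rule conv_epsI)
  fix e :: real assume e: "0 < e"
  obtain f where f: "\<And>n. f n \<in> D" "conv f (A x) sequentially" using dense by metis
  then obtain k where k: "rho (f k - A x) < e / 3"
    using conv_epsD[of f "A x" sequentially "e / 3"] e by (auto simp: eventually_sequentially)
  \<comment> \<open>\<open>z\<close> is fixed close to \<open>A x\<close> before \<open>t\<close>
    tends to 0; only then is \<open>t\<close> made small relative to \<open>A z\<close>.\<close>
  define z where "z = f k"
  have z: "z \<in> D" "rho (A x - z) < e / 3" using f k by (auto simp: z_def rho_minus_commute)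
  have "conv (\<lambda>t. rs t (A z)) (rs 0 (A z)) (at_right 0)"
    by (rule conv_rs_left) (rule tendsto_ident_at)
  then have "\<forall>\<^sub>F t in at_right 0. rho (rs t (A z) - rs 0 (A z)) < e / 3"
    by (rule conv_epsD) (use e in auto)
  moreover have "\<forall>\<^sub>F t in at_right 0. (0::real) < t" by (rule eventually_at_right_less)
  ultimately show "\<forall>\<^sub>F t in at_right 0. rho (rs (1 / t) (T t x - x) - A x) < e"
  proof eventually_elim
    case (elim t)
    then have t: "0 \<le> t" by simp
    have "rs (1 / t) (rs t (A x)) = A x" unfolding rs_rs using elim by simp
    then have eq: "rs (1 / t) (T t x - x) - A x = rs (1 / t) (T t x - x - rs t (A x))"
      by (simp add: sm_diff_right)
    \<comment> \<open>The factor 2 is written as two summands because \<open>pmag\<close> is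
      subadditive but not homogeneous.\<close>
    have "rho (rs (1 / t) (T t x - x) - A x) \<le> pmag (\<lambda>\<omega>. nrm (A x - z) \<omega> + (nrm (A x - z) \<omega> + nrm (rs t (A z)) \<omega>))"
    proof (rule rho_le_pmag)
      show "AE \<omega> in M. nrm (rs (1 / t) (T t x - x) - A x) \<omega> \<le> nrm (A x - z) \<omega> + (nrm (A x - z) \<omega> + nrm (rs t (A z)) \<omega>)"
        using nrm_T_taylor[OF x z(1) t] nrm_rs[of "1 / t" "T t x - x - rs t (A x)"] nrm_rs[of t "A z"]
        unfolding eq
      proof eventually_elim
        case e: (elim \<omega>)
        then have "1 / t * nrm (T t x - x - rs t (A x)) \<omega> \<le> 1 / t * (t * (2 * nrm (A x - z) \<omega> + t * nrm (A z) \<omega>))"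
          using t by (intro mult_left_mono) auto
        then show ?case using e elim by simp
      qed
    qed auto
    also have "\<dots> \<le> rho (A x - z) + (rho (A x - z) + rho (rs t (A z)))"
      unfolding rho_def by (intro order_trans[OF pmag_add_le] add_left_mono) auto
    also have "\<dots> < e" using z(2) elim by simp
    finally show ?case .
  qed
qed

text \<open>Orbits that start in \<open>D\<close> are Lipschitz at 0 with the random constant
  \<open>nrm (A z)\<close>, inherited from the scheme; density does the rest.\<close>

lemma T_orbit_conv: "conv (\<lambda>t. T t x) x (at_right 0)"
proof (rule contr_conv_dense[OF _ dense])
  show "\<forall>\<^sub>F t in at_right 0. contr (T t)"
    by (auto simp: eventually_at_right_field contr_T intro!: exI[of _ 1])
  fix z assume z: "z \<in> D"
  have 1: "conv (\<lambda>t. rs t (A z)) (rs 0 (A z)) (at_right 0)"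
    by (rule conv_rs_left) (rule tendsto_ident_at)
  have "conv (\<lambda>t. T t z - z) 0 (at_right 0)"
  proof (rule conv_rho_le)
    show "((\<lambda>t. rho (rs t (A z))) \<longlongrightarrow> 0) (at_right 0)" using 1 by (simp add: conv_iff)
    show "\<forall>\<^sub>F t in at_right 0. rho (T t z - z - 0) \<le> rho (rs t (A z))"
      unfolding eventually_at_right_field
    proof (intro exI[of _ 1] conjI allI impI)
      fix t :: real assume "0 < t"
      then have t: "0 \<le> t" by simp
      have "AE \<omega> in M. nrm (T t z - z) \<omega> \<le> t * nrm (A z) \<omega>"
      proof (rule nrm_limit_le)
        show "conv (\<lambda>n. U n t z - z) (T t z - z) sequentially" by (intro conv_diff T_conv t conv_const)
        show "\<forall>\<^sub>F n in sequentially. AE \<omega> in M. nrm (U n t z - z) \<omega> \<le> t * nrm (A z) \<omega>"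
        proof (rule always_eventually, rule allI)
          fix n
          show "AE \<omega> in M. nrm (U n t z - z) \<omega> \<le> t * nrm (A z) \<omega>"
            using nrm_J_pow_diff[OF z, of "steps n t" n] nrm_nonneg[of "A z"]
            unfolding U_def
          proof eventually_elim
            case (elim \<omega>)
            have "real (steps n t) / 2 ^ n \<le> t" using steps_le[OF t, of n] by (simp add: field_simps)
            then have "real (steps n t) / 2 ^ n * nrm (A z) \<omega> \<le> t * nrm (A z) \<omega>"
              using elim by (intro mult_right_mono)
            then show ?case using elim by linarith
          qed
        qed
      qed auto
      then show "rho (T t z - z - 0) \<le> rho (rs t (A z))"
        using nrm_rs[of t "A z"] t by (intro rho_mono) (auto elim: eventually_elim2)
    qed simp
  qed
  then show "conv (\<lambda>t. T t z) z (at_right 0)" by (rule conv_0I)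
qed

lemma contr_semigroup_T: "contr_semigroup M sm nrm T"
  by unfold_locales (auto simp: contr_T T_0 T_add T_orbit_conv)

end

section \<open>The Hille-Yosida theorem\<close>

lemma
  assumes "bij_betw (\<lambda>x. sm \<xi> x - A x) D UNIV"
  shows resolvent_in_domain: "resolvent sm A D \<xi> y \<in> D"
    and resolvent_right: "sm \<xi> (resolvent sm A D \<xi> y) - A (resolvent sm A D \<xi> y) = y"
    and resolvent_left: "x \<in> D \<Longrightarrow> resolvent sm A D \<xi> (sm \<xi> x - A x) = x"
proof -
  have inj: "inj_on (\<lambda>x. sm \<xi> x - A x) D" and y: "y \<in> (\<lambda>x. sm \<xi> x - A x) ` D"
    using assms by (auto simp: bij_betw_def)
  show "resolvent sm A D \<xi> y \<in> D"
    unfolding resolvent_def by (rule the_inv_into_into[OF inj y subset_refl])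
  show "sm \<xi> (resolvent sm A D \<xi> y) - A (resolvent sm A D \<xi> y) = y"
    unfolding resolvent_def by (rule f_the_inv_into_f[OF inj y])
  show "x \<in> D \<Longrightarrow> resolvent sm A D \<xi> (sm \<xi> x - A x) = x"
    unfolding resolvent_def by (rule the_inv_into_f_f[OF inj])
qed

lemma (in complete_RN_space) contraction_C0_semigroup_iff:
  "contraction_C0_semigroup M sm nrm T \<longleftrightarrow> contr_semigroup M sm nrm T"
proof
  assume T: "contraction_C0_semigroup M sm nrm T"
  then have C0: "C0_semigroup M sm nrm T" and op: "\<And>t. 0 \<le> t \<Longrightarrow> AE \<omega> in M. opnorm M nrm (T t) \<omega> \<le> 1"
    by (auto simp: contraction_C0_semigroup_def)
  then have b: "bounded_op M sm nrm (T t)" if "0 \<le> t" for t using that by (simp add: C0_semigroup_def)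
  show "contr_semigroup M sm nrm T"
  proof unfold_locales
    show "contr (T t)" if "0 \<le> t" for t
      using opnorm_le_iff[OF b[OF that], of "\<lambda>_. 1"] op[OF that] bounded_op_hom[OF b[OF that]]
      by (simp add: contr_def)
    show "T 0 x = x" for x using C0 by (simp add: C0_semigroup_def)
    show "T s (T t x) = T (s + t) x" if "0 \<le> s" "0 \<le> t" for s t x
      using C0 that unfolding C0_semigroup_def by (metis comp_apply)
    show "conv (\<lambda>t. T t x) x (at_right 0)" for x using C0 unfolding C0_semigroup_def by blast
  qed
next
  assume "contr_semigroup M sm nrm T"
  then interpret T: contr_semigroup M sm nrm T by simp
  have nrm_le: "AE \<omega> in M. nrm (T t x) \<omega> \<le> 1 * nrm x \<omega>" if "0 \<le> t" for t x
    using contr_nrm[OF T.contr_T[OF that]] by simp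
  have b: "bounded_op M sm nrm (T t)" if "0 \<le> t" for t
    by (rule bounded_opI[OF T.hom_T[OF that] _ nrm_le[OF that]]) simp
  have "AE \<omega> in M. opnorm M nrm (T t) \<omega> \<le> 1" if "0 \<le> t" for t
    using opnorm_le_iff[OF b[OF that], of "\<lambda>_. 1"] nrm_le[OF that] by simp
  then show "contraction_C0_semigroup M sm nrm T"
    unfolding contraction_C0_semigroup_def C0_semigroup_def using b T.T_cont by (auto simp: fun_eq_iff T.T_0 T.T_add)
qed

context contr_semigroup
begin

lemma generates_iff:
  "generates M sm nrm A D T \<longleftrightarrow> D = {x. \<exists>y. gen_lim x y} \<and> (\<forall>x\<in>D. gen_lim x (A x))"
  by (simp add: generates_def gen_lim_def)

lemma generator_closed_op:
  assumes "generates M sm nrm A D T"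
  shows "closed_op M nrm A D"
  unfolding closed_op_def
proof (intro allI impI)
  fix f x y
  assume f: "\<forall>n. f n \<in> D" "conv f x sequentially" "conv (\<lambda>n. A (f n)) y sequentially"
  have "gen_lim x y"
    by (rule gen_lim_closed[OF _ f(2,3)]) (use assms f(1) in \<open>auto simp: generates_iff\<close>)
  moreover from this have x: "x \<in> D" using assms by (auto simp: generates_iff)
  moreover from x have "gen_lim x (A x)" using assms by (simp add: generates_iff)
  ultimately show "x \<in> D \<and> A x = y" using gen_lim_unique by blast
qed

lemma generator_dense:
  assumes "generates M sm nrm A D T"
  shows "dense_set M nrm D"
  using gen_lim_dense assms unfolding dense_set_def generates_iff by blast

text \<open>Dissipativity gives injectivity and, evaluated at the resolvent of \<open>y\<close>, the
  bound with the random constant \<open>1 / Re \<xi>\<close>, from which continuity follows.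
  Surjectivity is the integral construction.\<close>

lemma generator_resolvent:
  assumes gen: "generates M sm nrm A D T" and A: "module_hom_on M sm D A"
    and [measurable]: "\<xi> \<in> borel_measurable M" and \<xi>: "AE \<omega> in M. 0 < Re (\<xi> \<omega>)"
  shows "in_resolvent_set M sm nrm A D \<xi> \<and> (AE \<omega> in M. opnorm M nrm (resolvent sm A D \<xi>) \<omega> \<le> 1 / Re (\<xi> \<omega>))"
proof -
  let ?B = "\<lambda>x. sm \<xi> x - A x" and ?R = "resolvent sm A D \<xi>"
  have A_lim: "gen_lim x (A x)" if "x \<in> D" for x using gen that by (simp add: generates_iff)
  have D_add: "x + y \<in> D" and A_add: "A (x + y) = A x + A y" if "x \<in> D" "y \<in> D" for x y
    using A that by (auto simp: module_hom_on_def)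
  have D_sm: "sm \<zeta> x \<in> D" and A_sm: "A (sm \<zeta> x) = sm \<zeta> (A x)" if "\<zeta> \<in> borel_measurable M" "x \<in> D" for \<zeta> x
    using A that by (auto simp: module_hom_on_def)
  have B_add: "?B (x + y) = ?B x + ?B y" if "x \<in> D" "y \<in> D" for x y
    using that by (simp add: A_add sm_add_right algebra_simps)
  have B_sm: "?B (sm \<zeta> x) = sm \<zeta> (?B x)" if "\<zeta> \<in> borel_measurable M" "x \<in> D" for \<zeta> x
    using that by (simp add: A_sm sm_diff_right sm_commute)
  have lower: "AE \<omega> in M. Re (\<xi> \<omega>) * nrm x \<omega> \<le> nrm (?B x) \<omega>" if "x \<in> D" for x
    by (rule gen_lim_dissipative[OF _ A_lim[OF that]]) simp
  have inj: "inj_on ?B D"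
  proof (rule inj_onI)
    fix x x' assume x: "x \<in> D" "x' \<in> D" and eq: "?B x = ?B x'"
    have m: "x - x' = x + sm (\<lambda>_. - 1) x'" by (simp add: sm_minus_one)
    have xx: "x - x' \<in> D" unfolding m by (intro D_add D_sm x) simp
    have "?B (x - x') + ?B x' = ?B x" using B_add[OF xx x(2)] by simp
    then have "?B (x - x') = 0" using eq by simp
    then have "AE \<omega> in M. Re (\<xi> \<omega>) * nrm (x - x') \<omega> \<le> nrm 0 \<omega>"
      using lower[OF xx] by simp
    then have "AE \<omega> in M. nrm (x - x') \<omega> = 0"
      using nrm_zero nrm_nonneg[of "x - x'"] \<xi>
      by eventually_elim (metis antisym mult_le_0_iff not_le)
    then show "x = x'" using nrm_eq_0D by fastforce
  qed
  have surj: "y \<in> ?B ` D" for y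
  proof -
    obtain z where z: "gen_lim z (sm \<xi> z - y)" using gen_lim_resolvent_surj[OF _ \<xi>, of y] by auto
    then have zD: "z \<in> D" using gen by (auto simp: generates_iff)
    then have "A z = sm \<xi> z - y" using gen_lim_unique[OF A_lim z] by simp
    then have "y = ?B z" by simp
    then show ?thesis using zD by (rule image_eqI)
  qed
  have bij: "bij_betw ?B D UNIV"
    unfolding bij_betw_def using inj surj by auto
  note inverse = resolvent_in_domain resolvent_right resolvent_left
  note R = inverse[where sm=sm and \<xi>=\<xi>, OF bij]
  note R_in = R(1) and R_eq = R(2) and R_left = R(3)
  have R_eqI: "?R y = x" if "x \<in> D" "?B x = y" for x y
    using R_left[OF that(1)] that(2) by simp
  have hom_R: "hom ?R"
    unfolding hom_def
  proof (intro conjI allI impI)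
    show "?R (x + y) = ?R x + ?R y" for x y
      by (rule R_eqI[OF D_add[OF R_in R_in]]) (simp only: B_add[OF R_in R_in] R_eq)
    show "?R (sm \<zeta> x) = sm \<zeta> (?R x)" if "\<zeta> \<in> borel_measurable M" for \<zeta> x
      by (rule R_eqI[OF D_sm[OF that R_in]]) (simp only: B_sm[OF that R_in] R_eq)
  qed
  have R_nrm: "AE \<omega> in M. nrm (?R y) \<omega> \<le> 1 / Re (\<xi> \<omega>) * nrm y \<omega>" for y
    using lower[OF R_in[of y]] \<xi> unfolding R_eq by eventually_elim (simp add: field_simps)
  have bd: "bounded_op M sm nrm ?R"
    by (rule bounded_opI[OF hom_R _ R_nrm]) measurable
  have "AE \<omega> in M. opnorm M nrm ?R \<omega> \<le> 1 / Re (\<xi> \<omega>)"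
  proof -
    have "AE \<omega> in M. 0 \<le> 1 / Re (\<xi> \<omega>)" using \<xi> by eventually_elim simp
    then show ?thesis using R_nrm opnorm_le_iff[OF bd, of "\<lambda>\<omega>. 1 / Re (\<xi> \<omega>)"] by simp
  qed
  then show ?thesis using bij bd by (simp add: in_resolvent_set_def)
qed

end

context complete_RN_space
begin

lemma resolvent_real_contr:
  assumes "in_resolvent_set M sm nrm A D (\<lambda>\<omega>. complex_of_real (\<xi> \<omega>))" and [measurable]: "\<xi> \<in> borel_measurable M"
  shows "(AE \<omega> in M. opnorm M nrm (\<lambda>x. sm (\<lambda>\<omega>. complex_of_real (\<xi> \<omega>)) (resolvent sm A D (\<lambda>\<omega>. complex_of_real (\<xi> \<omega>)) x)) \<omega> \<le> 1)
    \<longleftrightarrow> contr (\<lambda>x. sm (\<lambda>\<omega>. complex_of_real (\<xi> \<omega>)) (resolvent sm A D (\<lambda>\<omega>. complex_of_real (\<xi> \<omega>)) x))"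
proof -
  let ?\<xi> = "\<lambda>\<omega>. complex_of_real (\<xi> \<omega>)"
  let ?R = "resolvent sm A D ?\<xi>"
  have R: "bounded_op M sm nrm ?R" using assms(1) by (simp add: in_resolvent_set_def)
  have b: "bounded_op M sm nrm (\<lambda>x. sm ?\<xi> (?R x))"
    using R unfolding bounded_op_def by (auto simp: sm_add_right sm_commute conv_sm)
  show ?thesis
    using opnorm_le_iff[OF b, of "\<lambda>_. 1"] bounded_op_hom[OF b] by (simp add: contr_def)
qed

text \<open>The two inverse relations of the resolvent at \<open>2 ^ n\<close>, scaled by
  \<open>2^-n\<close>, are the relations of an implicit Euler step.\<close>

lemma resolvent_family_of_resolvents:
  assumes A: "module_hom_on M sm D A" and dense: "dense_set M nrm D"
    and res: "\<And>n. in_resolvent_set M sm nrm A D (\<lambda>_. complex_of_real (2 ^ n))"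
    and contr: "\<And>n. contr (\<lambda>x. rs (2 ^ n) (resolvent sm A D (\<lambda>_. complex_of_real (2 ^ n)) x))"
  shows "resolvent_family M sm nrm A D (\<lambda>n x. rs (2 ^ n) (resolvent sm A D (\<lambda>_. complex_of_real (2 ^ n)) x))"
proof unfold_locales
  fix n x
  let ?B = "\<lambda>x. rs (2 ^ n) x - A x" and ?R = "resolvent sm A D (\<lambda>_. complex_of_real (2 ^ n))"
  have D_sm: "sm \<zeta> x \<in> D" and A_sm: "A (sm \<zeta> x) = sm \<zeta> (A x)" if "\<zeta> \<in> borel_measurable M" "x \<in> D" for \<zeta> x
    using A that by (auto simp: module_hom_on_def)
  have bij: "bij_betw ?B D UNIV" using res[of n] by (simp add: in_resolvent_set_def)
  note inverse = resolvent_in_domain resolvent_right resolvent_left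
  note R = inverse[where sm=sm and \<xi>="\<lambda>_. complex_of_real (2 ^ n)", OF bij]
  note R_in = R(1) and R_eq = R(2) and R_left = R(3)
  have hR: "hom ?R" using res[of n] by (simp add: in_resolvent_set_def bounded_op_hom)
  show "rs (2 ^ n) (?R x) \<in> D" by (intro D_sm R_in) simp
  have inv: "rs (1 / 2 ^ n) (rs (2 ^ n) y) = y" for y unfolding rs_rs by simp
  have "rs (2 ^ n) (?R x) - x = A (?R x)" using R_eq[of x] by (simp add: algebra_simps)
  then show "rs (2 ^ n) (?R x) - x = rs (1 / 2 ^ n) (A (rs (2 ^ n) (?R x)))"
    using A_sm[of "\<lambda>_. complex_of_real (2 ^ n)", OF _ R_in[of x]] inv[of "A (?R x)"] by simp
  show "rs (2 ^ n) (?R x) - x = rs (1 / 2 ^ n) (rs (2 ^ n) (?R (A x)))" if "x \<in> D"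
    using R_left[OF that] unfolding inv hom_diff[OF hR] hom_sm[OF hR borel_measurable_const]
    by (simp add: algebra_simps)
qed (use dense contr in \<open>auto simp: dense_set_def\<close>)

end

lemma (in resolvent_family) generates_T: "generates M sm nrm A D T"
proof -
  interpret T: contr_semigroup M sm nrm T by (rule contr_semigroup_T)
  have A_lim: "T.gen_lim x (A x)" if "x \<in> D" for x
    using T_diff_quotient_conv[OF that] by (simp add: T.gen_lim_def)
  have "x \<in> D" if xy: "T.gen_lim x y" for x y
  proof -
    \<comment> \<open>\<open>J 0\<close> has step \<open>2^0 = 1\<close> and inverts
      \<open>I - A\<close>. Thus \<open>x'\<close> solves with \<open>A\<close> the equation that
      \<open>x\<close> solves with the generator, and dissipativity at \<open>1\<close> identifies
      the two.\<close>
    define x' where "x' = J 0 (x - y)"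
    have x': "x' \<in> D" "x' - (x - y) = A x'" using J_right[of 0 "x - y"] by (auto simp: x'_def J_in_D)
    have "T.gen_lim (x - x') (y - A x')"
      unfolding T.gen_lim_def
    proof (rule conv_cong)
      show "conv (\<lambda>t. rs (1 / t) (T t x - x) - rs (1 / t) (T t x' - x')) (y - A x') (at_right 0)"
        using xy A_lim[OF x'(1)] unfolding T.gen_lim_def by (rule conv_diff)
      show "\<forall>\<^sub>F t in at_right 0. rs (1 / t) (T t (x - x') - (x - x')) = rs (1 / t) (T t x - x) - rs (1 / t) (T t x' - x')"
        unfolding eventually_at_right_field
        by (intro exI[of _ 1]) (auto simp: hom_diff[OF T.hom_T] sm_diff_right)
    qed
    from T.gen_lim_dissipative[OF _ this, of "\<lambda>_. 1"]
    have "AE \<omega> in M. nrm (x - x') \<omega> \<le> nrm (x - x' - (y - A x')) \<omega>" by simp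
    moreover have "x - x' - (y - A x') = 0" using x'(2) by (simp add: algebra_simps)
    ultimately have "AE \<omega> in M. nrm (x - x') \<omega> \<le> nrm 0 \<omega>" by simp
    then have "AE \<omega> in M. nrm (x - x') \<omega> = 0"
      using nrm_zero nrm_nonneg[of "x - x'"] by eventually_elim simp
    then have "x - x' = 0" by (rule nrm_eq_0D)
    then show ?thesis using x'(1) by simp
  qed
  then show ?thesis unfolding T.generates_iff using A_lim by auto
qed

theorem theorem4p4:
  fixes M :: "'w measure"
    and sm :: "('w \<Rightarrow> complex) \<Rightarrow> 's::ab_group_add \<Rightarrow> 's"
    and nrm :: "'s \<Rightarrow> 'w \<Rightarrow> real"
    and A :: "'s \<Rightarrow> 's" and D :: "'s set"
  assumes "prob_space M"
    and "RN_module M sm nrm"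
    and "rn_complete M nrm"
    and "module_hom_on M sm D A"
  shows "((\<exists>T. contraction_C0_semigroup M sm nrm T \<and> generates M sm nrm A D T)
          \<longleftrightarrow>
          (closed_op M nrm A D \<and> dense_set M nrm D \<and>
           (\<forall>\<xi> :: 'w \<Rightarrow> real. \<xi> \<in> borel_measurable M \<and> (AE \<omega> in M. 0 < \<xi> \<omega>) \<longrightarrow>
              in_resolvent_set M sm nrm A D (\<lambda>\<omega>. complex_of_real (\<xi> \<omega>)) \<and>
              (AE \<omega> in M. opnorm M nrm
                 (\<lambda>x. sm (\<lambda>\<omega>. complex_of_real (\<xi> \<omega>))
                        (resolvent sm A D (\<lambda>\<omega>. complex_of_real (\<xi> \<omega>)) x)) \<omega> \<le> 1))))
       \<and>
       ((closed_op M nrm A D \<and> dense_set M nrm D \<and>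
           (\<forall>\<xi> :: 'w \<Rightarrow> real. \<xi> \<in> borel_measurable M \<and> (AE \<omega> in M. 0 < \<xi> \<omega>) \<longrightarrow>
              in_resolvent_set M sm nrm A D (\<lambda>\<omega>. complex_of_real (\<xi> \<omega>)) \<and>
              (AE \<omega> in M. opnorm M nrm
                 (\<lambda>x. sm (\<lambda>\<omega>. complex_of_real (\<xi> \<omega>))
                        (resolvent sm A D (\<lambda>\<omega>. complex_of_real (\<xi> \<omega>)) x)) \<omega> \<le> 1)))
          \<longleftrightarrow>
          (closed_op M nrm A D \<and> dense_set M nrm D \<and>
           (\<forall>\<xi> :: 'w \<Rightarrow> complex. \<xi> \<in> borel_measurable M \<and> (AE \<omega> in M. 0 < Re (\<xi> \<omega>)) \<longrightarrow>
              in_resolvent_set M sm nrm A D \<xi> \<and>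
              (AE \<omega> in M. opnorm M nrm (resolvent sm A D \<xi>) \<omega> \<le> 1 / Re (\<xi> \<omega>)))))"
proof -
  interpret prob_space M by (rule assms(1))
  interpret complete_RN_space M sm nrm by unfold_locales (use assms in auto)
  let ?a = "\<exists>T. contraction_C0_semigroup M sm nrm T \<and> generates M sm nrm A D T"
  let ?b = "closed_op M nrm A D \<and> dense_set M nrm D \<and>
           (\<forall>\<xi> :: 'w \<Rightarrow> real. \<xi> \<in> borel_measurable M \<and> (AE \<omega> in M. 0 < \<xi> \<omega>) \<longrightarrow>
              in_resolvent_set M sm nrm A D (\<lambda>\<omega>. complex_of_real (\<xi> \<omega>)) \<and>
              (AE \<omega> in M. opnorm M nrm
                 (\<lambda>x. sm (\<lambda>\<omega>. complex_of_real (\<xi> \<omega>))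
                        (resolvent sm A D (\<lambda>\<omega>. complex_of_real (\<xi> \<omega>)) x)) \<omega> \<le> 1))"
  let ?c = "closed_op M nrm A D \<and> dense_set M nrm D \<and>
           (\<forall>\<xi> :: 'w \<Rightarrow> complex. \<xi> \<in> borel_measurable M \<and> (AE \<omega> in M. 0 < Re (\<xi> \<omega>)) \<longrightarrow>
              in_resolvent_set M sm nrm A D \<xi> \<and>
              (AE \<omega> in M. opnorm M nrm (resolvent sm A D \<xi>) \<omega> \<le> 1 / Re (\<xi> \<omega>)))"
  have ac: ?c if a: ?a
  proof -
    obtain T where T: "contraction_C0_semigroup M sm nrm T" and gen: "generates M sm nrm A D T" using a by blast
    interpret T: contr_semigroup M sm nrm T using T by (simp add: contraction_C0_semigroup_iff)
    show ?c
      using T.generator_closed_op[OF gen] T.generator_dense[OF gen] T.generator_resolvent[OF gen assms(4)] by blast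
  qed
  have cb: ?b if c: ?c
  proof (intro conjI allI impI)
    fix \<xi> :: "'w \<Rightarrow> real"
    assume "\<xi> \<in> borel_measurable M \<and> (AE \<omega> in M. 0 < \<xi> \<omega>)"
    then have m [measurable]: "\<xi> \<in> borel_measurable M" and pos: "AE \<omega> in M. 0 < \<xi> \<omega>" by auto
    let ?\<xi> = "\<lambda>\<omega>. complex_of_real (\<xi> \<omega>)"
    let ?R = "resolvent sm A D ?\<xi>"
    have "?\<xi> \<in> borel_measurable M \<and> (AE \<omega> in M. 0 < Re (?\<xi> \<omega>))" using pos by simp
    from c[THEN conjunct2, THEN conjunct2, rule_format, OF this]
    have res: "in_resolvent_set M sm nrm A D ?\<xi>" and op: "AE \<omega> in M. opnorm M nrm ?R \<omega> \<le> 1 / \<xi> \<omega>"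
      by simp_all
    show "in_resolvent_set M sm nrm A D ?\<xi>" by (rule res)
    have R: "bounded_op M sm nrm ?R" using res by (simp add: in_resolvent_set_def)
    have le: "AE \<omega> in M. nrm (?R x) \<omega> \<le> 1 / \<xi> \<omega> * nrm x \<omega>" for x
    proof -
      have "AE \<omega> in M. 0 \<le> 1 / \<xi> \<omega>" using pos by eventually_elim simp
      then show ?thesis using opnorm_le_iff[OF R, of "\<lambda>\<omega>. 1 / \<xi> \<omega>"] op by simp
    qed
    \<comment> \<open>For a real \<xi> the factor \<xi> cancels the random constant
      \<open>1 / \<xi>\<close> of the resolvent bound.\<close>
    have "contr (\<lambda>x. sm ?\<xi> (?R x))"
      unfolding contr_def
    proof (intro conjI allI)
      show "hom (\<lambda>x. sm ?\<xi> (?R x))"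
        using bounded_op_hom[OF R] unfolding hom_def by (auto simp: sm_add_right sm_commute)
      show "AE \<omega> in M. nrm (sm ?\<xi> (?R x)) \<omega> \<le> nrm x \<omega>" for x
        using nrm_sm_real[OF m, of "?R x"] le[of x] pos by eventually_elim (simp add: field_simps)
    qed
    then show "AE \<omega> in M. opnorm M nrm (\<lambda>x. sm ?\<xi> (?R x)) \<omega> \<le> 1"
      using resolvent_real_contr[OF res m] by simp
  qed (use c in auto)
  have ba: ?a if b: ?b
  proof -
    \<comment> \<open>The scalars \<open>2 ^ n\<close> are constant in \<omega>, so the Euler steps
      have a deterministic length.\<close>
    have res: "in_resolvent_set M sm nrm A D (\<lambda>_. complex_of_real (2 ^ n))"
      and op: "AE \<omega> in M. opnorm M nrm (\<lambda>x. rs (2 ^ n) (resolvent sm A D (\<lambda>_. complex_of_real (2 ^ n)) x)) \<omega> \<le> 1"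
      for n :: nat
      using b[THEN conjunct2, THEN conjunct2, rule_format, of "\<lambda>_. 2 ^ n"] by auto
    have contr: "contr (\<lambda>x. rs (2 ^ n) (resolvent sm A D (\<lambda>_. complex_of_real (2 ^ n)) x))" for n
      using resolvent_real_contr[OF res, of n] op[of n] by simp
    have dense: "dense_set M nrm D" using b by blast
    interpret F: resolvent_family M sm nrm A D "\<lambda>n x. rs (2 ^ n) (resolvent sm A D (\<lambda>_. complex_of_real (2 ^ n)) x)"
      by (rule resolvent_family_of_resolvents[OF assms(4) dense res contr])
    have "contraction_C0_semigroup M sm nrm F.T"
      unfolding contraction_C0_semigroup_iff by (rule F.contr_semigroup_T)
    then show ?a using F.generates_T by blast
  qed
  \<comment> \<open>The cycle from (a) to (c) to (b) and back to (a) yields both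
    equivalences.\<close>
  show ?thesis
    by (rule conjI, rule iffI, erule cb[OF ac], erule ba, rule iffI, erule ac[OF ba], erule cb)
qed

end
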